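(* Let $g \in L^2(\mathbb{R})$ have compact support, and let $T, S \subset \mathbb{R}$ be two countable sets such that the Gabor system $$\mathbf{G}(g,T,S) = \{ g(x-t)\, e^{2\pi i s x} : t \in T,\ s \in S\}$$ is an orthonormal basis in $L^2(\mathbb{R})$. Then both $T$ and $S$ must be periodic sets, i.e. there exist real numbers $a, b > 0$, positive integers $n, m$, and real numbers $t_1,\dots,t_n$ and $s_1,\dots,s_m$ such that $$T = a\mathbb{Z} + \{t_1,\dots,t_n\}, \qquad S = b\mathbb{Z} + \{s_1,\dots,s_m\}.$$
   Context: The Gabor system $\mathbf{G}(g,T,S)$ is the family of functions of $x \in \mathbb{R}$ indexed by the pairs $(t,s) \in T \times S$. For sets $A, B \subset \mathbb{R}$, $A + B = \{a+b : a \in A,\ b \in B\}$. The function $g$ is complex-valued. *)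

theory Defs
  imports "HOL-Analysis.Analysis" "HOL-Library.Set_Algebras"
begin

text \<open>
  Elements of \<open>L\<^sup>2(\<real>)\<close> are represented by functions, with no quotient by equality almost
  everywhere; every notion below is invariant under changing a function on a null set.
\<close>

definition L2 :: "(real \<Rightarrow> complex) set" where
  "L2 = {f \<in> borel_measurable lebesgue. integrable lebesgue (\<lambda>x. (norm (f x))\<^sup>2)}"

definition L2_inner :: "(real \<Rightarrow> complex) \<Rightarrow> (real \<Rightarrow> complex) \<Rightarrow> complex" where
  "L2_inner f h = (LINT x|lebesgue. f x * cnj (h x))"

definition L2_norm :: "(real \<Rightarrow> complex) \<Rightarrow> real" where
  "L2_norm f = sqrt (LINT x|lebesgue. (norm (f x))\<^sup>2)"

text \<open>The smallest closed set outside of which \<open>f\<close> vanishes almost everywhere.\<close>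

definition ess_support :: "(real \<Rightarrow> complex) \<Rightarrow> real set" where
  "ess_support f = \<Inter> {K. closed K \<and> (AE x in lebesgue. x \<notin> K \<longrightarrow> f x = 0)}"

text \<open>
  Orthonormal bases are indexed families, so orthogonality is required for distinct indices.
  The last clause says that the finite linear combinations are dense in \<open>L\<^sup>2(\<real>)\<close>.
\<close>

definition L2_orthonormal_basis :: "'i set \<Rightarrow> ('i \<Rightarrow> real \<Rightarrow> complex) \<Rightarrow> bool" where
  "L2_orthonormal_basis I e \<longleftrightarrow>
     (\<forall>i\<in>I. e i \<in> L2) \<and>
     (\<forall>i\<in>I. \<forall>j\<in>I. L2_inner (e i) (e j) = (if i = j then 1 else 0)) \<and>
     (\<forall>f\<in>L2. \<forall>\<epsilon>>0. \<exists>J c. finite J \<and> J \<subseteq> I \<and>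
        L2_norm (\<lambda>x. f x - (\<Sum>j\<in>J. c j * e j x)) < \<epsilon>)"

definition gabor :: "(real \<Rightarrow> complex) \<Rightarrow> real \<times> real \<Rightarrow> real \<Rightarrow> complex" where
  "gabor g = (\<lambda>(t, s) x. g (x - t) * exp (2 * of_real pi * \<i> * of_real s * of_real x))"

text \<open>The sum of sets is the elementwise sum \<open>A + B = {a + b | a b. a \<in> A \<and> b \<in> B}\<close>.\<close>

definition periodic_set :: "real set \<Rightarrow> bool" where
  "periodic_set A \<longleftrightarrow>
     (\<exists>(a::real) (n::nat) (t::nat \<Rightarrow> real). a > 0 \<and> n > 0 \<and>
        A = range (\<lambda>k::int. a * of_int k) + t ` {1..n})"

end

theory Submission
  imports Defs "HOL-Complex_Analysis.Complex_Analysis"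
begin

text \<open>
  A locally finite, relatively dense set \<open>A\<close> is periodic as soon as \<open>A - A\<close> is locally finite and a
  long enough window of \<open>A\<close> determines the next points. Both properties are checked for \<open>T\<close> and \<open>S\<close>.

  Let \<open>Q u\<close> be the orthogonal projection onto the closed span of the functions
  \<open>exp (2 \<pi> i s x) g (x - u)\<close>, \<open>s \<in> S\<close>. Then \<open>Q (u + x)\<close> is conjugate to \<open>Q u\<close> by a translation,
  and the projections \<open>Q t\<close>, \<open>t \<in> T\<close>, are mutually orthogonal with sum the identity. As \<open>g\<close> has
  compact support, the next point of \<open>T\<close> is the place where the sum of the previous projections
  ceases to be the identity. If two windows of \<open>T\<close> are close, with \<open>t\<close> displaced by \<open>\<delta> t\<close>, then the sum
  of the integrals of \<open>Q\<close> over the intervals from \<open>t\<close> to \<open>t + \<delta> t\<close> commutes with translations, while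
  \<open>g (x - t)\<close> is nearly an eigenvector with eigenvalue \<open>\<delta> t\<close>; hence \<open>\<delta>\<close> is nearly constant. Since
  \<open>\<delta>\<close> grows at most exponentially from a window to the adjacent ones, it is exactly constant.
  So \<open>T\<close> has finitely many window patterns.

  The differences of \<open>S\<close> are zeros of the Fourier transform of \<open>|g|\<^sup>2\<close>, an entire function, so
  \<open>S - S\<close> is locally finite. Modulations of one test function give a nonnegative integrable
  \<open>W\<close> whose translates along \<open>S\<close> sum to a constant. Therefore the Dirac comb of \<open>S\<close> has a spectral
  gap around \<open>0\<close>, and two limits of translates of \<open>S\<close> which agree on a left half line coincide; by
  compactness, finite windows of \<open>S\<close> determine the next points.
\<close>

section \<open>Periodicity of deterministic point sets\<close>

text \<open>The two sets meet the criterion from opposite ends. For \<open>T\<close>, compact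
  support makes the future depend on a bounded past at once, but \<open>E g0\<close>, which vanishes
  on differences of distinct points, is only known to be continuous: its zeros might accumulate and
  windows of \<open>T\<close> might deform continuously. For \<open>S\<close>, differences are zeros
  of an analytic function, but the energy is not compactly supported in frequency, so a bounded past
  can only be reached through a limiting argument.

  The projections are used through their quadratic forms alone: Parseval becomes the scalar identity
  \<open>E_tile\<close>, valid for every real shift, and integrated projections become primitives of
  \<open>E f\<close>. Two matched windows may also differ by a common small shift; it is removed
  first and shown to vanish only at the end, because both windows contain their own centre. The
  exponential growth of displacements is harmless since its constant depends on the separation and
  the test functions alone, and the closeness of the windows is chosen afterwards. A spectral gap
  excludes one-sided sums because these extend holomorphically to a half plane.\<close>

lemma periodic_setI:
  fixes A :: "real set"
  assumes p: "p > 0" and per: "\<And>x. x \<in> A \<longleftrightarrow> x + p \<in> A"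
    and fin: "finite (A \<inter> {0..<p})" and ne: "A \<noteq> {}"
  shows "periodic_set A"
proof -
  have pern: "x \<in> A \<longleftrightarrow> x + p * of_nat n \<in> A" for x n
  proof (induction n)
    case (Suc n)
    then show ?case using per[of "x + p * of_nat n"] by (simp add: algebra_simps)
  qed simp
  have peri: "x \<in> A \<longleftrightarrow> x + p * of_int k \<in> A" for x k
  proof (cases "k \<ge> 0")
    case True
    then show ?thesis using pern[of x "nat k"] by simp
  next
    case False
    then show ?thesis using pern[of "x + p * of_int k" "nat (-k)"] by (simp add: algebra_simps)
  qed
  define F where "F = A \<inter> {0..<p}"
  have red: "\<exists>k::int. x - p * of_int k \<in> {0..<p}" for x
  proof
    show "x - p * of_int \<lfloor>x / p\<rfloor> \<in> {0..<p}"
      using p floor_divide_lower[of p x] floor_divide_upper[of p x] by (auto simp: algebra_simps)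
  qed
  have eq: "A = range (\<lambda>k::int. p * of_int k) + F"
  proof (intro set_eqI iffI)
    fix x assume x: "x \<in> A"
    obtain k :: int where k: "x - p * of_int k \<in> {0..<p}" using red by blast
    have "x - p * of_int k \<in> A" using peri[of x "-k"] x by simp
    with k have "x - p * of_int k \<in> F" by (simp add: F_def)
    then show "x \<in> range (\<lambda>k::int. p * of_int k) + F"
      using set_plus_intro[of "p * of_int k" "range (\<lambda>k::int. p * of_int k)" "x - p * of_int k" F, OF rangeI] by simp
  next
    fix x assume "x \<in> range (\<lambda>k::int. p * of_int k) + F"
    then obtain k :: int and y where "x = p * of_int k + y" "y \<in> F" by (auto elim!: set_plus_elim)
    then show "x \<in> A" using peri[of y k] by (simp add: F_def algebra_simps)
  qed
  have "F \<noteq> {}" using ne eq by (auto simp: set_plus_def)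
  moreover have "finite F" using fin by (simp add: F_def)
  ultimately have "card F > 0" by (simp add: card_gt_0_iff)
  moreover obtain t where "bij_betw t {1..card F} F"
    using ex_bij_betw_nat_finite_1[OF \<open>finite F\<close>] by blast
  ultimately show ?thesis unfolding periodic_set_def
    using p eq by (metis bij_betw_imp_surj_on)
qed

text \<open>
  Two points with the same pattern to their left have the same future, so \<open>A\<close> is eventually
  periodic to the right of each of them. Since only finitely many periods occur, one of them works
  arbitrarily far to the left.
\<close>

lemma periodic_set_if_deterministic:
  fixes A :: "real set"
  assumes diff: "\<And>r. finite ({a - b | a b. a \<in> A \<and> b \<in> A} \<inter> {-r..r})"
    and dense: "\<And>x. A \<inter> {x<..x+M} \<noteq> {}"
    and det: "\<And>a b. a \<in> A \<Longrightarrow> b \<in> A \<Longrightarrow> (\<And>d. d \<in> {-N..0} \<Longrightarrow> a + d \<in> A \<longleftrightarrow> b + d \<in> A) \<Longrightarrow>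
      (\<And>d. d \<in> {0..M} \<Longrightarrow> a + d \<in> A \<longleftrightarrow> b + d \<in> A)"
  shows "periodic_set A"
proof -
  define D where "D = {a - b | a b. a \<in> A \<and> b \<in> A}"
  have finD: "finite (D \<inter> {-r..r})" for r using diff by (simp add: D_def)
  have inD: "d \<in> D" if "a \<in> A" "a + d \<in> A" for a d
    using that unfolding D_def by force
  have M: "M > 0" using dense[of 0] by force
  have forward: "a + d \<in> A \<longleftrightarrow> b + d \<in> A"
    if a: "a \<in> A" and b: "b \<in> A" and ab: "\<And>d. d \<in> {-N..0} \<Longrightarrow> a + d \<in> A \<longleftrightarrow> b + d \<in> A" and d: "d \<ge> 0"
    for a b d
  proof (rule ccontr)
    assume neg: "\<not> ?thesis"
    \<comment> \<open>\<open>Z\<close> embeds in the locally finite set \<open>D\<close>, so a first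
      disagreement \<open>m\<close> exists.\<close>
    define Z where "Z = {x \<in> {0..d}. \<not> (a + x \<in> A \<longleftrightarrow> b + x \<in> A)}"
    have "Z \<subseteq> D \<inter> {-d..d}" using inD[OF a] inD[OF b] by (auto simp: Z_def)
    then have finZ: "finite Z" using finD finite_subset by blast
    have "d \<in> Z" using neg d by (simp add: Z_def)
    define m where "m = Min Z"
    have mZ: "m \<in> Z" unfolding m_def using finZ \<open>d \<in> Z\<close> by (intro Min_in) auto
    have minm: "x \<notin> Z" if "x < m" for x using finZ that by (metis Min_le m_def not_le)
    have "m \<noteq> 0" using mZ a b by (auto simp: Z_def)
    then have mpos: "m > 0" and md: "m \<le> d" using mZ by (auto simp: Z_def)
    define Y where "Y = {x \<in> {0..<m}. a + x \<in> A}"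
    have "Y \<subseteq> D \<inter> {-m..m}" using inD[OF a] by (auto simp: Y_def)
    then have finY: "finite Y" using finD finite_subset by blast
    have "0 \<in> Y" using a mpos by (simp add: Y_def)
    \<comment> \<open>The hypothesis \<open>det\<close> is applied again at the last point before
      the first disagreement. Density puts \<open>m\<close> within \<open>M\<close> of that point,
      and the agreement known so far supplies the required past there.\<close>
    define y where "y = Max Y"
    have yY: "y \<in> Y" unfolding y_def using finY \<open>0 \<in> Y\<close> by (intro Max_in) auto
    have maxy: "x \<le> y" if "x \<in> Y" for x using finY that by (simp add: y_def)
    have y: "0 \<le> y" "y < m" "a + y \<in> A" using yY by (auto simp: Y_def)
    have bya: "b + y \<in> A" using minm[of y] y md by (auto simp: Z_def)
    obtain z where z: "z \<in> A" "a + y < z" "z \<le> a + y + M" using dense[of "a + y"] by auto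
    have "m \<le> y + M"
    proof (rule ccontr)
      assume "\<not> m \<le> y + M"
      then have "z - a \<in> Y" using z y by (auto simp: Y_def)
      then show False using maxy z by force
    qed
    moreover have "a + y + e \<in> A \<longleftrightarrow> b + y + e \<in> A" if "e \<in> {-N..0}" for e
    proof (cases "y + e \<ge> 0")
      case True
      then show ?thesis using minm[of "y + e"] that y md by (auto simp: Z_def add.assoc)
    next
      case False
      then show ?thesis using ab[of "y + e"] that y by (auto simp: add.assoc)
    qed
    ultimately have "a + y + (m - y) \<in> A \<longleftrightarrow> b + y + (m - y) \<in> A"
      using det[of "a + y" "b + y" "m - y"] y bya by simp
    then show False using mZ by (auto simp: Z_def)
  qed
  define pat where "pat a = {d \<in> {-N..0}. a + d \<in> A}" for a
  have "pat ` A \<subseteq> Pow (D \<inter> {-N..N})"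
    using inD by (auto simp: pat_def)
  then have finpat: "finite (pat ` A)" using finD finite_subset by blast
  define k where "k = card (pat ` A)"
  define P where "P = (of_nat k + 1) * M"
  \<comment> \<open>The bound \<open>P\<close> on the period is the same for all \<open>n\<close>:
    among \<open>k + 1\<close> points in successive blocks of length \<open>M\<close>, two share one
    of the \<open>k\<close> patterns. So finitely many periods are in play however far left
    \<open>a\<close> is taken.\<close>
  define Q where "Q n a p \<longleftrightarrow> a \<in> A \<and> a \<le> - of_nat n \<and> p > 0 \<and> p \<in> D \<inter> {-P..P}
    \<and> (\<forall>d\<ge>0. a + d \<in> A \<longleftrightarrow> a + p + d \<in> A)" for n :: nat and a p
  have Qex: "\<exists>a p. Q n a p" for n
  proof -
    define x where "x i = - of_nat n - P + of_nat i * M" for i :: nat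
    have "\<forall>i. \<exists>y. y \<in> A \<inter> {x i<..x i+M}" using dense by blast
    from choice[OF this] obtain q where q: "\<And>i. q i \<in> A \<inter> {x i<..x i+M}" by blast
    have xS: "x i + M = x (Suc i)" for i by (simp add: x_def algebra_simps)
    have xmono: "x i \<le> x j" if "i \<le> j" for i j using that M by (simp add: x_def)
    have qmono: "q i < q j" if "i < j" for i j
    proof -
      have "q i \<le> x (Suc i)" using q[of i] xS[of i] by auto
      also have "\<dots> \<le> x j" using xmono that by simp
      also have "\<dots> < q j" using q[of j] by auto
      finally show ?thesis .
    qed
    have "\<not> inj_on (\<lambda>i. pat (q i)) {..k}"
    proof
      assume "inj_on (\<lambda>i. pat (q i)) {..k}"
      then have "card {..k} \<le> card (pat ` A)"
        using q by (intro card_inj_on_le[of "\<lambda>i. pat (q i)"] finpat) auto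
      then show False by (simp add: k_def)
    qed
    then obtain i j where ij: "i \<le> k" "j \<le> k" "i < j" "pat (q i) = pat (q j)"
      unfolding inj_on_def by (metis atMost_iff linorder_neqE_nat)
    have xk: "x (Suc k) = - of_nat n" by (simp add: x_def P_def algebra_simps)
    have qi: "q l \<le> - of_nat n" "q l > - of_nat n - P" if "l \<le> k" for l

    proof -
      have x0: "x 0 = - of_nat n - P" by (simp add: x_def)
      have "x (Suc l) \<le> x (Suc k)" "x 0 \<le> x l" using xmono that by auto
      then show "q l \<le> - of_nat n" "q l > - of_nat n - P" using q[of l] xS[of l] xk x0 by auto
    qed
    have "q i + d \<in> A \<longleftrightarrow> q j + d \<in> A" if "d \<ge> 0" for d
    proof (rule forward)
      show "q i \<in> A" "q j \<in> A" "d \<ge> 0" using q that by auto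
      show "q i + d \<in> A \<longleftrightarrow> q j + d \<in> A" if "d \<in> {-N..0}" for d
        using ij(4) that unfolding pat_def by blast
    qed
    moreover have "q j - q i \<in> D" using inD[of "q i" "q j - q i"] q by auto
    ultimately show ?thesis using qmono[OF ij(3)] qi[OF ij(1)] qi[OF ij(2)] q[of i] unfolding Q_def
      by (intro exI[of _ "q i"] exI[of _ "q j - q i"]) auto
  qed
  define a where "a n = (SOME a. \<exists>p. Q n a p)" for n
  define p where "p n = (SOME p. Q n (a n) p)" for n
  have ap: "Q n (a n) (p n)" for n
    unfolding p_def a_def using Qex by (intro someI_ex[of "Q n _"] someI_ex[of "\<lambda>a. \<exists>p. Q n a p"])
  have "range p \<subseteq> D \<inter> {-P..P}" using ap unfolding Q_def by blast
  then have "finite (range p)" using finD finite_subset by blast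
  \<comment> \<open>One period is attained from starting points arbitrarily far to the left, so it
    is a period on the whole line.\<close>
  then obtain q where q: "infinite {n. p n = q}"
    using pigeonhole_infinite[of UNIV p] by auto
  have qp: "q > 0"
  proof -
    obtain n where "p n = q" using q not_finite_existsD by auto
    then show ?thesis using ap[of n] by (simp add: Q_def)
  qed
  have per: "x \<in> A \<longleftrightarrow> x + q \<in> A" for x
  proof -
    obtain n where n: "n > nat \<lceil>- x\<rceil>" "p n = q"
      using q unfolding infinite_nat_iff_unbounded by auto
    then have "of_nat n \<ge> - x" by linarith
    then have "x - a n \<ge> 0" using ap[of n] unfolding Q_def by linarith
    then have "a n + (x - a n) \<in> A \<longleftrightarrow> a n + p n + (x - a n) \<in> A" using ap[of n] unfolding Q_def by blast
    then show ?thesis using n by (simp add: algebra_simps)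
  qed
  obtain a0 where a0: "a0 \<in> A" using dense by blast
  have "(\<lambda>x. x - a0) ` (A \<inter> {0..<q}) \<subseteq> D \<inter> {-(q+\<bar>a0\<bar>)..q+\<bar>a0\<bar>}"
    using inD[OF a0] by auto
  then have "finite ((\<lambda>x. x - a0) ` (A \<inter> {0..<q}))" using finD finite_subset by blast
  then have "finite (A \<inter> {0..<q})" by (rule finite_imageD) (simp add: inj_on_def)
  then show ?thesis using periodic_setI[OF qp per] a0 by blast
qed

section \<open>Square integrable functions\<close>

text \<open>Borel functions and \<open>lborel\<close> replace the completed measure of
  \<open>L2\<close>, so that translations, products and Fubini stay within one
  sigma-algebra.\<close>

definition L2b :: "(real \<Rightarrow> complex) set" where
  "L2b = {f \<in> borel_measurable borel. integrable lborel (\<lambda>x. (norm (f x))\<^sup>2)}"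

definition ip :: "(real \<Rightarrow> complex) \<Rightarrow> (real \<Rightarrow> complex) \<Rightarrow> complex" where
  "ip f h = (LINT x|lborel. f x * cnj (h x))"

definition nsq :: "(real \<Rightarrow> complex) \<Rightarrow> real" where
  "nsq f = (LINT x|lborel. (norm (f x))\<^sup>2)"

lemma L2b_measurable [measurable_dest]: "f \<in> L2b \<Longrightarrow> f \<in> borel_measurable borel"
  and L2b_integrable: "f \<in> L2b \<Longrightarrow> integrable lborel (\<lambda>x. (norm (f x))\<^sup>2)"
  by (auto simp: L2b_def)

lemma L2bI: "f \<in> borel_measurable borel \<Longrightarrow> integrable lborel (\<lambda>x. (norm (f x))\<^sup>2) \<Longrightarrow> f \<in> L2b"
  by (auto simp: L2b_def)

lemma norm_add_sq_le: "(norm (a + b :: complex))\<^sup>2 \<le> 2 * (norm a)\<^sup>2 + 2 * (norm b)\<^sup>2"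
proof -
  have "(norm (a + b))\<^sup>2 \<le> (norm a + norm b)\<^sup>2" by (intro power_mono norm_triangle_ineq) auto
  also have "\<dots> \<le> 2 * (norm a)\<^sup>2 + 2 * (norm b)\<^sup>2"
    using zero_le_power2[of "norm a - norm b"] by (simp add: power2_eq_square algebra_simps)
  finally show ?thesis .
qed

lemma L2b_bounded_mult:
  assumes f: "f \<in> L2b" and h: "h \<in> borel_measurable borel" and B: "\<And>x. norm (h x) \<le> B"
  shows "(\<lambda>x. h x * f x) \<in> L2b"
proof (rule L2bI)
  show "(\<lambda>x. h x * f x) \<in> borel_measurable borel" using f h by (auto dest: L2b_measurable)
  have le: "norm ((norm (h x * f x))\<^sup>2) \<le> norm (B\<^sup>2 * (norm (f x))\<^sup>2)" for x
    using B[of x] by (simp add: norm_mult power_mult_distrib mult_right_mono power_mono)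
  have [measurable]: "f \<in> borel_measurable borel" using f by (rule L2b_measurable)
  have [measurable]: "h \<in> borel_measurable borel" by (rule h)
  show "integrable lborel (\<lambda>x. (norm (h x * f x))\<^sup>2)"
    by (rule Bochner_Integration.integrable_bound[of lborel "\<lambda>x. B\<^sup>2 * (norm (f x))\<^sup>2"])
       (use le L2b_integrable[OF f] in \<open>auto intro!: AE_I2\<close>)
qed

lemma L2b_cmult: "f \<in> L2b \<Longrightarrow> (\<lambda>x. c * f x) \<in> L2b"
  using L2b_bounded_mult[of f "\<lambda>_. c" "norm c"] by auto

lemma L2b_add:
  assumes f: "f \<in> L2b" and h: "h \<in> L2b"
  shows "(\<lambda>x. f x + h x) \<in> L2b"
proof (rule L2bI)
  show "(\<lambda>x. f x + h x) \<in> borel_measurable borel" using f h by (auto dest: L2b_measurable)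
  have le: "norm ((norm (f x + h x))\<^sup>2) \<le> norm (2 * (norm (f x))\<^sup>2 + 2 * (norm (h x))\<^sup>2)" for x
    using norm_add_sq_le[of "f x" "h x"] by simp
  have [measurable]: "f \<in> borel_measurable borel" "h \<in> borel_measurable borel"
    using f h by (auto dest: L2b_measurable)
  show "integrable lborel (\<lambda>x. (norm (f x + h x))\<^sup>2)"
    by (rule Bochner_Integration.integrable_bound[of lborel "\<lambda>x. 2 * (norm (f x))\<^sup>2 + 2 * (norm (h x))\<^sup>2"])
       (use le L2b_integrable[OF f] L2b_integrable[OF h] in \<open>auto intro!: AE_I2\<close>)
qed

lemma L2b_diff: "f \<in> L2b \<Longrightarrow> h \<in> L2b \<Longrightarrow> (\<lambda>x. f x - h x) \<in> L2b"
  using L2b_add[of f "\<lambda>x. (-1) * h x"] L2b_cmult[of h "-1"] by simp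

lemma L2b_zero: "(\<lambda>x. 0) \<in> L2b"
  by (auto simp: L2b_def)

lemma L2b_sum: "(\<And>i. i \<in> J \<Longrightarrow> f i \<in> L2b) \<Longrightarrow> (\<lambda>x. \<Sum>i\<in>J. f i x) \<in> L2b"
  by (induction J rule: infinite_finite_induct) (auto simp: L2b_zero L2b_add)

lemma lborel_integral_translate:
  fixes f :: "real \<Rightarrow> 'a::{banach, second_countable_topology}"
  shows "(LINT x|lborel. f (x + c)) = (LINT x|lborel. f x)"
  using lborel_integral_real_affine[of 1 f c] by (simp add: add.commute)

lemma lborel_integrable_translate:
  fixes f :: "real \<Rightarrow> 'a::{banach, second_countable_topology}"
  shows "integrable lborel f \<Longrightarrow> integrable lborel (\<lambda>x. f (x + c))"
  using lborel_integrable_real_affine[of f 1 c] by (simp add: add.commute)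

lemma L2b_translate: "f \<in> L2b \<Longrightarrow> (\<lambda>x. f (x + c)) \<in> L2b"
  using lborel_integrable_translate[of "\<lambda>x. (norm (f x))\<^sup>2" c] by (auto simp: L2b_def)

lemma nsq_translate: "nsq (\<lambda>x. f (x + c)) = nsq f"
  unfolding nsq_def by (rule lborel_integral_translate)

lemma nsq_nonneg [simp]: "nsq f \<ge> 0"
  by (simp add: nsq_def)

lemma borel_measurable_cnj [measurable]: "cnj \<in> borel_measurable borel"
  by (intro borel_measurable_continuous_onI continuous_intros)

lemma ip_integrable:
  assumes f: "f \<in> L2b" and h: "h \<in> L2b"
  shows "integrable lborel (\<lambda>x. f x * cnj (h x))"
proof -
  have le: "norm (f x * cnj (h x)) \<le> norm ((norm (f x))\<^sup>2 + (norm (h x))\<^sup>2)" for x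
  proof -
    have "2 * (norm (f x) * norm (h x)) \<le> (norm (f x))\<^sup>2 + (norm (h x))\<^sup>2"
      using zero_le_power2[of "norm (f x) - norm (h x)"] by (simp add: power2_diff)
    moreover have "0 \<le> norm (f x) * norm (h x)" by simp
    ultimately have "norm (f x) * norm (h x) \<le> (norm (f x))\<^sup>2 + (norm (h x))\<^sup>2" by linarith
    then show ?thesis by (simp add: norm_mult)
  qed
  have [measurable]: "f \<in> borel_measurable borel" "h \<in> borel_measurable borel"
    using f h by (auto dest: L2b_measurable)
  show ?thesis
    by (rule Bochner_Integration.integrable_bound[of lborel "\<lambda>x. (norm (f x))\<^sup>2 + (norm (h x))\<^sup>2"])
       (use le L2b_integrable[OF f] L2b_integrable[OF h] in \<open>auto intro!: AE_I2\<close>)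
qed

section \<open>Inner products, Bessel and Parseval\<close>

lemma ip_self: "ip f f = of_real (nsq f)"
  unfolding ip_def nsq_def by (simp only: complex_norm_square[symmetric] integral_complex_of_real)

lemma ip_diff_left: "f \<in> L2b \<Longrightarrow> f' \<in> L2b \<Longrightarrow> h \<in> L2b \<Longrightarrow> ip (\<lambda>x. f x - f' x) h = ip f h - ip f' h"
  unfolding ip_def by (simp add: left_diff_distrib ip_integrable)

lemma ip_cmult_left: "ip (\<lambda>x. c * f x) h = c * ip f h"
  unfolding ip_def by (simp add: mult.assoc)

lemma ip_cnj: "ip h f = cnj (ip f h)"
proof -
  have "cnj (ip f h) = (LINT x|lborel. cnj (f x * cnj (h x)))"
    unfolding ip_def by (rule Bochner_Integration.integral_cnj[symmetric])
  then show ?thesis by (simp add: ip_def mult.commute)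
qed

lemma ip_diff_right: "f \<in> L2b \<Longrightarrow> f' \<in> L2b \<Longrightarrow> h \<in> L2b \<Longrightarrow> ip h (\<lambda>x. f x - f' x) = ip h f - ip h f'"
  using ip_diff_left[of f f' h] ip_cnj by (metis complex_cnj_diff)

lemma ip_cmult_right: "ip h (\<lambda>x. c * f x) = cnj c * ip h f"
  using ip_cmult_left[of c f h] ip_cnj by (metis complex_cnj_mult)

text \<open>Completing the square: a wrong coefficient costs exactly its squared error.\<close>

lemma nsq_diff_cmult:
  assumes u: "u \<in> L2b" and e: "e \<in> L2b" and 1: "ip e e = 1"
  shows "nsq (\<lambda>x. u x - c * e x) = nsq u - (norm (ip u e))\<^sup>2 + (norm (c - ip u e))\<^sup>2"
proof -
  have ce: "(\<lambda>x. c * e x) \<in> L2b" using e by (rule L2b_cmult)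
  have "complex_of_real (nsq (\<lambda>x. u x - c * e x)) = ip (\<lambda>x. u x - c * e x) (\<lambda>x. u x - c * e x)"
    by (simp add: ip_self)
  also have "\<dots> = of_real (nsq u) - cnj c * ip u e - c * cnj (ip u e) + c * cnj c"
    using u ce L2b_diff[OF u ce]
    by (simp add: ip_diff_left ip_diff_right ip_cmult_left ip_cmult_right 1 ip_self[of u] ip_cnj[of e u] algebra_simps e)
  also have "\<dots> = of_real (nsq u - (norm (ip u e))\<^sup>2 + (norm (c - ip u e))\<^sup>2)"
    by (simp only: of_real_add of_real_diff complex_norm_square) (simp add: algebra_simps)
  finally show ?thesis by (simp only: of_real_eq_iff)
qed

lemma nsq_diff_sum:
  assumes f: "f \<in> L2b" and e: "\<And>i. i \<in> I \<Longrightarrow> e i \<in> L2b"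
    and on: "\<And>i j. i \<in> I \<Longrightarrow> j \<in> I \<Longrightarrow> ip (e i) (e j) = (if i = j then 1 else 0)"
    and J: "finite J" "J \<subseteq> I"
  shows "nsq (\<lambda>x. f x - (\<Sum>j\<in>J. c j * e j x))
    = nsq f - (\<Sum>j\<in>J. (norm (ip f (e j)))\<^sup>2) + (\<Sum>j\<in>J. (norm (c j - ip f (e j)))\<^sup>2)
    \<and> (\<forall>i\<in>I - J. ip (\<lambda>x. f x - (\<Sum>j\<in>J. c j * e j x)) (e i) = ip f (e i))"
  using J
proof (induction J rule: finite_induct)
  case (insert k J)
  define u where "u = (\<lambda>x. f x - (\<Sum>j\<in>J. c j * e j x))"
  have k: "k \<in> I" "k \<notin> J" "J \<subseteq> I" using insert by auto
  have u: "u \<in> L2b" unfolding u_def using k e by (intro L2b_diff f L2b_sum L2b_cmult) auto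
  have eq: "(\<lambda>x. f x - (\<Sum>j\<in>insert k J. c j * e j x)) = (\<lambda>x. u x - c k * e k x)"
    using insert by (auto simp: u_def algebra_simps)
  have IH: "nsq u = nsq f - (\<Sum>j\<in>J. (norm (ip f (e j)))\<^sup>2) + (\<Sum>j\<in>J. (norm (c j - ip f (e j)))\<^sup>2)"
    "\<And>i. i \<in> I - J \<Longrightarrow> ip u (e i) = ip f (e i)" using insert.IH k by (auto simp: u_def)
  have "nsq (\<lambda>x. u x - c k * e k x) = nsq u - (norm (ip u (e k)))\<^sup>2 + (norm (c k - ip u (e k)))\<^sup>2"
    using k e on by (intro nsq_diff_cmult u) auto
  moreover have "ip (\<lambda>x. u x - c k * e k x) (e i) = ip f (e i)" if "i \<in> I - insert k J" for i
    using that k e[of k] e[of i] on[of k i] IH(2)[of i] u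
    by (subst ip_diff_left) (auto simp: L2b_cmult ip_cmult_left)
  ultimately show ?case unfolding eq using IH k insert.hyps by auto
qed simp

lemma bessel_finite:
  assumes "f \<in> L2b" and "\<And>i. i \<in> I \<Longrightarrow> e i \<in> L2b"
    and "\<And>i j. i \<in> I \<Longrightarrow> j \<in> I \<Longrightarrow> ip (e i) (e j) = (if i = j then 1 else 0)"
    and "finite J" "J \<subseteq> I"
  shows "(\<Sum>j\<in>J. (norm (ip f (e j)))\<^sup>2) \<le> nsq f"
  using nsq_diff_sum[OF assms, of "\<lambda>j. ip f (e j)"] nsq_nonneg[of "\<lambda>x. f x - (\<Sum>j\<in>J. ip f (e j) * e j x)"]
  by simp

text \<open>Bessel bounds all finite partial sums by \<open>nsq f\<close>. No approximating
  combination does better than the one with the coefficients of \<open>f\<close>, so density pushes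
  the supremum up to \<open>nsq f\<close>.\<close>

lemma parseval_has_sum:
  assumes f: "f \<in> L2b" and e: "\<And>i. i \<in> I \<Longrightarrow> e i \<in> L2b"
    and on: "\<And>i j. i \<in> I \<Longrightarrow> j \<in> I \<Longrightarrow> ip (e i) (e j) = (if i = j then 1 else 0)"
    and dense: "\<And>\<epsilon>. \<epsilon> > 0 \<Longrightarrow> \<exists>J c. finite J \<and> J \<subseteq> I \<and> nsq (\<lambda>x. f x - (\<Sum>j\<in>J. c j * e j x)) < \<epsilon>"
  shows "((\<lambda>i. (norm (ip f (e i)))\<^sup>2) has_sum nsq f) I"
proof -
  have "((\<lambda>i. (norm (ip f (e i)))\<^sup>2) has_sum (SUP J\<in>{J. finite J \<and> J \<subseteq> I}. \<Sum>j\<in>J. (norm (ip f (e j)))\<^sup>2)) I"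
    using bessel_finite[OF f e on, where I = I]
    by (intro nonneg_bdd_above_has_sum) (auto simp: bdd_above_def)
  moreover have "(SUP J\<in>{J. finite J \<and> J \<subseteq> I}. \<Sum>j\<in>J. (norm (ip f (e j)))\<^sup>2) = nsq f"
  proof (rule cSup_eq_non_empty)
    fix y assume y: "\<And>x. x \<in> (\<lambda>J. \<Sum>j\<in>J. (norm (ip f (e j)))\<^sup>2) ` {J. finite J \<and> J \<subseteq> I} \<Longrightarrow> x \<le> y"
    show "nsq f \<le> y"
    proof (rule field_le_epsilon)
      fix \<epsilon> :: real assume "\<epsilon> > 0"
      then obtain J c where J: "finite J" "J \<subseteq> I" "nsq (\<lambda>x. f x - (\<Sum>j\<in>J. c j * e j x)) < \<epsilon>"
        using dense by blast
      have "nsq f - (\<Sum>j\<in>J. (norm (ip f (e j)))\<^sup>2) < \<epsilon>"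
        using nsq_diff_sum[OF f e on J(1,2), of c] J(3) sum_nonneg[of J "\<lambda>j. (norm (c j - ip f (e j)))\<^sup>2"] by simp
      then show "nsq f \<le> y + \<epsilon>" using y[of "\<Sum>j\<in>J. (norm (ip f (e j)))\<^sup>2"] J by auto
    qed
  qed (use bessel_finite[OF f e on, where I = I] in auto)
  ultimately show ?thesis by simp
qed

lemma integrable_indicator_Icc [simp]: "integrable lborel (indicat_real {a..b})" for a b :: real
  by (rule integrable_real_indicator) (auto simp: emeasure_lborel_Icc_eq)

section \<open>Continuity of translation in mean square\<close>

lemma nsq_add_le:
  assumes f: "f \<in> L2b" and h: "h \<in> L2b"
  shows "nsq (\<lambda>x. f x + h x) \<le> 2 * nsq f + 2 * nsq h"
proof -
  have "nsq (\<lambda>x. f x + h x) \<le> (LINT x|lborel. 2 * (norm (f x))\<^sup>2 + 2 * (norm (h x))\<^sup>2)"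
    unfolding nsq_def
    by (intro integral_mono L2b_integrable L2b_add f h norm_add_sq_le) (simp add: L2b_integrable f h)
  also have "\<dots> = 2 * nsq f + 2 * nsq h" by (simp add: nsq_def L2b_integrable f h)
  finally show ?thesis .
qed

lemma nsq_diff_tendsto:
  fixes s :: "nat \<Rightarrow> real \<Rightarrow> complex" and f :: "real \<Rightarrow> complex" and u w :: "real \<Rightarrow> real"
  assumes s: "\<And>n::nat. s n \<in> borel_measurable borel" and f: "f \<in> borel_measurable borel"
    and lim: "AE x in lborel. (\<lambda>n. s n x) \<longlonglongrightarrow> f x"
    and w: "integrable lborel w" and le: "\<And>n x. norm (s n x - f x) \<le> u x" and uw: "\<And>x. (u x)\<^sup>2 \<le> w x"
  shows "(\<lambda>n. nsq (\<lambda>x. s n x - f x)) \<longlonglongrightarrow> 0"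
proof -
  have "(\<lambda>n. LINT x|lborel. (norm (s n x - f x))\<^sup>2) \<longlonglongrightarrow> (LINT x|(lborel :: real measure). 0)"
  proof (rule integral_dominated_convergence[where w = w and s="\<lambda>n x. (norm (s n x - f x))\<^sup>2" and f="\<lambda>_. 0"])
    show "(\<lambda>x. (norm (s i x - f x))\<^sup>2) \<in> borel_measurable lborel" for i
      using s[of i] f by measurable
    show "AE x in lborel. (\<lambda>i. (norm (s i x - f x))\<^sup>2) \<longlonglongrightarrow> 0"
      using lim
    proof eventually_elim
      case (elim x)
      then have "(\<lambda>i. norm (s i x - f x) ^ 2) \<longlonglongrightarrow> norm (f x - f x) ^ 2"
        by (intro tendsto_intros)
      then show ?case by simp
    qed
    show "AE x in lborel. norm ((norm (s i x - f x))\<^sup>2) \<le> w x" for i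
    proof (rule AE_I2)
      fix x
      have "(norm (s i x - f x))\<^sup>2 \<le> (u x)\<^sup>2" using le by (intro power_mono) auto
      then show "norm ((norm (s i x - f x))\<^sup>2) \<le> w x" using uw[of x] by simp
    qed
  qed (use w in auto)
  then show ?thesis by (simp add: nsq_def)
qed

text \<open>Translation is an isometry, so an approximant \<open>h\<close> may replace
  \<open>f\<close> both before and after the shift. This is the step from continuous to bounded and
  from bounded to general functions.\<close>

lemma nsq_translate_tendsto_closure:
  assumes f: "f \<in> L2b"
    and appr: "\<And>\<epsilon>. \<epsilon> > 0 \<Longrightarrow> \<exists>h\<in>L2b. ((\<lambda>v. nsq (\<lambda>x. h (x + v) - h x)) \<longlongrightarrow> 0) (at 0) \<and> nsq (\<lambda>x. h x - f x) < \<epsilon>"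
  shows "((\<lambda>v. nsq (\<lambda>x. f (x + v) - f x)) \<longlongrightarrow> 0) (at 0)"
proof (rule tendstoI)
  fix e :: real assume e: "e > 0"
  \<comment> \<open>Two uses of \<open>nsq_add_le\<close> weight the three errors by 4, 4 and 2;
    with \<open>e / 16\<close> for \<open>h - f\<close> and \<open>e / 8\<close> for the shift the
    total stays below \<open>7 * e / 8\<close>.\<close>
  obtain h where h: "h \<in> L2b" and th: "((\<lambda>v. nsq (\<lambda>x. h (x + v) - h x)) \<longlongrightarrow> 0) (at 0)"
    and hf: "nsq (\<lambda>x. h x - f x) < e / 16" using appr[of "e/16"] e by auto
  have ev: "\<forall>\<^sub>F v in at 0. dist (nsq (\<lambda>x. h (x + v) - h x)) 0 < e / 8"
    using tendstoD[OF th, of "e/8"] e by simp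
  show "\<forall>\<^sub>F v in at 0. dist (nsq (\<lambda>x. f (x + v) - f x)) 0 < e"
    using ev
  proof eventually_elim
    case (elim v)
    have d: "(\<lambda>x. f x - h x) \<in> L2b" "(\<lambda>x. h x - f x) \<in> L2b" using f h by (auto intro: L2b_diff)
    have dv: "(\<lambda>x. f (x + v) - h (x + v)) \<in> L2b" using L2b_translate[OF d(1), of v] .
    have hv: "(\<lambda>x. h (x + v) - h x) \<in> L2b" by (intro L2b_diff L2b_translate h)
    have "nsq (\<lambda>x. f (x + v) - f x)
        = nsq (\<lambda>x. ((f (x + v) - h (x + v)) + (h (x + v) - h x)) + (h x - f x))"
      by (simp add: algebra_simps)
    also have "\<dots> \<le> 2 * nsq (\<lambda>x. (f (x + v) - h (x + v)) + (h (x + v) - h x)) + 2 * nsq (\<lambda>x. h x - f x)"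
      by (intro nsq_add_le L2b_add dv hv d)
    also have "nsq (\<lambda>x. (f (x + v) - h (x + v)) + (h (x + v) - h x)) \<le>
        2 * nsq (\<lambda>x. f (x + v) - h (x + v)) + 2 * nsq (\<lambda>x. h (x + v) - h x)"
      by (intro nsq_add_le dv hv)
    also have "nsq (\<lambda>x. f (x + v) - h (x + v)) = nsq (\<lambda>x. f x - h x)"
      using nsq_translate[of "\<lambda>x. f x - h x" v] by simp
    also have "nsq (\<lambda>x. f x - h x) = nsq (\<lambda>x. h x - f x)"
      by (simp add: nsq_def norm_minus_commute)
    finally show ?case using elim hf e by simp
  qed
qed

lemma nsq_translate_tendsto_continuous:
  fixes h :: "real \<Rightarrow> complex"
  assumes cont: "continuous_on UNIV h" and le: "\<And>x. norm (h x) \<le> M" and supp: "\<And>x. \<bar>x\<bar> > L \<Longrightarrow> h x = 0"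
  shows "((\<lambda>v. nsq (\<lambda>x. h (x + v) - h x)) \<longlongrightarrow> 0) (at 0)"
proof -
  \<comment> \<open>Shifts below 1 confine all differences to \<open>{-(L+1)..L+1}\<close>, which
    gives one majorant for all of them.\<close>
  have "((\<lambda>v. nsq (\<lambda>x. h (x + v) - h x)) \<longlongrightarrow> 0) (at 0 within ball 0 1)"
    unfolding tendsto_at_iff_sequentially
  proof (intro allI impI)
    fix X :: "nat \<Rightarrow> real" assume X: "\<forall>i. X i \<in> ball 0 1 - {0}" and X0: "X \<longlonglongrightarrow> 0"
    have X1: "\<bar>X i\<bar> < 1" for i using X by (auto simp: dist_norm)
    have hc: "isCont h x" for x using cont by (simp add: continuous_on_eq_continuous_at)
    have hm [measurable]: "h \<in> borel_measurable borel" by (rule borel_measurable_continuous_onI[OF cont])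
    have M: "M \<ge> 0" using le[of 0] norm_ge_zero order_trans by blast
    have "(\<lambda>n. nsq (\<lambda>x. h (x + X n) - h x)) \<longlonglongrightarrow> 0"
    proof (rule nsq_diff_tendsto[where w = "\<lambda>x. (2 * M)\<^sup>2 * indicator {-(L+1)..L+1} x" and u = "\<lambda>x. 2 * M * indicator {-(L+1)..L+1} x"])
      show "AE x in lborel. (\<lambda>n. h (x + X n)) \<longlonglongrightarrow> h x"
      proof (rule AE_I2)
        fix x
        have "(\<lambda>n. x + X n) \<longlonglongrightarrow> x + 0" by (intro tendsto_intros X0)
        then show "(\<lambda>n. h (x + X n)) \<longlonglongrightarrow> h x" using isCont_tendsto_compose[OF hc[of x]] by simp
      qed
      show "norm (h (x + X n) - h x) \<le> 2 * M * indicator {-(L+1)..L+1} x" for n x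
      proof (cases "x \<in> {-(L+1)..L+1}")
        case True
        then show ?thesis using norm_triangle_ineq4[of "h (x + X n)" "h x"] le[of "x + X n"] le[of x] by simp
      next
        case False
        then have "\<bar>x\<bar> > L + 1" by auto
        then have "\<bar>x\<bar> > L" "\<bar>x + X n\<bar> > L" using X1[of n] by linarith+
        then show ?thesis using False supp by simp
      qed
      show "(2 * M * indicator {-(L+1)..L+1} x)\<^sup>2 \<le> (2 * M)\<^sup>2 * indicator {-(L+1)..L+1} x" for x :: real
        by (auto simp: indicator_def)
    qed auto
    then show "((\<lambda>v. nsq (\<lambda>x. h (x + v) - h x)) \<circ> X) \<longlonglongrightarrow> 0" by (simp add: o_def)
  qed
  then show ?thesis by (subst (asm) at_within_open) auto
qed

lemma nsq_translate_tendsto_bounded: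
  fixes f :: "real \<Rightarrow> complex"
  assumes f: "f \<in> L2b" and le: "\<And>x. norm (f x) \<le> M" and M: "M > 0" and supp: "\<And>x. \<bar>x\<bar> > L \<Longrightarrow> f x = 0"
  shows "((\<lambda>v. nsq (\<lambda>x. f (x + v) - f x)) \<longlongrightarrow> 0) (at 0)"
proof (rule nsq_translate_tendsto_closure[OF f])
  have fm [measurable]: "f \<in> borel_measurable borel" using f by (rule L2b_measurable)
  have "f \<in> borel_measurable lebesgue"
    using fm by (simp add: measurable_completion)
  then have "f measurable_on UNIV" by (rule lebesgue_measurable_imp_measurable_on) simp
  then obtain N \<phi> where N: "negligible N" and \<phi>: "\<And>n. continuous_on UNIV (\<phi> n)"
    and lim: "\<And>x. x \<notin> N \<Longrightarrow> (\<lambda>n::nat. \<phi> n x) \<longlonglongrightarrow> f x"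
    unfolding measurable_on_def by auto
  \<comment> \<open>Measurability yields continuous functions converging almost everywhere. Radial
    clipping to the disc of radius \<open>M\<close> and the cutoff \<open>cut\<close> add a common
    bound and compact support; both leave \<open>f\<close> unchanged, so the limit is kept.\<close>
  define clip :: "complex \<Rightarrow> complex" where "clip z = z / of_real (max 1 (norm z / M))" for z
  define cut :: "real \<Rightarrow> real" where "cut x = max 0 (min 1 (L + 1 - \<bar>x\<bar>))" for x
  define \<psi> where "\<psi> n x = of_real (cut x) * clip (\<phi> n x)" for n x
  have clip_cont: "continuous_on UNIV clip"
    unfolding clip_def using M by (intro continuous_intros) (auto simp: max_def)
  have clip_le: "norm (clip z) \<le> M" for z
  proof -
    have "norm z \<le> M * max 1 (norm z / M)" using M by (auto simp: max_def field_simps)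
    then show ?thesis unfolding clip_def by (simp add: norm_divide field_simps max_def)
  qed
  have clip_id: "clip z = z" if "norm z \<le> M" for z
    using that M by (simp add: clip_def max_def field_simps)
  have cut: "0 \<le> cut x" "cut x \<le> 1" for x by (auto simp: cut_def)
  have \<psi>_cont: "continuous_on UNIV (\<psi> n)" for n
  proof -
    have "continuous_on UNIV (\<lambda>x. clip (\<phi> n x))"
      using continuous_on_compose2[OF clip_cont \<phi>[of n]] by simp
    then show ?thesis unfolding \<psi>_def cut_def by (intro continuous_intros) auto
  qed
  have \<psi>_le: "norm (\<psi> n x) \<le> M" for n x
  proof -
    have "norm (\<psi> n x) = cut x * norm (clip (\<phi> n x))" using cut[of x] by (simp add: \<psi>_def norm_mult)
    also have "\<dots> \<le> 1 * M" using cut[of x] clip_le by (intro mult_mono) auto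
    finally show ?thesis by simp
  qed
  have \<psi>_supp: "\<psi> n x = 0" if "\<bar>x\<bar> > L + 1" for n x using that by (simp add: \<psi>_def cut_def)
  have \<psi>_L2: "\<psi> n \<in> L2b" for n
  proof (rule L2bI)
    show [measurable]: "\<psi> n \<in> borel_measurable borel" by (rule borel_measurable_continuous_onI[OF \<psi>_cont])
    have "norm ((norm (\<psi> n x))\<^sup>2) \<le> norm (M\<^sup>2 * indicator {-(L+1)..L+1} x)" for x
    proof (cases "\<bar>x\<bar> > L + 1")
      case False
      then have "x \<in> {-(L+1)..L+1}" by auto
      then show ?thesis using \<psi>_le[of n x] by (simp add: power_mono)
    qed (simp add: \<psi>_supp)
    then show "integrable lborel (\<lambda>x. (norm (\<psi> n x))\<^sup>2)"
      by (intro Bochner_Integration.integrable_bound[of lborel "\<lambda>x. M\<^sup>2 * indicator {-(L+1)..L+1} x" "\<lambda>x. (norm (\<psi> n x))\<^sup>2", OF _ _ AE_I2]) auto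
  qed
  have \<psi>_lim: "(\<lambda>n. nsq (\<lambda>x. \<psi> n x - f x)) \<longlonglongrightarrow> 0"
  proof (rule nsq_diff_tendsto[where w = "\<lambda>x. (2 * M)\<^sup>2 * indicator {-(L+1)..L+1} x" and u = "\<lambda>x. 2 * M * indicator {-(L+1)..L+1} x"])
    have "AE x in lborel. x \<notin> N"
      using AE_not_in[of N lebesgue] N by (simp add: negligible_iff_null_sets AE_completion_iff)
    then show "AE x in lborel. (\<lambda>n. \<psi> n x) \<longlonglongrightarrow> f x"
    proof eventually_elim
      case (elim x)
      have "isCont clip (f x)" using clip_cont by (simp add: continuous_on_eq_continuous_at)
      then have "(\<lambda>n. of_real (cut x) * clip (\<phi> n x)) \<longlonglongrightarrow> of_real (cut x) * clip (f x)"
        using isCont_tendsto_compose lim[OF elim] by (intro tendsto_intros) blast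
      moreover have "of_real (cut x) * clip (f x) = f x"
        using supp[of x] clip_id[OF le] clip_id[of 0] M by (cases "\<bar>x\<bar> > L") (auto simp: cut_def)
      ultimately show ?case by (simp add: \<psi>_def)
    qed
    show "norm (\<psi> n x - f x) \<le> 2 * M * indicator {-(L+1)..L+1} x" for n x
    proof (cases "x \<in> {-(L+1)..L+1}")
      case True
      then show ?thesis using norm_triangle_ineq4[of "\<psi> n x" "f x"] le[of x] \<psi>_le[of n x] by simp
    next
      case False
      then have "\<bar>x\<bar> > L + 1" by auto
      then show ?thesis using False supp[of x] \<psi>_supp by simp
    qed
    show "(2 * M * indicator {-(L+1)..L+1} x)\<^sup>2 \<le> (2 * M)\<^sup>2 * indicator {-(L+1)..L+1} x" for x :: real
      by (auto simp: indicator_def)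
    show "\<psi> n \<in> borel_measurable borel" for n using \<psi>_L2 by (rule L2b_measurable)
  qed auto
  fix \<epsilon> :: real assume "\<epsilon> > 0"
  then have "\<forall>\<^sub>F n in sequentially. nsq (\<lambda>x. \<psi> n x - f x) < \<epsilon>"
    using order_tendstoD(2)[OF \<psi>_lim] by simp
  then obtain n where "nsq (\<lambda>x. \<psi> n x - f x) < \<epsilon>" using eventually_happens'[OF sequentially_bot] by blast
  then show "\<exists>h\<in>L2b. ((\<lambda>v. nsq (\<lambda>x. h (x + v) - h x)) \<longlongrightarrow> 0) (at 0) \<and> nsq (\<lambda>x. h x - f x) < \<epsilon>"
    using \<psi>_L2[of n] nsq_translate_tendsto_continuous[OF \<psi>_cont[of n] \<psi>_le[of n] \<psi>_supp[of _ n]] by blast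
qed

lemma nsq_translate_tendsto:
  fixes f :: "real \<Rightarrow> complex"
  assumes f: "f \<in> L2b" and supp: "\<And>x. \<bar>x\<bar> > L \<Longrightarrow> f x = 0"
  shows "((\<lambda>v. nsq (\<lambda>x. f (x + v) - f x)) \<longlongrightarrow> 0) (at 0)"
proof (rule nsq_translate_tendsto_closure[OF f])
  have fm [measurable]: "f \<in> borel_measurable borel" using f by (rule L2b_measurable)
  \<comment> \<open>Truncation by height: each \<open>h n\<close> is bounded, and
    \<open>norm (f x)\<close> dominates the error.\<close>
  define h where "h n x = (if norm (f x) \<le> real (Suc n) then f x else 0)" for n :: nat and x
  have h_L2: "h n \<in> L2b" for n
  proof -
    have "(\<lambda>x. indicator {x. norm (f x) \<le> real (Suc n)} x * f x) \<in> L2b"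
      by (rule L2b_bounded_mult[OF f, where B = 1]) (auto simp: indicator_def)
    moreover have "(\<lambda>x. indicator {x. norm (f x) \<le> real (Suc n)} x * f x) = h n"
      by (auto simp: h_def indicator_def)
    ultimately show ?thesis by simp
  qed
  have lim: "(\<lambda>n. nsq (\<lambda>x. h n x - f x)) \<longlonglongrightarrow> 0"
  proof (rule nsq_diff_tendsto[where w = "\<lambda>x. (norm (f x))\<^sup>2" and u = "\<lambda>x. norm (f x)"])
    show "AE x in lborel. (\<lambda>n. h n x) \<longlonglongrightarrow> f x"
    proof (rule AE_I2)
      fix x
      obtain m where m: "norm (f x) \<le> real m" using real_arch_simple by blast
      have "\<forall>\<^sub>F n in sequentially. h n x = f x"
        using eventually_ge_at_top[of m] by eventually_elim (use m in \<open>auto simp: h_def\<close>)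
      then show "(\<lambda>n. h n x) \<longlonglongrightarrow> f x" by (rule tendsto_eventually)
    qed
    show "h n \<in> borel_measurable borel" for n using h_L2 by (rule L2b_measurable)
    show "norm (h n x - f x) \<le> norm (f x)" for n x by (simp add: h_def)
  qed (auto simp: L2b_integrable f)
  fix \<epsilon> :: real assume "\<epsilon> > 0"
  then have "\<forall>\<^sub>F n in sequentially. nsq (\<lambda>x. h n x - f x) < \<epsilon>"
    using order_tendstoD(2)[OF lim] by simp
  then obtain n where "nsq (\<lambda>x. h n x - f x) < \<epsilon>" using eventually_happens'[OF sequentially_bot] by blast
  moreover have "((\<lambda>v. nsq (\<lambda>x. h n (x + v) - h n x)) \<longlongrightarrow> 0) (at 0)"
    by (rule nsq_translate_tendsto_bounded[OF h_L2, where M = "real (Suc n)" and L = L]) (auto simp: h_def supp)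
  ultimately show "\<exists>h\<in>L2b. ((\<lambda>v. nsq (\<lambda>x. h (x + v) - h x)) \<longlongrightarrow> 0) (at 0) \<and> nsq (\<lambda>x. h x - f x) < \<epsilon>"
    using h_L2[of n] by blast
qed

section \<open>From the given basis to a Borel window\<close>

lemma gabor_simp: "gabor g (t, s) x = g (x - t) * cis (2 * pi * s * x)"
  by (simp add: gabor_def cis_conv_exp mult_ac)

lemma gabor_L2b:
  assumes "g \<in> L2b" shows "gabor g p \<in> L2b"
proof -
  obtain t s where p: "p = (t, s)" by fastforce
  have m: "(\<lambda>x. cis (2 * pi * s * x)) \<in> borel_measurable borel"
    by (intro borel_measurable_continuous_onI continuous_intros)
  have "(\<lambda>x. cis (2 * pi * s * x) * g (x + (- t))) \<in> L2b"
    by (intro L2b_bounded_mult[where B = 1] L2b_translate assms m) simp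
  then show ?thesis by (simp add: p gabor_simp[abs_def] mult.commute)
qed

text \<open>Everything about \<open>T\<close> and \<open>S\<close> is derived from these facts.
  Density of the span enters as the Parseval identity, and the support condition holds pointwise,
  after a change on a null set.\<close>

locale gabor_parseval =
  fixes g :: "real \<Rightarrow> complex" and T S :: "real set" and L :: real
  assumes g_L2: "g \<in> L2b" and g_supp: "\<And>x. \<bar>x\<bar> > L \<Longrightarrow> g x = 0" and L_pos: "L > 0"
    and orthonormal: "\<And>p q. p \<in> T \<times> S \<Longrightarrow> q \<in> T \<times> S \<Longrightarrow>
      ip (gabor g p) (gabor g q) = (if p = q then 1 else 0)"
    and parseval: "\<And>f. f \<in> L2b \<Longrightarrow> ((\<lambda>p. (norm (ip f (gabor g p)))\<^sup>2) has_sum nsq f) (T \<times> S)"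

text \<open>The complement of \<open>ess_support g\<close> is a possibly uncountable union of open
  sets on which \<open>g\<close> vanishes almost everywhere; Lindelof reduces it to a countable
  union.\<close>

lemma AE_zero_outside_ess_support:
  "AE x in lebesgue. x \<notin> ess_support g \<longrightarrow> g x = 0"
proof -
  define \<F> where "\<F> = {K. closed K \<and> (AE x in lebesgue. x \<notin> K \<longrightarrow> g x = 0)}"
  obtain \<U> where U: "\<U> \<subseteq> uminus ` \<F>" "countable \<U>" "\<Union>\<U> = \<Union>(uminus ` \<F>)"
    by (rule Lindelof[of "uminus ` \<F>"]) (auto simp: \<F>_def)
  have eq: "x \<notin> ess_support g \<longleftrightarrow> (\<exists>W\<in>\<U>. x \<in> W)" for x
  proof -
    have "x \<notin> ess_support g \<longleftrightarrow> x \<in> \<Union>(uminus ` \<F>)" by (auto simp: ess_support_def \<F>_def)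
    then show ?thesis by (simp add: U(3)[symmetric])
  qed
  have "AE x in lebesgue. x \<in> W \<longrightarrow> g x = 0" if "W \<in> \<U>" for W
    using that U(1) by (auto simp: \<F>_def)
  then have "AE x in lebesgue. \<forall>W\<in>\<U>. x \<in> W \<longrightarrow> g x = 0"
    using U(2) unfolding AE_ball_countable[OF U(2)] by blast
  then show ?thesis by eventually_elim (auto simp: eq)
qed

text \<open>Real and imaginary parts have Borel versions off a null set; the indicator of an
  interval containing the support makes the vanishing outside it pointwise.\<close>

lemma ex_borel_representative:
  assumes g: "g \<in> L2" and supp: "compact (ess_support g)"
  obtains g' L where "g' \<in> L2b" "L > 0" "\<And>x. \<bar>x\<bar> > L \<Longrightarrow> g' x = 0" "AE x in lborel. g x = g' x"
proof -
  have gm [measurable]: "g \<in> borel_measurable lebesgue" using g by (simp add: L2_def)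
  obtain r where r: "r \<in> borel_measurable lborel" "AE x in lborel. Re (g x) = r x"
    using completion_ex_borel_measurable_real[of "\<lambda>x. Re (g x)" lborel] by auto
  obtain i where i: "i \<in> borel_measurable lborel" "AE x in lborel. Im (g x) = i x"
    using completion_ex_borel_measurable_real[of "\<lambda>x. Im (g x)" lborel] by auto
  obtain L0 where L0: "\<And>x. x \<in> ess_support g \<Longrightarrow> norm x \<le> L0"
    using compact_imp_bounded[OF supp] unfolding bounded_iff by auto
  define L where "L = max 1 L0"
  define g' where "g' x = indicator {-L..L} x * Complex (r x) (i x)" for x
  have [measurable]: "r \<in> borel_measurable borel" "i \<in> borel_measurable borel" using r i by auto
  have "(\<lambda>x. complex_of_real (r x) + \<i> * complex_of_real (i x)) \<in> borel_measurable borel"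
    by measurable
  then have g'm [measurable]: "g' \<in> borel_measurable borel"
    unfolding g'_def[abs_def] by (simp add: Complex_eq)
  have ae: "AE x in lborel. g x = g' x"
    using r(2) i(2) AE_zero_outside_ess_support[of g, unfolded AE_completion_iff]
  proof eventually_elim
    case (elim x)
    show ?case
    proof (cases "x \<in> {-L..L}")
      case True
      then show ?thesis using elim by (simp add: g'_def complex_eq_iff)
    next
      case False
      then have "x \<notin> ess_support g" using L0[of x] by (auto simp: L_def)
      then show ?thesis using elim False by (simp add: g'_def)
    qed
  qed
  have "integrable lebesgue (\<lambda>x. (norm (g' x))\<^sup>2) \<longleftrightarrow> integrable lebesgue (\<lambda>x. (norm (g x))\<^sup>2)"
  proof (rule integrable_cong_AE)
    show "(\<lambda>x. (norm (g' x))\<^sup>2) \<in> borel_measurable lebesgue"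
      by (rule measurable_completion) simp
    show "AE x in lebesgue. (norm (g' x))\<^sup>2 = (norm (g x))\<^sup>2"
      using ae unfolding AE_completion_iff by eventually_elim simp
  qed simp
  then have "integrable lborel (\<lambda>x. (norm (g' x))\<^sup>2)"
    using g by (simp add: L2_def integrable_completion)
  then have "g' \<in> L2b" by (intro L2bI) auto
  moreover have "L > 0" by (simp add: L_def)
  moreover have "g' x = 0" if "\<bar>x\<bar> > L" for x using that by (auto simp: g'_def indicator_def)
  ultimately show thesis using ae that by blast
qed

lemma gabor_AE_cong:
  assumes ae: "AE x in lborel. g x = g' x"
  shows "AE x in lborel. gabor g p x = gabor g' p x"
proof -
  obtain t s where p: "p = (t, s)" by fastforce
  obtain N where N: "N \<in> null_sets lborel" "{x. g x \<noteq> g' x} \<subseteq> N"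
    using ae unfolding eventually_ae_filter by auto
  have "AE x in lborel. x \<notin> N" using N(1) by (rule AE_not_in)
  then have "AE x in lborel. (- t) + 1 * x \<notin> N"
    using N by (intro AE_borel_affine) (auto simp: null_sets_def)
  then show ?thesis
  proof eventually_elim
    case (elim x)
    then have "g (x - t) = g' (x - t)" using N(2) by auto
    then show ?case by (simp add: p gabor_simp)
  qed
qed

lemma L2_nsq:
  assumes h: "h \<in> borel_measurable borel" and f: "f \<in> borel_measurable lebesgue" and ae: "AE x in lborel. f x = h x"
  shows "L2_norm f = sqrt (nsq h)"
proof -
  have "(LINT x|lebesgue. (norm (f x))\<^sup>2) = (LINT x|lebesgue. (norm (h x))\<^sup>2)"
  proof (rule integral_cong_AE)
    have [measurable]: "f \<in> borel_measurable lebesgue" by (rule f)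
    show "(\<lambda>x. (norm (f x))\<^sup>2) \<in> borel_measurable lebesgue" by measurable
    have [measurable]: "h \<in> borel_measurable borel" by (rule h)
    show "(\<lambda>x. (norm (h x))\<^sup>2) \<in> borel_measurable lebesgue" by (rule measurable_completion) measurable
    show "AE x in lebesgue. (norm (f x))\<^sup>2 = (norm (h x))\<^sup>2"
      unfolding AE_completion_iff using ae by eventually_elim simp
  qed
  also have "\<dots> = nsq h" unfolding nsq_def using h by (intro integral_completion) measurable
  finally show ?thesis by (simp add: L2_norm_def)
qed

lemma gabor_parseval_of_basis:
  assumes g: "g \<in> L2" and supp: "compact (ess_support g)"
    and basis: "L2_orthonormal_basis (T \<times> S) (gabor g)"
  shows "\<exists>g' L. gabor_parseval g' T S L"
proof -
  obtain g' L where g': "g' \<in> L2b" and L: "L > 0" "\<And>x. \<bar>x\<bar> > L \<Longrightarrow> g' x = 0"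
    and ae: "AE x in lborel. g x = g' x"
    using ex_borel_representative[OF g supp] by metis
  have aeg: "AE x in lborel. gabor g p x = gabor g' p x" for p by (rule gabor_AE_cong[OF ae])
  have gL2: "gabor g' p \<in> L2b" for p by (rule gabor_L2b[OF g'])
  have gm: "gabor g p \<in> borel_measurable lebesgue" if "p \<in> T \<times> S" for p
    using basis that by (auto simp: L2_orthonormal_basis_def L2_def)
  have on: "ip (gabor g' p) (gabor g' q) = (if p = q then 1 else 0)" if p: "p \<in> T \<times> S" and q: "q \<in> T \<times> S" for p q
  proof -
    have "L2_inner (gabor g p) (gabor g q) = (LINT x|lebesgue. gabor g' p x * cnj (gabor g' q x))"
      unfolding L2_inner_def
    proof (rule integral_cong_AE)
      have [measurable]: "gabor g p \<in> borel_measurable lebesgue" "gabor g q \<in> borel_measurable lebesgue"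
        using gm p q by auto
      show "(\<lambda>x. gabor g p x * cnj (gabor g q x)) \<in> borel_measurable lebesgue" by measurable
      have [measurable]: "gabor g' p \<in> borel_measurable borel" "gabor g' q \<in> borel_measurable borel"
        using gL2 L2b_measurable by auto
      show "(\<lambda>x. gabor g' p x * cnj (gabor g' q x)) \<in> borel_measurable lebesgue"
        by (rule measurable_completion) measurable
      show "AE x in lebesgue. gabor g p x * cnj (gabor g q x) = gabor g' p x * cnj (gabor g' q x)"
        unfolding AE_completion_iff using aeg[of p] aeg[of q] by eventually_elim simp
    qed
    also have "\<dots> = ip (gabor g' p) (gabor g' q)"
      unfolding ip_def using ip_integrable[OF gL2 gL2, of p q]
      by (intro integral_completion) (simp add: borel_measurable_integrable)
    finally show ?thesis using basis p q unfolding L2_orthonormal_basis_def by metis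
  qed
  have pars: "((\<lambda>p. (norm (ip f (gabor g' p)))\<^sup>2) has_sum nsq f) (T \<times> S)" if f: "f \<in> L2b" for f
  proof (rule parseval_has_sum[OF f gL2 on])
    fix \<epsilon> :: real assume e: "\<epsilon> > 0"
    have fb: "f \<in> borel_measurable borel" using f by (rule L2b_measurable)
    have "f \<in> L2" unfolding L2_def
    proof (intro CollectI conjI)
      show "f \<in> borel_measurable lebesgue" using fb by (simp add: measurable_completion)
      show "integrable lebesgue (\<lambda>x. (norm (f x))\<^sup>2)"
        using fb L2b_integrable[OF f] by (subst integrable_completion) measurable
    qed
    then obtain J c where J: "finite J" "J \<subseteq> T \<times> S"
        "L2_norm (\<lambda>x. f x - (\<Sum>j\<in>J. c j * gabor g j x)) < sqrt \<epsilon>"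
      using basis e real_sqrt_gt_zero[OF e] unfolding L2_orthonormal_basis_def by blast
    have L2J: "(\<lambda>x. f x - (\<Sum>j\<in>J. c j * gabor g' j x)) \<in> L2b"
      by (intro L2b_diff f L2b_sum L2b_cmult gL2)
    have "L2_norm (\<lambda>x. f x - (\<Sum>j\<in>J. c j * gabor g j x)) = sqrt (nsq (\<lambda>x. f x - (\<Sum>j\<in>J. c j * gabor g' j x)))"
    proof (rule L2_nsq)
      show "(\<lambda>x. f x - (\<Sum>j\<in>J. c j * gabor g' j x)) \<in> borel_measurable borel"
        using L2J by (rule L2b_measurable)
      show "(\<lambda>x. f x - (\<Sum>j\<in>J. c j * gabor g j x)) \<in> borel_measurable lebesgue"
        using gm J(2) measurable_completion[of f lborel borel] fb
        by (intro borel_measurable_diff borel_measurable_sum borel_measurable_times borel_measurable_const)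
           (auto simp: subset_iff)
      have "AE x in lborel. \<forall>j\<in>J. gabor g j x = gabor g' j x"
        using J(1) aeg by (simp add: AE_finite_all)
      then show "AE x in lborel. f x - (\<Sum>j\<in>J. c j * gabor g j x) = f x - (\<Sum>j\<in>J. c j * gabor g' j x)"
        by eventually_elim simp
    qed
    then show "\<exists>J c. finite J \<and> J \<subseteq> T \<times> S \<and> nsq (\<lambda>x. f x - (\<Sum>j\<in>J. c j * gabor g' j x)) < \<epsilon>"
      using J by auto
  qed
  show ?thesis
    using g' L on pars by (intro exI[of _ g'] exI[of _ L]) (unfold_locales; simp)
qed

section \<open>The energy of a test function on a time shift\<close>

text \<open>Two points in one cell of the grid of mesh \<open>\<rho>\<close> are closer than
  \<open>\<rho>\<close>.\<close>

lemma inj_on_floor_separated: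
  fixes A :: "real set"
  assumes "\<rho> > 0" and sep: "\<And>x y. x \<in> A \<Longrightarrow> y \<in> A \<Longrightarrow> x \<noteq> y \<Longrightarrow> \<bar>x - y\<bar> \<ge> \<rho>"
  shows "inj_on (\<lambda>x. \<lfloor>x / \<rho>\<rfloor>) A"
proof (rule inj_onI, rule ccontr)
  fix x y assume xy: "x \<in> A" "y \<in> A" "\<lfloor>x / \<rho>\<rfloor> = \<lfloor>y / \<rho>\<rfloor>" "x \<noteq> y"
  then have "\<bar>x / \<rho> - y / \<rho>\<bar> < 1" by linarith
  then have "\<bar>x - y\<bar> < \<rho>" using \<open>\<rho> > 0\<close> by (simp add: field_simps flip: diff_divide_distrib)
  then show False using sep[of x y] xy by auto
qed

lemma finite_separated_Icc:
  fixes A :: "real set"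
  assumes "\<rho> > 0" and sep: "\<And>x y. x \<in> A \<Longrightarrow> y \<in> A \<Longrightarrow> x \<noteq> y \<Longrightarrow> \<bar>x - y\<bar> \<ge> \<rho>"
  shows "finite (A \<inter> {a..b})"
proof (rule inj_on_finite[of "\<lambda>x. \<lfloor>x / \<rho>\<rfloor>"])
  show "inj_on (\<lambda>x. \<lfloor>x / \<rho>\<rfloor>) (A \<inter> {a..b})"
    by (rule inj_on_subset[OF inj_on_floor_separated[OF assms]]) auto
  show "(\<lambda>x. \<lfloor>x / \<rho>\<rfloor>) ` (A \<inter> {a..b}) \<subseteq> {\<lfloor>a / \<rho>\<rfloor>..\<lfloor>b / \<rho>\<rfloor>}"
    using \<open>\<rho> > 0\<close> by (auto intro!: floor_mono divide_right_mono)
qed simp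

context gabor_parseval
begin

text \<open>The short-time Fourier transform of \<open>f\<close> with window \<open>g\<close>. The
  shift \<open>u\<close> is any real number and not just a point of \<open>T\<close>: later
  arguments move it continuously.\<close>

definition coef :: "(real \<Rightarrow> complex) \<Rightarrow> real \<Rightarrow> real \<Rightarrow> complex" where
  "coef f u s = ip f (gabor g (u, s))"

text \<open>The squared norm of \<open>Q u f\<close>.\<close>

definition E :: "(real \<Rightarrow> complex) \<Rightarrow> real \<Rightarrow> real" where
  "E f u = (\<Sum>\<^sub>\<infinity>s\<in>S. (norm (coef f u s))\<^sup>2)"

lemma coef_eq: "coef f u s = (LINT x|lborel. f x * cnj (g (x - u)) * cis (- (2 * pi * s * x)))"
  unfolding coef_def ip_def by (simp add: gabor_simp cis_cnj mult_ac)

text \<open>Translating \<open>f\<close> moves the shift and otherwise only multiplies the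
  coefficient by a unimodular phase.\<close>

lemma norm_coef_translate: "norm (coef (\<lambda>x. f (x - c)) u s) = norm (coef f (u - c) s)"
proof -
  have "coef (\<lambda>x. f (x - c)) u s = (LINT x|lborel. f (x + c - c) * cnj (g (x + c - u)) * cis (- (2 * pi * s * (x + c))))"
    unfolding coef_eq by (rule lborel_integral_translate[symmetric])
  also have "\<dots> = (LINT x|lborel. cis (- (2 * pi * s * c)) * (f x * cnj (g (x - (u - c))) * cis (- (2 * pi * s * x))))"
  proof (intro Bochner_Integration.integral_cong refl)
    fix x
    have "cis (- (2 * pi * s * (x + c))) = cis (- (2 * pi * s * c)) * cis (- (2 * pi * s * x))"
      by (simp add: cis_mult algebra_simps)
    then show "f (x + c - c) * cnj (g (x + c - u)) * cis (- (2 * pi * s * (x + c)))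
        = cis (- (2 * pi * s * c)) * (f x * cnj (g (x - (u - c))) * cis (- (2 * pi * s * x)))"
      by (simp add: algebra_simps)
  qed
  also have "\<dots> = cis (- (2 * pi * s * c)) * coef f (u - c) s"
    unfolding coef_eq by simp
  finally show ?thesis by (simp add: norm_mult)
qed

lemma coef_modulate: "coef (\<lambda>x. cis (2 * pi * y * x) * f x) u s = coef f u (s - y)"
  unfolding coef_eq
proof (intro Bochner_Integration.integral_cong refl)
  fix x
  have "cis (2 * pi * y * x) * cis (- (2 * pi * s * x)) = cis (- (2 * pi * (s - y) * x))"
    by (simp add: cis_mult algebra_simps)
  then show "cis (2 * pi * y * x) * f x * cnj (g (x - u)) * cis (- (2 * pi * s * x))
      = f x * cnj (g (x - u)) * cis (- (2 * pi * (s - y) * x))"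
    by (simp add: mult_ac)
qed

text \<open>With no indices, Parseval would give the indicator of \<open>{0..1}\<close> norm 0
  instead of 1.\<close>

lemma nonempty: "T \<noteq> {}" "S \<noteq> {}"
proof -
  have i: "(\<lambda>x. complex_of_real (indicator {0..1::real} x)) \<in> L2b"
  proof (rule L2bI)
    have eq: "(\<lambda>x. (norm (complex_of_real (indicator {0..1::real} x)))\<^sup>2) = indicat_real {0..1}"
      by (auto simp: indicator_def)
    show "integrable lborel (\<lambda>x. (norm (complex_of_real (indicator {0..1::real} x)))\<^sup>2)"
      unfolding eq by (rule integrable_indicator_Icc)
  qed measurable
  have "nsq (\<lambda>x. complex_of_real (indicator {0..1::real} x)) = (LINT x|lborel. indicat_real {0..1::real} x)"
    unfolding nsq_def by (intro Bochner_Integration.integral_cong) (auto simp: indicator_def)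
  also have "\<dots> = 1" by simp
  finally have 1: "((\<lambda>p. (norm (ip (\<lambda>x. complex_of_real (indicator {0..1::real} x)) (gabor g p)))\<^sup>2) has_sum 1) (T \<times> S)"
    using parseval[OF i] by simp
  then have "T \<times> S \<noteq> {}" using has_sum_empty has_sum_unique by (metis zero_neq_one)
  then show "T \<noteq> {}" "S \<noteq> {}" by auto
qed

lemma L2b_shift: "f \<in> L2b \<Longrightarrow> (\<lambda>x. f (x - c)) \<in> L2b"
  using L2b_translate[of f "-c"] by simp

lemma nsq_shift: "nsq (\<lambda>x. f (x - c)) = nsq f"
  using nsq_translate[of f "-c"] by simp

lemma has_sum_E_aux:
  assumes f: "f \<in> L2b" and t: "t \<in> T"
  shows "(\<lambda>s. (norm (coef f t s))\<^sup>2) summable_on S"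
proof -
  have "(\<lambda>p. (norm (ip f (gabor g p)))\<^sup>2) summable_on (Pair t ` S)"
    using parseval[OF f] t by (intro summable_on_subset_banach[OF has_sum_imp_summable]) auto
  then show ?thesis
    by (subst (asm) summable_on_reindex) (auto simp: inj_on_def o_def coef_def)
qed

text \<open>Parseval gives summability only for shifts in \<open>T\<close>; translating
  \<open>f\<close> carries an arbitrary \<open>u\<close> to some \<open>t\<close> in
  \<open>T\<close>.\<close>

lemma has_sum_E:
  assumes f: "f \<in> L2b"
  shows "((\<lambda>s. (norm (coef f u s))\<^sup>2) has_sum E f u) S"
proof -
  obtain t where t: "t \<in> T" using nonempty by auto
  have "(\<lambda>s. (norm (coef (\<lambda>x. f (x - (t - u))) t s))\<^sup>2) summable_on S"
    by (rule has_sum_E_aux[OF L2b_shift[OF f] t])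
  then show ?thesis unfolding E_def norm_coef_translate by (simp add: has_sum_infsum)
qed

lemma E_nonneg: "E f u \<ge> 0"
  unfolding E_def by (intro infsum_nonneg) auto

lemma E_translate: "E (\<lambda>x. f (x - c)) u = E f (u - c)"
  unfolding E_def norm_coef_translate ..

text \<open>Parseval for the translate of \<open>f\<close> by \<open>x\<close>, summed first over
  \<open>S\<close>. Since \<open>x\<close> is free, the identity can later be integrated in
  \<open>x\<close>.\<close>

lemma E_tile:
  assumes f: "f \<in> L2b"
  shows "((\<lambda>t. E f (t - x)) has_sum nsq f) T"
proof -
  define h where "h = (\<lambda>y. f (y - x))"
  have h: "h \<in> L2b" unfolding h_def by (rule L2b_shift[OF f])
  have "((\<lambda>t. E h t) has_sum nsq h) T"
    using parseval[OF h] by (rule has_sum_SigmaD) (auto simp: coef_def[symmetric] has_sum_E[OF h])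
  then show ?thesis unfolding h_def E_translate nsq_shift .
qed

lemma E_le: assumes f: "f \<in> L2b" shows "E f u \<le> nsq f"
proof -
  obtain t where t: "t \<in> T" using nonempty by auto
  have "E f (t - (t - u)) \<le> nsq f"
    using has_sum_mono_neutral[OF has_sum_finite[of "{t}" "\<lambda>t'. E f (t' - (t - u))"] E_tile[OF f, of "t - u"]] t E_nonneg
    by simp
  then show ?thesis by simp
qed

lemma E_eq_0:
  assumes "AE x in lborel. f x * cnj (g (x - u)) = 0"
  shows "E f u = 0"
proof -
  have "coef f u s = 0" for s
    unfolding coef_eq by (rule integral_eq_zero_AE) (use assms in \<open>eventually_elim, simp\<close>)
  then show ?thesis by (simp add: E_def)
qed

section \<open>Support and continuity of the energy\<close>

definition supported :: "(real \<Rightarrow> complex) \<Rightarrow> bool" where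
  "supported f \<longleftrightarrow> (\<forall>x. \<bar>x\<bar> > L \<longrightarrow> f x = 0)"

lemma E_supp:
  assumes "supported f" and "\<bar>u\<bar> > 2 * L"
  shows "E f u = 0"
proof (rule E_eq_0, rule AE_I2)
  fix x
  have "\<bar>x\<bar> > L \<or> \<bar>x - u\<bar> > L" using assms(2) by linarith
  then show "f x * cnj (g (x - u)) = 0" using assms(1) g_supp by (auto simp: supported_def)
qed

lemma coef_diff:
  assumes "f \<in> L2b" "h \<in> L2b" shows "coef (\<lambda>x. f x - h x) u s = coef f u s - coef h u s"
  unfolding coef_def by (rule ip_diff_left) (auto intro: assms gabor_L2b g_L2)

text \<open>Weighted AM-GM on the cross term; a small \<open>\<kappa>\<close> keeps the factor of
  the main term close to 1.\<close>

lemma norm_sq_perturb: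
  fixes c d :: complex assumes "\<kappa> > 0"
  shows "(norm c)\<^sup>2 \<le> (1 + \<kappa>) * (norm d)\<^sup>2 + (1 + 1 / \<kappa>) * (norm (c - d))\<^sup>2"
proof -
  have "norm c \<le> norm d + norm (c - d)" by norm
  then have "(norm c)\<^sup>2 \<le> (norm d + norm (c - d))\<^sup>2" by (intro power_mono) auto
  also have "\<dots> = (norm d)\<^sup>2 + (norm (c - d))\<^sup>2 + 2 * norm d * norm (c - d)" by (simp add: power2_sum)
  also have "2 * norm d * norm (c - d) \<le> \<kappa> * (norm d)\<^sup>2 + (1 / \<kappa>) * (norm (c - d))\<^sup>2"
  proof -
    have "0 \<le> (\<kappa> * norm d - norm (c - d))\<^sup>2 / \<kappa>" using assms by simp
    also have "\<dots> = \<kappa> * (norm d)\<^sup>2 + (1 / \<kappa>) * (norm (c - d))\<^sup>2 - 2 * norm d * norm (c - d)"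
      using assms by (simp add: power2_eq_square field_simps)
    finally show ?thesis by simp
  qed
  finally show ?thesis by (simp add: algebra_simps)
qed

lemma E_perturb:
  assumes f: "f \<in> L2b" and h: "h \<in> L2b" and l: "\<kappa> > 0"
  shows "E f u \<le> E h u + \<kappa> * nsq h + (1 + 1 / \<kappa>) * nsq (\<lambda>x. f x - h x)"
proof -
  have d: "(\<lambda>x. f x - h x) \<in> L2b" by (intro L2b_diff f h)
  have "E f u \<le> (1 + \<kappa>) * E h u + (1 + 1 / \<kappa>) * E (\<lambda>x. f x - h x) u"
  proof (rule has_sum_mono[OF has_sum_E[OF f]])
    show "((\<lambda>s. (1 + \<kappa>) * (norm (coef h u s))\<^sup>2 + (1 + 1 / \<kappa>) * (norm (coef (\<lambda>x. f x - h x) u s))\<^sup>2) has_sum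
        (1 + \<kappa>) * E h u + (1 + 1 / \<kappa>) * E (\<lambda>x. f x - h x) u) S"
      by (intro has_sum_add has_sum_cmult_right has_sum_E h d)
    show "(norm (coef f u s))\<^sup>2 \<le> (1 + \<kappa>) * (norm (coef h u s))\<^sup>2 + (1 + 1 / \<kappa>) * (norm (coef (\<lambda>x. f x - h x) u s))\<^sup>2" for s
      unfolding coef_diff[OF f h] by (rule norm_sq_perturb[OF l])
  qed
  also have "\<dots> \<le> E h u + \<kappa> * nsq h + (1 + 1 / \<kappa>) * nsq (\<lambda>x. f x - h x)"
  proof -
    have "\<kappa> * E h u \<le> \<kappa> * nsq h" using l by (intro mult_left_mono E_le h) simp
    moreover have "(1 + 1 / \<kappa>) * E (\<lambda>x. f x - h x) u \<le> (1 + 1 / \<kappa>) * nsq (\<lambda>x. f x - h x)"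
      using l by (intro mult_left_mono E_le d) simp
    moreover have "(1 + \<kappa>) * E h u = E h u + \<kappa> * E h u" by (simp add: algebra_simps)
    ultimately show ?thesis by linarith
  qed
  finally show ?thesis .
qed

text \<open>Changing the shift amounts to translating \<open>f\<close>, so mean-square continuity of
  translation applies, uniformly in the base point.\<close>

lemma E_uniform_continuous:
  assumes f: "f \<in> L2b" and supp: "supported f" and e: "\<epsilon> > 0"
  obtains \<eta> where "\<eta> > 0" "\<And>u v. \<bar>u - v\<bar> < \<eta> \<Longrightarrow> \<bar>E f u - E f v\<bar> < \<epsilon>"
proof -
  \<comment> \<open>Half of \<open>\<epsilon>\<close> pays for \<open>\<kappa> * nsq f\<close>, the
    other half for the error term weighted by \<open>1 + 1 / \<kappa>\<close>; the
    \<open>+ 1\<close> keeps the denominator positive when \<open>nsq f\<close> is 0.\<close>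
  define \<kappa> where "\<kappa> = \<epsilon> / (2 * (nsq f + 1))"
  have l: "\<kappa> > 0" using e nsq_nonneg[of f] by (simp add: \<kappa>_def add_nonneg_pos)
  have ll: "\<kappa> * nsq f < \<epsilon> / 2"
  proof -
    have "nsq f / (nsq f + 1) < 1" using nsq_nonneg[of f] by (simp add: add_nonneg_pos)
    then have "\<epsilon> / 2 * (nsq f / (nsq f + 1)) < \<epsilon> / 2 * 1" using e by (intro mult_strict_left_mono) auto
    moreover have "\<kappa> * nsq f = \<epsilon> / 2 * (nsq f / (nsq f + 1))" by (simp add: \<kappa>_def)
    ultimately show ?thesis by simp
  qed
  define \<beta> where "\<beta> = \<epsilon> / (2 * (1 + 1 / \<kappa>))"
  have b: "\<beta> > 0" using e l by (simp add: \<beta>_def add_pos_pos)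
  have bl: "(1 + 1 / \<kappa>) * \<beta> = \<epsilon> / 2"
  proof -
    have "1 + 1 / \<kappa> > 0" using l by (simp add: add_pos_pos)
    moreover have "d * (\<epsilon> / (2 * d)) = \<epsilon> / 2" if "d > 0" for d using that by simp
    ultimately show ?thesis unfolding \<beta>_def by blast
  qed
  have "\<forall>\<^sub>F v in at 0. nsq (\<lambda>x. f (x + v) - f x) < \<beta>"
    using order_tendstoD(2)[OF nsq_translate_tendsto[OF f, of L] b] supp by (simp add: supported_def)
  then obtain \<eta> where \<eta>: "\<eta> > 0" "\<And>v. v \<noteq> 0 \<Longrightarrow> \<bar>v\<bar> < \<eta> \<Longrightarrow> nsq (\<lambda>x. f (x + v) - f x) < \<beta>"
    unfolding eventually_at by (auto simp: dist_norm)
  have key: "E f u - E f v < \<epsilon>" if "\<bar>u - v\<bar> < \<eta>" for u v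
  proof (cases "u = v")
    case False
    define h where "h = (\<lambda>x. f (x - (v - u)))"
    have h: "h \<in> L2b" unfolding h_def by (rule L2b_shift[OF f])
    have "E f u = E h v" by (simp add: h_def E_translate)
    also have "\<dots> \<le> E f v + \<kappa> * nsq f + (1 + 1 / \<kappa>) * nsq (\<lambda>x. h x - f x)"
      by (rule E_perturb[OF h f l])
    also have "(1 + 1 / \<kappa>) * nsq (\<lambda>x. h x - f x) < (1 + 1 / \<kappa>) * \<beta>"
      using \<eta>(2)[of "u - v"] that False l by (intro mult_strict_left_mono) (auto simp: h_def algebra_simps add_pos_pos)
    finally show ?thesis using ll bl by linarith
  qed (use e in simp)
  show thesis
  proof (rule that[OF \<eta>(1)])
    fix u v assume "\<bar>u - v\<bar> < \<eta>"
    then show "\<bar>E f u - E f v\<bar> < \<epsilon>" using key[of u v] key[of v u] by (simp add: abs_minus_commute)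
  qed
qed

lemma E_continuous:
  assumes f: "f \<in> L2b" and supp: "supported f"
  shows "continuous_on A (E f)"
  unfolding continuous_on_iff dist_real_def
proof (intro ballI allI impI)
  fix x e :: real assume "e > 0"
  from E_uniform_continuous[OF f supp this] obtain \<eta> where "\<eta> > 0" "\<And>u v. \<bar>u - v\<bar> < \<eta> \<Longrightarrow> \<bar>E f u - E f v\<bar> < e" by metis
  then show "\<exists>d>0. \<forall>x'\<in>A. \<bar>x' - x\<bar> < d \<longrightarrow> \<bar>E f x' - E f x\<bar> < e" by auto
qed

section \<open>Test functions cut out of the window\<close>

definition freq :: real where "freq = (SOME s. s \<in> S)"

lemma freq: "freq \<in> S"
  unfolding freq_def using nonempty(2) by (simp add: some_in_eq)

text \<open>Modulation by a frequency from \<open>S\<close> makes every translate of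
  \<open>g0\<close> along \<open>T\<close> a basis element up to a phase.\<close>

definition g0 :: "real \<Rightarrow> complex" where "g0 = gabor g (0, freq)"

lemma g0_L2: "g0 \<in> L2b" and g0_supp: "supported g0"
  by (auto simp: supported_def g0_def gabor_simp g_supp intro: gabor_L2b g_L2)

lemma norm_g0: "norm (g0 x) = norm (g x)"
  by (simp add: g0_def gabor_simp norm_mult)

text \<open>Orthonormality against that basis element: the scalar form of the mutual orthogonality
  of the projections along \<open>T\<close>.\<close>

lemma E_g0:
  assumes t: "t \<in> T" and t': "t' \<in> T"
  shows "E g0 (t' - t) = (if t' = t then 1 else 0)"
proof -
  have "coef (\<lambda>x. g0 (x - t)) t' s = cis (- (2 * pi * freq * t)) * ip (gabor g (t, freq)) (gabor g (t', s))" for s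
  proof -
    have "(\<lambda>x. g0 (x - t)) = (\<lambda>x. cis (- (2 * pi * freq * t)) * gabor g (t, freq) x)"
    proof
      fix x
      have "cis (2 * pi * freq * (x - t)) = cis (- (2 * pi * freq * t)) * cis (2 * pi * freq * x)"
        by (simp add: cis_mult algebra_simps)
      then show "g0 (x - t) = cis (- (2 * pi * freq * t)) * gabor g (t, freq) x"
        by (simp add: g0_def gabor_simp mult_ac)
    qed
    then show ?thesis unfolding coef_def by (simp only: ip_cmult_left)
  qed
  then have "norm (coef g0 (t' - t) s) = norm (ip (gabor g (t, freq)) (gabor g (t', s)))" for s
    by (simp add: norm_coef_translate[symmetric] norm_mult)
  then have "E g0 (t' - t) = (\<Sum>\<^sub>\<infinity>s\<in>S. if t = t' \<and> freq = s then 1 else 0)"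
    unfolding E_def using orthonormal t t' freq by (intro infsum_cong) auto
  also have "\<dots> = (\<Sum>\<^sub>\<infinity>s\<in>{freq}. if t = t' then 1 else 0)"
    using freq by (intro infsum_cong_neutral) auto
  finally show ?thesis by auto
qed

lemma nsq_g0: "nsq g0 = 1"
proof -
  obtain t where t: "t \<in> T" using nonempty by auto
  have "complex_of_real (nsq (gabor g (t, freq))) = 1"
    using orthonormal[of "(t, freq)" "(t, freq)"] t freq by (simp add: ip_self)
  moreover have "nsq (gabor g (t, freq)) = nsq (\<lambda>x. g (x - t))"
    by (simp add: nsq_def gabor_simp norm_mult)
  moreover have "nsq g0 = nsq g" by (simp add: nsq_def norm_g0)
  ultimately show ?thesis by (simp add: nsq_shift)
qed

text \<open>The coefficient of the cutoff at shift 0 and frequency \<open>freq\<close> is its own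
  squared norm, the mass of \<open>g\<close> on \<open>J\<close>.\<close>

lemma E_cutoff_pos:
  fixes J :: "real set"
  assumes J: "J \<in> sets borel" and pos: "\<not> (AE x in lborel. x \<in> J \<longrightarrow> g x = 0)"
  shows "(\<lambda>x. indicator J x * g0 x) \<in> L2b" "E (\<lambda>x. indicator J x * g0 x) 0 > 0"
proof -
  let ?\<phi> = "\<lambda>x. indicator J x * g0 x"
  show phi: "?\<phi> \<in> L2b"
    by (rule L2b_bounded_mult[OF g0_L2, where B = 1]) (use J in \<open>auto simp: indicator_def\<close>)
  have "nsq ?\<phi> \<noteq> 0"
  proof
    assume "nsq ?\<phi> = 0"
    then have "AE x in lborel. (norm (?\<phi> x))\<^sup>2 = 0"
      unfolding nsq_def using L2b_integrable[OF phi] by (subst (asm) integral_nonneg_eq_0_iff_AE) auto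
    then have "AE x in lborel. x \<in> J \<longrightarrow> g x = 0"
    proof eventually_elim
      case (elim x)
      then show ?case using norm_g0[of x] by auto
    qed
    then show False using pos by simp
  qed
  have "coef ?\<phi> 0 freq = ip ?\<phi> ?\<phi>"
    unfolding coef_def ip_def g0_def by (intro Bochner_Integration.integral_cong) (auto simp: indicator_def)
  then have "(norm (coef ?\<phi> 0 freq))\<^sup>2 > 0" using \<open>nsq ?\<phi> \<noteq> 0\<close> by (simp add: ip_self)
  also have "(norm (coef ?\<phi> 0 freq))\<^sup>2 \<le> E ?\<phi> 0"
    using has_sum_mono_neutral[OF has_sum_finite[of "{freq}" "\<lambda>s. (norm (coef ?\<phi> 0 s))\<^sup>2"] has_sum_E[OF phi, of 0]] freq
    by simp
  finally show "E ?\<phi> 0 > 0" .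
qed

lemma not_AE_g: "\<not> (AE x in lborel. g x = 0)"
proof
  assume "AE x in lborel. g x = 0"
  then have "nsq g0 = 0"
    unfolding nsq_def norm_g0 by (intro integral_eq_zero_AE) (auto elim: eventually_mono)
  then show False by (simp add: nsq_g0)
qed

text \<open>\<open>\<phi>\<close> is a piece of \<open>g0\<close> at the right end of the support:
  it carries mass, yet \<open>g\<close> moved left by \<open>\<zeta>\<close> or more no longer
  reaches it.\<close>

lemma right_end_test:
  assumes z: "\<zeta> > 0"
  obtains \<phi> where "\<phi> \<in> L2b" "supported \<phi>" "E \<phi> 0 > 0" "\<And>u. u \<le> - \<zeta> \<Longrightarrow> E \<phi> u = 0"
proof -
  define Y where "Y = {y. AE x in lborel. x > y \<longrightarrow> g x = 0}"
  have "L \<in> Y" using g_supp by (auto simp: Y_def)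
  have low: "y \<ge> - L" if "y \<in> Y" for y
  proof (rule ccontr)
    assume neg: "\<not> - L \<le> y"
    have "AE x in lborel. x > y \<longrightarrow> g x = 0" using that by (simp add: Y_def)
    then have "AE x in lborel. g x = 0"
    proof eventually_elim
      case (elim x)
      then show ?case using neg g_supp[of x] by (cases "x > y") auto
    qed
    then show False using not_AE_g by simp
  qed
  have bdd: "bdd_below Y" using low by (auto simp: bdd_below_def)
  define h where "h = Inf Y"
  \<comment> \<open>With \<open>y\<close> barely above the infimum, \<open>y - \<zeta>\<close> falls
    below it: \<open>g\<close> vanishes beyond \<open>y\<close> but still has mass beyond
    \<open>y - \<zeta>\<close>.\<close>
  obtain y where y: "y \<in> Y" "y < h + \<zeta> / 2"
    using cInf_lessD[of Y "h + \<zeta> / 2"] \<open>L \<in> Y\<close> z by (auto simp: h_def)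
  have notY: "y - \<zeta> \<notin> Y"
    using cInf_lower[OF _ bdd, of "y - \<zeta>"] y z by (auto simp: h_def)
  define \<phi> where "\<phi> = (\<lambda>x. indicator {y - \<zeta><..} x * g0 x)"
  have "\<not> (AE x in lborel. x \<in> {y - \<zeta><..} \<longrightarrow> g x = 0)" using notY by (simp add: Y_def)
  then have "\<phi> \<in> L2b" "E \<phi> 0 > 0" unfolding \<phi>_def by (intro E_cutoff_pos; simp)+
  moreover have "E \<phi> u = 0" if "u \<le> - \<zeta>" for u
  proof (rule E_eq_0)
    have "AE x in lborel. x > y \<longrightarrow> g x = 0" using y by (simp add: Y_def)
    then have "AE x in lborel. (- u) + 1 * x > y \<longrightarrow> g ((- u) + 1 * x) = 0"
      using L2b_measurable[OF g_L2] by (intro AE_borel_affine) auto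
    then show "AE x in lborel. \<phi> x * cnj (g (x - u)) = 0"
    proof eventually_elim
      case (elim x)
      then show ?case using that by (auto simp: \<phi>_def indicator_def)
    qed
  qed
  ultimately show thesis using that[of \<phi>] g0_supp by (auto simp: \<phi>_def supported_def)
qed

text \<open>Mirror image at the left end. The two tests control displacements on the two sides of a
  window; this one also detects the next point of \<open>T\<close>.\<close>

lemma left_end_test:
  assumes z: "\<zeta> > 0"
  obtains \<phi> where "\<phi> \<in> L2b" "supported \<phi>" "E \<phi> 0 > 0" "\<And>u. u \<ge> \<zeta> \<Longrightarrow> E \<phi> u = 0"
proof -
  define Y where "Y = {y. AE x in lborel. x < y \<longrightarrow> g x = 0}"
  have "- L \<in> Y" using g_supp by (auto simp: Y_def)
  have low: "y \<le> L" if "y \<in> Y" for y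
  proof (rule ccontr)
    assume neg: "\<not> y \<le> L"
    have "AE x in lborel. x < y \<longrightarrow> g x = 0" using that by (simp add: Y_def)
    then have "AE x in lborel. g x = 0"
    proof eventually_elim
      case (elim x)
      then show ?case using neg g_supp[of x] by (cases "x < y") auto
    qed
    then show False using not_AE_g by simp
  qed
  have bdd: "bdd_above Y" using low by (auto simp: bdd_above_def)
  define h where "h = Sup Y"
  obtain y where y: "y \<in> Y" "y > h - \<zeta> / 2"
    using less_cSupD[of Y "h - \<zeta> / 2"] \<open>- L \<in> Y\<close> z by (auto simp: h_def)
  have notY: "y + \<zeta> \<notin> Y"
    using cSup_upper[OF _ bdd, of "y + \<zeta>"] y z by (auto simp: h_def)
  define \<phi> where "\<phi> = (\<lambda>x. indicator {..<y + \<zeta>} x * g0 x)"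
  have "\<not> (AE x in lborel. x \<in> {..<y + \<zeta>} \<longrightarrow> g x = 0)" using notY by (simp add: Y_def)
  then have "\<phi> \<in> L2b" "E \<phi> 0 > 0" unfolding \<phi>_def by (intro E_cutoff_pos; simp)+
  moreover have "E \<phi> u = 0" if "u \<ge> \<zeta>" for u
  proof (rule E_eq_0)
    have "AE x in lborel. x < y \<longrightarrow> g x = 0" using y by (simp add: Y_def)
    then have "AE x in lborel. (- u) + 1 * x < y \<longrightarrow> g ((- u) + 1 * x) = 0"
      using L2b_measurable[OF g_L2] by (intro AE_borel_affine) auto
    then show "AE x in lborel. \<phi> x * cnj (g (x - u)) = 0"
    proof eventually_elim
      case (elim x)
      then show ?case using that by (auto simp: \<phi>_def indicator_def)
    qed
  qed
  ultimately show thesis using that[of \<phi>] g0_supp by (auto simp: \<phi>_def supported_def)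
qed

text \<open>\<open>E g0\<close> is 1 at 0 and 0 at every other difference of \<open>T\<close>, and a
  uniformly continuous function needs room for this drop.\<close>

lemma T_separated: obtains \<rho> where "\<rho> > 0" "\<And>t t'. t \<in> T \<Longrightarrow> t' \<in> T \<Longrightarrow> t \<noteq> t' \<Longrightarrow> \<bar>t - t'\<bar> \<ge> \<rho>"
proof -
  obtain \<eta> where \<eta>: "\<eta> > 0" "\<And>u v. \<bar>u - v\<bar> < \<eta> \<Longrightarrow> \<bar>E g0 u - E g0 v\<bar> < 1"
    using E_uniform_continuous[OF g0_L2 g0_supp zero_less_one] by auto
  have "\<bar>t - t'\<bar> \<ge> \<eta>" if "t \<in> T" "t' \<in> T" "t \<noteq> t'" for t t'
    using \<eta>(2)[of "t - t'" "t - t"] E_g0[of t' t] E_g0[of t t] that by force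
  then show thesis using that \<eta>(1) by blast
qed

text \<open>Around a point far from \<open>T\<close> no term of \<open>E_tile\<close> for
  \<open>g0\<close> would survive, although the sum is 1.\<close>

lemma T_relatively_dense: "\<exists>t\<in>T. \<bar>t - x\<bar> \<le> 2 * L"
proof (rule ccontr)
  assume neg: "\<not> ?thesis"
  have "E g0 (t - x) = 0" if "t \<in> T" for t
    using neg that by (intro E_supp[OF g0_supp]) (auto simp: not_le)
  then have "((\<lambda>t. E g0 (t - x)) has_sum 0) T" by (simp add: has_sum_0)
  then show False using E_tile[OF g0_L2, of x] has_sum_unique nsq_g0 by (metis zero_neq_one)
qed

lemma finite_T_Icc: "finite (T \<inter> {a..b})"
  using T_separated finite_separated_Icc by metis

end

section \<open>Rigidity of small displacements\<close>

lemma abs_sum_le_card: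
  fixes f :: "real \<Rightarrow> real"
  assumes fin: "finite F" and zero: "\<And>t. t \<in> F \<Longrightarrow> t \<notin> G \<Longrightarrow> f t = 0"
    and le: "\<And>t. t \<in> F \<Longrightarrow> t \<in> G \<Longrightarrow> \<bar>f t\<bar> \<le> b" and card: "card (F \<inter> G) \<le> n" and b: "b \<ge> 0"
  shows "\<bar>sum f F\<bar> \<le> real n * b"
proof -
  have "sum f F = sum f (F \<inter> G)" using fin zero by (intro sum.mono_neutral_right) auto
  then have "\<bar>sum f F\<bar> \<le> (\<Sum>t\<in>F \<inter> G. \<bar>f t\<bar>)" using sum_abs by metis
  also have "\<dots> \<le> real (card (F \<inter> G)) * b" using le by (intro sum_bounded_above) auto
  also have "\<dots> \<le> real n * b" using card b by (intro mult_right_mono) auto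
  finally show ?thesis .
qed

text \<open>
  Here \<open>\<delta>\<close> is a displacement of the points of \<open>F\<close>, and \<open>e\<close> is the energy of a test function
  concentrated at one end of the window, so that the identity \<open>\<Lambda>\<close> at \<open>x = t\<close> bounds \<open>\<delta> t\<close> by the
  displacements on one side of \<open>t\<close>; the sign \<open>s\<close> selects the side.
\<close>

lemma displacement_growth:
  fixes F :: "real set" and \<delta> e :: "real \<Rightarrow> real" and z :: "real \<Rightarrow> real \<Rightarrow> real"
  assumes fin: "finite F" and s: "\<bar>s\<bar> = 1"
    and sep: "\<And>x y. x \<in> F \<Longrightarrow> y \<in> F \<Longrightarrow> x \<noteq> y \<Longrightarrow> \<bar>x - y\<bar> \<ge> \<rho>"
    and card: "\<And>x. card (F \<inter> {x-R..x+R}) \<le> n0"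
    and z: "\<And>x t. t \<in> F \<Longrightarrow> \<bar>z x t - (t - x)\<bar> \<le> \<eta>" and \<eta>: "\<eta> \<le> 1" and R: "r + 1 \<le> R" "R > 0"
    and e_supp: "\<And>u. \<bar>u\<bar> > r \<Longrightarrow> e u = 0" and e_bound: "\<And>u. \<bar>e u\<bar> \<le> B"
    and e_pos: "\<And>u. \<bar>u\<bar> \<le> \<eta> \<Longrightarrow> e u \<ge> c" and c: "c > 0"
    and e_side: "\<And>u. s * u \<le> - \<rho> + \<eta> \<Longrightarrow> e u = 0"
    and \<Lambda>: "\<And>x. \<bar>x\<bar> \<le> 2 * R \<Longrightarrow> (\<Sum>t\<in>F. \<delta> t * e (z x t)) = k"
    and m0: "\<And>t. t \<in> F \<Longrightarrow> \<bar>t\<bar> \<le> R \<Longrightarrow> \<bar>\<delta> t\<bar> \<le> m" "m \<ge> 0"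
    and C: "C = 1 + 2 * real n0 * B / c"
    and t: "t \<in> F" "- R - real n * \<rho> \<le> s * t" "- 2 * R \<le> s * t" "s * t \<le> R"
  shows "\<bar>\<delta> t\<bar> \<le> C ^ n * m"
  using t
proof (induction n arbitrary: t)
  case 0
  have "\<bar>t\<bar> = \<bar>s * t\<bar>" using s by (simp add: abs_mult)
  then have "\<bar>t\<bar> \<le> R" using 0 by auto
  then show ?case using m0 0 by simp
next
  case (Suc n)
  have B: "B \<ge> 0" using e_bound[of 0] by simp
  have C1: "C \<ge> 1" using B c by (simp add: C)
  show ?case
  proof (cases "- R - real n * \<rho> \<le> s * t")
    case True
    then have "\<bar>\<delta> t\<bar> \<le> C ^ n * m" using Suc by simp
    also have "\<dots> \<le> C ^ Suc n * m"
      using C1 m0(2) by (intro mult_right_mono power_increasing) auto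
    finally show ?thesis .
  next
    case False
    have abst: "\<bar>u\<bar> = \<bar>s * u\<bar>" for u using s by (simp add: abs_mult)
    have tR: "\<bar>t\<bar> \<le> 2 * R" using abst[of t] Suc.prems R(2) by auto
    have far: "e (z x u) = 0" if "u \<in> F" "u \<notin> {x-R..x+R}" for x u
    proof (rule e_supp)
      have "\<bar>u - x\<bar> > R" using that by auto
      then show "\<bar>z x u\<bar> > r" using z[OF that(1), of x] \<eta> R by linarith
    qed
    \<comment> \<open>At \<open>x = 0\<close> only central points, displaced by at most
      \<open>m\<close>, contribute; this bounds the unknown constant \<open>k\<close>.\<close>
    have "\<bar>k\<bar> \<le> real n0 * (m * B)"
    proof -
      have "\<bar>\<Sum>u\<in>F. \<delta> u * e (z 0 u)\<bar> \<le> real n0 * (m * B)"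
      proof (rule abs_sum_le_card[OF fin _ _ card[of 0]])
        fix u assume u: "u \<in> F" "u \<in> {0-R..0+R}"
        then have "\<bar>\<delta> u\<bar> \<le> m" using m0(1) by auto
        then show "\<bar>\<delta> u * e (z 0 u)\<bar> \<le> m * B"
          unfolding abs_mult using e_bound m0(2) by (intro mult_mono) auto
      qed (use far B m0(2) in auto)
      then show ?thesis using \<Lambda>[of 0] R(2) by simp
    qed
    \<comment> \<open>\<open>\<Lambda>\<close> at \<open>x = t\<close> is to be solved for
      \<open>\<delta> t\<close>. Points beyond \<open>t\<close> are invisible to \<open>e\<close>;
      those on the inner side lie at least \<open>\<rho>\<close> further in, where the induction
      hypothesis applies. Each step gains a strip of width \<open>\<rho>\<close> at the price of a
      factor \<open>C\<close>.\<close>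
    moreover have "\<bar>\<Sum>u\<in>F - {t}. \<delta> u * e (z t u)\<bar> \<le> real n0 * ((C ^ n * m) * B)"
    proof (rule abs_sum_le_card[where G = "{t-R..t+R}"])
      have "card ((F - {t}) \<inter> {t-R..t+R}) \<le> card (F \<inter> {t-R..t+R})"
        using fin by (intro card_mono) auto
      then show "card ((F - {t}) \<inter> {t-R..t+R}) \<le> n0" using card[of t] by linarith
      fix u assume u: "u \<in> F - {t}" "u \<in> {t-R..t+R}"
      show "\<bar>\<delta> u * e (z t u)\<bar> \<le> C ^ n * m * B"
      proof (cases "s * u < s * t")
        case True
        have "\<rho> \<le> \<bar>s * (u - t)\<bar>" using sep[of u t] u Suc.prems abst by auto
        then have "s * u - s * t \<le> - \<rho>" using True by (simp add: right_diff_distrib)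
        moreover have "\<bar>s * (z t u - (u - t))\<bar> \<le> \<eta>" using z[of u t] u abst by simp
        ultimately have "s * z t u \<le> - \<rho> + \<eta>" by (simp add: algebra_simps abs_le_iff)
        then show ?thesis using e_side B C1 m0(2) by simp
      next
        case False
        have "\<rho> \<le> \<bar>s * (u - t)\<bar>" using sep[of u t] u Suc.prems abst by auto
        then have "s * u - s * t \<ge> \<rho>" using False by (simp add: right_diff_distrib)
        moreover have "\<bar>s * (u - t)\<bar> \<le> R" using u abst[of "u - t"] by auto
        then have "s * u - s * t \<le> R" by (simp add: right_diff_distrib)
        \<comment> \<open>Positivity holds because \<open>s * t\<close> lies below the threshold for
          \<open>n\<close> but not below that for \<open>Suc n\<close>.\<close>
        moreover have "\<rho> > 0"
          using Suc.prems(2) \<open>\<not> - R - real n * \<rho> \<le> s * t\<close> by (simp add: algebra_simps)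
        then have "real n * \<rho> \<ge> 0" by simp
        then have "s * t \<le> - R" using \<open>\<not> - R - real n * \<rho> \<le> s * t\<close> by linarith
        ultimately have "\<bar>\<delta> u\<bar> \<le> C ^ n * m"
          using u Suc.prems False \<open>\<not> - R - real n * \<rho> \<le> s * t\<close> R(2)
          by (intro Suc.IH) (auto simp: algebra_simps)
        then show ?thesis unfolding abs_mult using e_bound C1 m0(2) by (intro mult_mono) auto
      qed
    qed (use fin far B C1 m0(2) in auto)
    moreover have "(\<Sum>u\<in>F. \<delta> u * e (z t u)) = \<delta> t * e (z t t) + (\<Sum>u\<in>F - {t}. \<delta> u * e (z t u))"
      using Suc.prems fin by (intro sum.remove) auto
    ultimately have "\<bar>\<delta> t * e (z t t)\<bar> \<le> real n0 * (m * B) + real n0 * ((C ^ n * m) * B)"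
      using \<Lambda>[OF tR] by linarith
    moreover have "\<bar>\<delta> t\<bar> * c \<le> \<bar>\<delta> t * e (z t t)\<bar>"
    proof -
      have "c \<le> e (z t t)" using z[of t t] Suc.prems by (intro e_pos) simp
      then show ?thesis unfolding abs_mult using c by (intro mult_left_mono) auto
    qed
    moreover have "real n0 * (m * B) \<le> real n0 * ((C ^ n * m) * B)"
    proof -
      have "1 * m \<le> C ^ n * m" using one_le_power[OF C1] m0(2) by (intro mult_right_mono)
      then show ?thesis using B by (intro mult_left_mono mult_right_mono) auto
    qed
    ultimately have "\<bar>\<delta> t\<bar> * c \<le> 2 * real n0 * B * (C ^ n * m)" by (simp add: algebra_simps)
    then have "\<bar>\<delta> t\<bar> \<le> (C - 1) * (C ^ n * m)" using c by (simp add: C field_simps)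
    also have "\<dots> \<le> C * (C ^ n * m)" using C1 m0(2) by (intro mult_right_mono) auto
    finally show ?thesis by (simp add: mult.assoc)
  qed
qed

text \<open>Let \<open>m\<close> be the largest displacement within \<open>R\<close>. Growth from
  both sides bounds the displacements within \<open>2 * R\<close> by \<open>C ^ n * m\<close>. The
  identity for \<open>e0\<close> has right side zero and is nearly diagonal, so it returns a bound
  for \<open>m\<close> by a factor below 1 times \<open>m\<close>, whence \<open>m = 0\<close>. The
  functions \<open>z0\<close>, \<open>zr\<close>, \<open>zl\<close> stand for mean-value
  points.\<close>

lemma displacement_rigidity:
  fixes F :: "real set" and \<delta> e0 er el :: "real \<Rightarrow> real" and z0 zr zl :: "real \<Rightarrow> real \<Rightarrow> real"
  assumes fin: "finite F"
    and sep: "\<And>x y. x \<in> F \<Longrightarrow> y \<in> F \<Longrightarrow> x \<noteq> y \<Longrightarrow> \<bar>x - y\<bar> \<ge> \<rho>"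
    and card: "\<And>x. card (F \<inter> {x-R..x+R}) \<le> n0"
    and \<eta>: "\<eta> \<le> 1" and R: "r + 1 \<le> R" "R > 0"
    and z0: "\<And>x t. t \<in> F \<Longrightarrow> \<bar>z0 x t - (t - x)\<bar> \<le> \<eta>"
    and zr: "\<And>x t. t \<in> F \<Longrightarrow> \<bar>zr x t - (t - x)\<bar> \<le> \<eta>"
    and zl: "\<And>x t. t \<in> F \<Longrightarrow> \<bar>zl x t - (t - x)\<bar> \<le> \<eta>"
    and supp: "\<And>u. \<bar>u\<bar> > r \<Longrightarrow> e0 u = 0" "\<And>u. \<bar>u\<bar> > r \<Longrightarrow> er u = 0" "\<And>u. \<bar>u\<bar> > r \<Longrightarrow> el u = 0"
    and bound: "\<And>u. \<bar>er u\<bar> \<le> B" "\<And>u. \<bar>el u\<bar> \<le> B"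
    and pos: "\<And>u. \<bar>u\<bar> \<le> \<eta> \<Longrightarrow> er u \<ge> c" "\<And>u. \<bar>u\<bar> \<le> \<eta> \<Longrightarrow> el u \<ge> c" and c: "c > 0"
    and side: "\<And>u. u \<le> - \<rho> + \<eta> \<Longrightarrow> er u = 0" "\<And>u. u \<ge> \<rho> - \<eta> \<Longrightarrow> el u = 0"
    and \<Lambda>0: "\<And>x. \<bar>x\<bar> \<le> 2 * R \<Longrightarrow> (\<Sum>t\<in>F. \<delta> t * e0 (z0 x t)) = 0"
    and \<Lambda>r: "\<And>x. \<bar>x\<bar> \<le> 2 * R \<Longrightarrow> (\<Sum>t\<in>F. \<delta> t * er (zr x t)) = kr"
    and \<Lambda>l: "\<And>x. \<bar>x\<bar> \<le> 2 * R \<Longrightarrow> (\<Sum>t\<in>F. \<delta> t * el (zl x t)) = kl"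
    and diag: "\<And>u. \<bar>u\<bar> \<le> \<eta> \<Longrightarrow> e0 u \<ge> 1 - \<epsilon>"
    and offdiag: "\<And>t t' u. t \<in> F \<Longrightarrow> t' \<in> F \<Longrightarrow> t \<noteq> t' \<Longrightarrow> \<bar>u - (t' - t)\<bar> \<le> \<eta> \<Longrightarrow> \<bar>e0 u\<bar> \<le> \<epsilon>"
    and C: "C = 1 + 2 * real n0 * B / c" and n: "real n * \<rho> \<ge> R" and \<epsilon>: "\<epsilon> > 0" "\<epsilon> * (real n0 + 1) * C ^ n < 1"
    and t: "t \<in> F" "\<bar>t\<bar> \<le> R"
  shows "\<delta> t = 0"
proof -
  define D where "D = (\<lambda>t. \<bar>\<delta> t\<bar>) ` (F \<inter> {-R..R})"
  define m where "m = Max D"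
  have D: "finite D" "D \<noteq> {}" using fin t by (auto simp: D_def abs_le_iff)
  have m_ge: "\<bar>\<delta> u\<bar> \<le> m" if "u \<in> F" "\<bar>u\<bar> \<le> R" for u
    unfolding m_def using that D by (intro Max_ge) (auto simp: D_def abs_le_iff)
  have m: "m \<ge> 0" using m_ge[OF t] by linarith
  have B: "B \<ge> 0" using bound(1)[of 0] by simp
  have C1: "C \<ge> 1" using B c by (simp add: C)
  \<comment> \<open>The test \<open>er\<close> propagates bounds to the left and \<open>el\<close>
    to the right; \<open>n\<close> steps of length \<open>\<rho>\<close> lead from \<open>R\<close>
    to \<open>2 * R\<close>.\<close>
  have grow: "\<bar>\<delta> u\<bar> \<le> C ^ n * m" if u: "u \<in> F" "\<bar>u\<bar> \<le> 2 * R" for u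
  proof (cases "u \<le> R")
    case True
    show ?thesis
      by (rule displacement_growth[where s = 1, OF fin _ sep card zr \<eta> R supp(2) bound(1) pos(1) c _ \<Lambda>r m_ge m C u(1)])
         (use True side(1) u n in auto)
  next
    case False
    show ?thesis
      by (rule displacement_growth[where s = "-1", OF fin _ sep card zl \<eta> R supp(3) bound(2) pos(2) c _ \<Lambda>l m_ge m C u(1)])
         (use False side(2) u n R in auto)
  qed
  define M where "M = C ^ n * m"
  have M: "M \<ge> 0" using C1 m by (simp add: M_def)
  have small: "\<bar>\<delta> u\<bar> \<le> \<epsilon> * (real n0 + 1) * M" if u: "u \<in> F" "\<bar>u\<bar> \<le> R" for u
  proof -
    have "\<bar>\<Sum>t\<in>F - {u}. \<delta> t * e0 (z0 u t)\<bar> \<le> real n0 * (M * \<epsilon>)"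
    proof (rule abs_sum_le_card[where G = "{u-R..u+R}"])
      have "card ((F - {u}) \<inter> {u-R..u+R}) \<le> card (F \<inter> {u-R..u+R})"
        using fin by (intro card_mono) auto
      then show "card ((F - {u}) \<inter> {u-R..u+R}) \<le> n0" using card[of u] by linarith
      fix t assume t: "t \<in> F - {u}"
      show "\<delta> t * e0 (z0 u t) = 0" if "t \<notin> {u-R..u+R}"
      proof -
        have "\<bar>t - u\<bar> > R" using that by auto
        then have "\<bar>z0 u t\<bar> > r" using z0[of t u] t \<eta> R by auto
        then show ?thesis using supp(1) by simp
      qed
      show "\<bar>\<delta> t * e0 (z0 u t)\<bar> \<le> M * \<epsilon>" if "t \<in> {u-R..u+R}"
      proof -
        have "\<bar>t\<bar> \<le> 2 * R" using that u by auto
        then have "\<bar>\<delta> t\<bar> \<le> M" using grow t by (simp add: M_def)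
        moreover have "\<bar>e0 (z0 u t)\<bar> \<le> \<epsilon>" using offdiag[of u t] z0[of t u] t u by auto
        ultimately show ?thesis unfolding abs_mult using M by (intro mult_mono) auto
      qed
    qed (use fin M \<epsilon> in auto)
    moreover have "(\<Sum>t\<in>F. \<delta> t * e0 (z0 u t)) = \<delta> u * e0 (z0 u u) + (\<Sum>t\<in>F - {u}. \<delta> t * e0 (z0 u t))"
      using u fin by (intro sum.remove) auto
    ultimately have "\<bar>\<delta> u * e0 (z0 u u)\<bar> \<le> real n0 * (M * \<epsilon>)"
      using \<Lambda>0[of u] u R(2) by linarith
    moreover have "\<bar>\<delta> u\<bar> * (1 - \<epsilon>) \<le> \<bar>\<delta> u * e0 (z0 u u)\<bar>"
      unfolding abs_mult using diag[of "z0 u u"] z0[of u u] u by (intro mult_left_mono) auto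
    ultimately have "\<bar>\<delta> u\<bar> \<le> real n0 * (M * \<epsilon>) + \<epsilon> * \<bar>\<delta> u\<bar>" by (simp add: algebra_simps)
    also have "\<epsilon> * \<bar>\<delta> u\<bar> \<le> \<epsilon> * M" using grow[of u] u R(2) \<epsilon> by (intro mult_left_mono) (auto simp: M_def)
    finally show ?thesis by (simp add: algebra_simps)
  qed
  have "m \<in> D" unfolding m_def using D by (rule Max_in)
  then obtain u where "u \<in> F" "\<bar>u\<bar> \<le> R" "m = \<bar>\<delta> u\<bar>" by (auto simp: D_def abs_le_iff)
  then have "m \<le> \<epsilon> * (real n0 + 1) * C ^ n * m" using small[of u] by (simp add: M_def mult.assoc)
  then have "m = 0" using \<epsilon>(2) m by (metis less_le_not_le mult_le_cancel_right1 not_less order_antisym_conv)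
  then show ?thesis using m_ge[OF t] by simp
qed

section \<open>Counting, mean values and primitives\<close>

lemma card_separated_Icc:
  fixes A :: "real set"
  assumes \<rho>: "\<rho> > 0" and sep: "\<And>x y. x \<in> A \<Longrightarrow> y \<in> A \<Longrightarrow> x \<noteq> y \<Longrightarrow> \<bar>x - y\<bar> \<ge> \<rho>"
  shows "card (A \<inter> {a..b}) \<le> nat (\<lceil>(b - a) / \<rho>\<rceil> + 2)"
proof -
  have inj: "inj_on (\<lambda>x. \<lfloor>x / \<rho>\<rfloor>) (A \<inter> {a..b})"
    by (rule inj_on_subset[OF inj_on_floor_separated[OF assms]]) auto
  have "card (A \<inter> {a..b}) \<le> card {\<lfloor>a / \<rho>\<rfloor>..\<lfloor>b / \<rho>\<rfloor>}"
    using \<rho> by (intro card_inj_on_le[OF inj]) (auto intro!: floor_mono divide_right_mono)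
  also have "\<dots> \<le> nat (\<lceil>(b - a) / \<rho>\<rceil> + 2)"
    unfolding diff_divide_distrib by (simp add: nat_le_eq_zle) linarith
  finally show ?thesis .
qed

text \<open>The intermediate point becomes a function of base point and signed increment, the form
  in which \<open>displacement_rigidity\<close> receives it.\<close>

lemma mean_value_signed:
  fixes P e :: "real \<Rightarrow> real"
  assumes "\<And>x. (P has_real_derivative e x) (at x)"
  obtains z where "\<And>v d. \<bar>z v d - v\<bar> \<le> \<bar>d\<bar>" "\<And>v d. P (v + d) - P v = d * e (z v d)"
proof -
  have "\<exists>y. \<bar>y - v\<bar> \<le> \<bar>d\<bar> \<and> P (v + d) - P v = d * e y" for v d
  proof -
    consider "d = 0" | "d > 0" | "d < 0" by linarith
    then show ?thesis
    proof cases
      case 2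
      then obtain y where "y > v" "y < v + d" "P (v + d) - P v = (v + d - v) * e y"
        using MVT2[of v "v + d" P e] assms by auto
      then show ?thesis by (intro exI[of _ y]) auto
    next
      case 3
      then obtain y where "y > v + d" "y < v" "P v - P (v + d) = (v - (v + d)) * e y"
        using MVT2[of "v + d" v P e] assms by auto
      then show ?thesis by (intro exI[of _ y]) auto
    qed auto
  qed
  then have "\<forall>v. \<forall>d. \<exists>y. \<bar>y - v\<bar> \<le> \<bar>d\<bar> \<and> P (v + d) - P v = d * e y" by blast
  then obtain z where "\<forall>v d. \<bar>z v d - v\<bar> \<le> \<bar>d\<bar> \<and> P (v + d) - P v = d * e (z v d)" by metis
  then show thesis using that by blast
qed

lemma antiderivative_UNIV:
  fixes f :: "real \<Rightarrow> real"
  assumes "continuous_on UNIV f"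
  obtains P where "\<And>x. (P has_real_derivative f x) (at x)"
proof -
  have "\<exists>P. \<forall>x. (-\<infinity>::ereal) < ereal x \<longrightarrow> ereal x < \<infinity> \<longrightarrow> (P has_vector_derivative f x) (at x)"
    using assms by (intro einterval_antiderivative) (auto simp: continuous_on_eq_continuous_at)
  then show thesis using that by (auto simp: has_real_derivative_iff_has_vector_derivative)
qed

text \<open>Differentiation in \<open>x\<close> gives back the tiling sum, which is constant on the
  whole range.\<close>

lemma primitive_sum_linear:
  fixes P e \<tau> :: "real \<Rightarrow> real"
  assumes P: "\<And>x. (P has_real_derivative e x) (at x)" and fin: "finite F"
    and c: "\<And>x. \<bar>x\<bar> \<le> X \<Longrightarrow> (\<Sum>d\<in>F. e (\<tau> d - x)) = c" and x: "\<bar>x\<bar> \<le> X"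
  shows "(\<Sum>d\<in>F. P (\<tau> d - x)) = (\<Sum>d\<in>F. P (\<tau> d)) - c * x"
proof -
  have "\<exists>k. \<forall>x\<in>{-X..X}. (\<Sum>d\<in>F. P (\<tau> d - x)) + c * x = k"
  proof (rule has_field_derivative_zero_constant)
    fix x assume x: "x \<in> {-X..X}"
    have "((\<lambda>x. P (\<tau> d - x)) has_real_derivative - e (\<tau> d - x)) (at x within {-X..X})" for d
    proof -
      have "((\<lambda>x. P (\<tau> d - x)) has_real_derivative e (\<tau> d - x) * (0 - 1)) (at x within {-X..X})"
        by (rule DERIV_chain'[where f = "\<lambda>x. \<tau> d - x" and g = P]) (auto intro!: derivative_eq_intros P)
      then show ?thesis by simp
    qed
    then have "((\<lambda>x. (\<Sum>d\<in>F. P (\<tau> d - x)) + c * x) has_real_derivative (\<Sum>d\<in>F. - e (\<tau> d - x)) + c * 1) (at x within {-X..X})"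
      by (intro derivative_intros) auto
    moreover have "(\<Sum>d\<in>F. - e (\<tau> d - x)) + c * 1 = 0"
      using c[of x] x by (auto simp: sum_negf abs_le_iff)
    ultimately show "((\<lambda>x. (\<Sum>d\<in>F. P (\<tau> d - x)) + c * x) has_real_derivative 0) (at x within {-X..X})" by simp
  qed simp
  then obtain k where k: "\<And>x. x \<in> {-X..X} \<Longrightarrow> (\<Sum>d\<in>F. P (\<tau> d - x)) + c * x = k" by blast
  have "x \<in> {-X..X}" "0 \<in> {-X..X}" using x by auto
  then show ?thesis using k[of x] k[of 0] by auto
qed

section \<open>Recurrence of window patterns in \<open>T\<close>\<close>

context gabor_parseval
begin

definition window :: "real \<Rightarrow> real \<Rightarrow> real set" where
  "window K a = {d. a + d \<in> T} \<inter> {-K..K}"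

text \<open>Only points within \<open>2 * L\<close> of \<open>x\<close> carry energy, and the window
  contains all of them.\<close>

lemma window_tile:
  assumes f: "f \<in> L2b" and supp: "supported f" and x: "\<bar>x\<bar> \<le> K - 2 * L"
  shows "(\<Sum>d\<in>window K a. E f (d - x)) = nsq f"
proof -
  have inj: "inj_on (\<lambda>d. a + d) (window K a)" by (auto simp: inj_on_def)
  have im: "(\<lambda>d. a + d) ` window K a \<subseteq> T \<inter> {a-K..a+K}" by (auto simp: window_def)
  have fin: "finite (window K a)"
    using finite_imageD[OF finite_subset[OF im finite_T_Icc] inj] .
  have "((\<lambda>t. E f (t - (a + x))) has_sum nsq f) T" by (rule E_tile[OF f])
  then have "((\<lambda>t. E f (t - (a + x))) has_sum nsq f) ((\<lambda>d. a + d) ` window K a)"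
  proof (subst has_sum_cong_neutral[where T = T])
    fix t assume t: "t \<in> T - (\<lambda>d. a + d) ` window K a"
    then have "t - a \<notin> window K a" by (metis DiffE add.commute diff_add_cancel imageI)
    then have "t - a \<notin> {-K..K}" using t by (auto simp: window_def)
    then have "\<bar>t - (a + x)\<bar> > 2 * L" using x by auto
    then show "E f (t - (a + x)) = 0" by (rule E_supp[OF supp])
  qed (use im in auto)
  then have "((\<lambda>d. E f (d - x)) has_sum nsq f) (window K a)"
    by (subst (asm) has_sum_reindex[OF inj]) (simp add: o_def)
  then show ?thesis using fin by (simp add: has_sum_finite_iff)
qed

lemma finite_window: "finite (window K a)"
proof -
  have "(\<lambda>d. a + d) ` window K a \<subseteq> T \<inter> {a-K..a+K}" by (auto simp: window_def)
  from finite_imageD[OF finite_subset[OF this finite_T_Icc]] show ?thesis by (simp add: inj_on_def)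
qed

text \<open>Equal cell patterns match the two windows up to \<open>\<eta>\<close>. Subtracting
  primitives of their tiling identities gives the linear relations of
  \<open>displacement_rigidity\<close>, which force the matching to be the identity near the
  centre.\<close>

lemma nearby_windows_coincide:
  assumes R: "R \<ge> 2 * L + 1"
  obtains \<eta> K where "\<eta> > 0" "\<And>a b d. a \<in> T \<Longrightarrow> b \<in> T \<Longrightarrow>
    (\<lambda>d. \<lfloor>d / \<eta>\<rfloor>) ` window K a = (\<lambda>d. \<lfloor>d / \<eta>\<rfloor>) ` window K b \<Longrightarrow> \<bar>d\<bar> \<le> R \<Longrightarrow> a + d \<in> T \<Longrightarrow> b + d \<in> T"
proof -
  obtain \<rho> where \<rho>: "\<rho> > 0" and sep: "\<And>t t'. t \<in> T \<Longrightarrow> t' \<in> T \<Longrightarrow> t \<noteq> t' \<Longrightarrow> \<bar>t - t'\<bar> \<ge> \<rho>"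
    using T_separated by metis
  define n0 where "n0 = nat (\<lceil>2 * R / \<rho>\<rceil> + 2)"
  \<comment> \<open>Tiling is evaluated at \<open>x + \<theta>\<close> with
    \<open>\<bar>x\<bar> \<le> 2 * R\<close> and \<open>\<bar>\<theta>\<bar> \<le> 1\<close>, with a
    margin \<open>2 * L\<close> for the support of the energy.\<close>
  define K where "K = 2 * R + 2 * L + 2"
  have sepw: "\<bar>x - y\<bar> \<ge> \<rho>" if "x \<in> window K a" "y \<in> window K a" "x \<noteq> y" for x y a
    using sep[of "a + x" "a + y"] that by (auto simp: window_def)
  have cardw: "card (window K a \<inter> {x-R..x+R}) \<le> n0" for x a
  proof -
    have "card (window K a \<inter> {x-R..x+R}) \<le> nat (\<lceil>(x + R - (x - R)) / \<rho>\<rceil> + 2)"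
      by (rule card_separated_Icc[OF \<rho> sepw])
    then show ?thesis by (simp add: n0_def)
  qed
  have L2R: "2 * L + 1 \<le> R" "R > 0" using R L_pos by auto
  have "\<rho> / 2 > 0" using \<rho> by simp
  obtain \<phi>r where r: "\<phi>r \<in> L2b" "supported \<phi>r" "E \<phi>r 0 > 0" "\<And>u. u \<le> - (\<rho> / 2) \<Longrightarrow> E \<phi>r u = 0"
    using right_end_test[OF \<open>\<rho> / 2 > 0\<close>] by metis
  obtain \<phi>l where l: "\<phi>l \<in> L2b" "supported \<phi>l" "E \<phi>l 0 > 0" "\<And>u. u \<ge> \<rho> / 2 \<Longrightarrow> E \<phi>l u = 0"
    using left_end_test[OF \<open>\<rho> / 2 > 0\<close>] by metis
  define c where "c = min (E \<phi>r 0) (E \<phi>l 0) / 2"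
  have c: "c > 0" using r l by (simp add: c_def)
  define B where "B = max (nsq \<phi>r) (nsq \<phi>l)"
  define C where "C = 1 + 2 * real n0 * B / c"
  have C1: "C \<ge> 1" using c by (simp add: C_def B_def max_def)
  obtain n where n: "real n * \<rho> \<ge> R"
    using reals_Archimedean3[OF \<rho>] by (metis less_imp_le)
  \<comment> \<open>This makes \<open>\<epsilon> * (real n0 + 1) * C ^ n\<close> one half.
    \<open>C\<close> and \<open>n\<close> are already fixed, and the grid size is chosen only after
    \<open>\<epsilon>\<close>.\<close>
  define \<epsilon> where "\<epsilon> = 1 / (2 * ((real n0 + 1) * C ^ n))"
  have Cn: "C ^ n > 0" using C1 by simp
  have \<epsilon>: "\<epsilon> > 0" "\<epsilon> * (real n0 + 1) * C ^ n < 1"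
  proof -
    have X: "(real n0 + 1) * C ^ n > 0" using Cn by simp
    then show "\<epsilon> > 0" by (simp add: \<epsilon>_def)
    have "X > 0 \<Longrightarrow> 1 / (2 * X) * X < 1" for X :: real by simp
    from this[OF X] show "\<epsilon> * (real n0 + 1) * C ^ n < 1" unfolding \<epsilon>_def mult.assoc .
  qed
  obtain \<eta>1 where \<eta>1: "\<eta>1 > 0" "\<And>u v. \<bar>u - v\<bar> < \<eta>1 \<Longrightarrow> \<bar>E \<phi>r u - E \<phi>r v\<bar> < c"
    using E_uniform_continuous[OF r(1,2) c] by auto
  obtain \<eta>2 where \<eta>2: "\<eta>2 > 0" "\<And>u v. \<bar>u - v\<bar> < \<eta>2 \<Longrightarrow> \<bar>E \<phi>l u - E \<phi>l v\<bar> < c"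
    using E_uniform_continuous[OF l(1,2) c] by auto
  obtain \<eta>3 where \<eta>3: "\<eta>3 > 0" "\<And>u v. \<bar>u - v\<bar> < \<eta>3 \<Longrightarrow> \<bar>E g0 u - E g0 v\<bar> < \<epsilon>"
    using E_uniform_continuous[OF g0_L2 g0_supp \<epsilon>(1)] by auto
  define \<eta>' where "\<eta>' = Min {\<eta>1 / 2, \<eta>2 / 2, \<eta>3 / 2, \<rho> / 2, 1}"
  have \<eta>': "\<eta>' > 0" "\<eta>' < \<eta>1" "\<eta>' < \<eta>2" "\<eta>' < \<eta>3" "\<eta>' \<le> \<rho> / 2" "\<eta>' \<le> 1"
    using \<eta>1(1) \<eta>2(1) \<eta>3(1) \<rho> by (auto simp: \<eta>'_def)
  \<comment> \<open>A point moves by at most \<open>\<eta>\<close> and the common shift will be at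
    most \<open>real n0 * \<eta>\<close>; together they stay within the tolerance
    \<open>\<eta>'\<close>.\<close>
  define \<eta> where "\<eta> = \<eta>' / (real n0 + 1)"
  have \<eta>: "\<eta> > 0" "real n0 * \<eta> + \<eta> = \<eta>'"
  proof -
    have pos: "real n0 + 1 > 0" by simp
    then show "\<eta> > 0" using \<eta>'(1) by (simp add: \<eta>_def)
    have "real n0 * \<eta> + \<eta> = (real n0 + 1) * \<eta>" by (simp add: algebra_simps)
    also have "\<dots> = \<eta>'" using pos by (simp add: \<eta>_def)
    finally show "real n0 * \<eta> + \<eta> = \<eta>'" .
  qed
  have n0\<eta>: "real n0 * \<eta> \<ge> 0" using \<eta> by simp
  obtain P0 where P0: "\<And>x. (P0 has_real_derivative E g0 x) (at x)"
    using antiderivative_UNIV[OF E_continuous[OF g0_L2 g0_supp]] by metis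
  obtain Pr where Pr: "\<And>x. (Pr has_real_derivative E \<phi>r x) (at x)"
    using antiderivative_UNIV[OF E_continuous[OF r(1,2)]] by metis
  obtain Pl where Pl: "\<And>x. (Pl has_real_derivative E \<phi>l x) (at x)"
    using antiderivative_UNIV[OF E_continuous[OF l(1,2)]] by metis
  obtain z0 where z0: "\<And>v d. \<bar>z0 v d - v\<bar> \<le> \<bar>d\<bar>" "\<And>v d. P0 (v + d) - P0 v = d * E g0 (z0 v d)"
    using mean_value_signed[OF P0] by metis
  obtain zr where zr: "\<And>v d. \<bar>zr v d - v\<bar> \<le> \<bar>d\<bar>" "\<And>v d. Pr (v + d) - Pr v = d * E \<phi>r (zr v d)"
    using mean_value_signed[OF Pr] by metis
  obtain zl where zl: "\<And>v d. \<bar>zl v d - v\<bar> \<le> \<bar>d\<bar>" "\<And>v d. Pl (v + d) - Pl v = d * E \<phi>l (zl v d)"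
    using mean_value_signed[OF Pl] by metis
  have main: "b + d \<in> T"
    if a: "a \<in> T" and b: "b \<in> T" and eq: "(\<lambda>d. \<lfloor>d / \<eta>\<rfloor>) ` window K a = (\<lambda>d. \<lfloor>d / \<eta>\<rfloor>) ` window K b"
      and d: "\<bar>d\<bar> \<le> R" "a + d \<in> T" for a b d
  proof -
    define F where "F = window K a"
    have fin: "finite F" unfolding F_def by (rule finite_window)
    have close: "\<bar>x - y\<bar> < \<eta>" if "\<lfloor>x / \<eta>\<rfloor> = \<lfloor>y / \<eta>\<rfloor>" for x y
    proof -
      have "\<bar>x / \<eta> - y / \<eta>\<bar> < 1" using that by linarith
      then show ?thesis using \<eta>(1) by (simp add: field_simps flip: diff_divide_distrib)
    qed
    have uniq: "x = y" if "x \<in> window K u" "y \<in> window K u" "\<lfloor>x / \<eta>\<rfloor> = \<lfloor>y / \<eta>\<rfloor>" for x y u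
      using sepw[OF that(1,2)] close[OF that(3)] \<eta>' \<eta> n0\<eta> \<rho> by force
    have ex: "\<exists>y. y \<in> window K b \<and> \<lfloor>x / \<eta>\<rfloor> = \<lfloor>y / \<eta>\<rfloor>" if "x \<in> F" for x
      using eq that unfolding F_def by (metis (mono_tags, lifting) image_iff)
    \<comment> \<open>The cells are shorter than \<open>\<rho>\<close>, so each holds at most one
      point of a window and equal patterns yield a bijection.\<close>
    define \<sigma> where "\<sigma> x = (SOME y. y \<in> window K b \<and> \<lfloor>x / \<eta>\<rfloor> = \<lfloor>y / \<eta>\<rfloor>)" for x
    have \<sigma>: "\<sigma> x \<in> window K b" "\<lfloor>x / \<eta>\<rfloor> = \<lfloor>\<sigma> x / \<eta>\<rfloor>" if "x \<in> F" for x
      using someI_ex[OF ex[OF that]] by (auto simp: \<sigma>_def)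
    have bij: "bij_betw \<sigma> F (window K b)"
    proof (rule bij_betw_imageI)
      show "inj_on \<sigma> F"
      proof (rule inj_onI)
        fix x y assume "x \<in> F" "y \<in> F" "\<sigma> x = \<sigma> y"
        then show "x = y" using \<sigma>(2)[of x] \<sigma>(2)[of y] uniq[of x a y] by (simp add: F_def)
      qed
      show "\<sigma> ` F = window K b"
      proof (intro equalityI subsetI)
        fix y assume y: "y \<in> window K b"
        then obtain x where x: "x \<in> F" "\<lfloor>x / \<eta>\<rfloor> = \<lfloor>y / \<eta>\<rfloor>"
          using eq unfolding F_def by (metis (mono_tags, lifting) image_iff)
        then have "\<sigma> x = y" using \<sigma>[OF x(1)] y uniq[of "\<sigma> x" b y] by simp
        then show "y \<in> \<sigma> ` F" using x by blast
      qed (use \<sigma> in auto)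
    qed
    have \<sigma>\<eta>: "\<bar>\<sigma> x - x\<bar> \<le> \<eta>" if "x \<in> F" for x using close[of "\<sigma> x" x] \<sigma>(2)[OF that] by simp
    have tileA: "(\<Sum>d\<in>F. E f (d - x)) = nsq f"
      if "f \<in> L2b" "supported f" "\<bar>x\<bar> \<le> 2 * R + 2" for f x
      unfolding F_def using that by (intro window_tile) (auto simp: K_def)
    have tileB: "(\<Sum>d\<in>F. E f (\<sigma> d - x)) = nsq f"
      if "f \<in> L2b" "supported f" "\<bar>x\<bar> \<le> 2 * R + 2" for f x
      using window_tile[of f x K b, OF that(1,2)] that(3) sum.reindex_bij_betw[OF bij, of "\<lambda>d. E f (d - x)"]
      by (simp add: K_def)
    \<comment> \<open>Roughly the average displacement, weighted by the energies of
      \<open>g0\<close>. As \<open>nsq g0 = 1\<close>, subtracting it from all displacements makes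
      the relation for \<open>g0\<close> homogeneous.\<close>
    define \<theta> where "\<theta> = (\<Sum>d\<in>F. P0 (\<sigma> d)) - (\<Sum>d\<in>F. P0 d)"
    have "\<theta> = (\<Sum>d\<in>F. (\<sigma> d - d) * E g0 (z0 d (\<sigma> d - d)))"
    proof -
      have "P0 (\<sigma> d) - P0 d = (\<sigma> d - d) * E g0 (z0 d (\<sigma> d - d))" for d
        using z0(2)[of d "\<sigma> d - d"] by simp
      then show ?thesis by (simp add: \<theta>_def sum_subtractf[symmetric])
    qed
    moreover have "\<bar>\<Sum>d\<in>F. (\<sigma> d - d) * E g0 (z0 d (\<sigma> d - d))\<bar> \<le> real n0 * (\<eta> * 1)"
    proof (rule abs_sum_le_card[where G = "{0-R..0+R}"])
      show "card (F \<inter> {0-R..0+R}) \<le> n0" unfolding F_def by (rule cardw)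
      fix t assume t: "t \<in> F"
      show "\<bar>(\<sigma> t - t) * E g0 (z0 t (\<sigma> t - t))\<bar> \<le> \<eta> * 1"
        unfolding abs_mult using \<sigma>\<eta>[OF t] E_nonneg[of g0] E_le[OF g0_L2] nsq_g0 by (intro mult_mono) auto
      show "(\<sigma> t - t) * E g0 (z0 t (\<sigma> t - t)) = 0" if "t \<notin> {0-R..0+R}"
      proof -
        have "\<bar>t\<bar> > R" using that by auto
        moreover have "\<bar>z0 t (\<sigma> t - t) - t\<bar> \<le> 1" using z0(1)[of t "\<sigma> t - t"] \<sigma>\<eta>[OF t] \<eta> \<eta>' n0\<eta> by linarith
        ultimately have "\<bar>z0 t (\<sigma> t - t)\<bar> > 2 * L" using R by linarith
        then show ?thesis using E_supp[OF g0_supp] by simp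
      qed
    qed (use fin \<eta> in auto)
    ultimately have \<theta>: "\<bar>\<theta>\<bar> \<le> real n0 * \<eta>" by simp
    define \<delta> where "\<delta> d = \<sigma> d - \<theta> - d" for d
    have \<delta>: "\<bar>\<delta> x\<bar> \<le> \<eta>'" if "x \<in> F" for x
      using \<sigma>\<eta>[OF that] \<theta> \<eta>(2) unfolding \<delta>_def by linarith
    have \<theta>1: "\<bar>\<theta>\<bar> \<le> 1" using \<theta> \<eta> \<eta>' by linarith
    \<comment> \<open>The primitive sums of both windows are linear in \<open>x\<close> with the
      same slope; evaluating one at \<open>x + \<theta>\<close> and the other at \<open>x\<close>
      leaves a difference independent of \<open>x\<close>.\<close>
    have \<Lambda>: "(\<Sum>d\<in>F. \<delta> d * E f (z (d - x) (\<delta> d))) = (\<Sum>d\<in>F. P (\<sigma> d)) - (\<Sum>d\<in>F. P d) - nsq f * \<theta>"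
      if f: "f \<in> L2b" "supported f" and P: "\<And>x. (P has_real_derivative E f x) (at x)"
        and z: "\<And>v d. P (v + d) - P v = d * E f (z v d)" and x: "\<bar>x\<bar> \<le> 2 * R" for f P z x
    proof -
      have "(\<Sum>d\<in>F. \<delta> d * E f (z (d - x) (\<delta> d))) = (\<Sum>d\<in>F. P (\<sigma> d - (x + \<theta>)) - P (d - x))"
      proof (rule sum.cong[OF refl])
        fix d
        have "d - x + \<delta> d = \<sigma> d - (x + \<theta>)" by (simp add: \<delta>_def)
        then show "\<delta> d * E f (z (d - x) (\<delta> d)) = P (\<sigma> d - (x + \<theta>)) - P (d - x)"
          using z[of "d - x" "\<delta> d"] by metis
      qed
      also have "\<dots> = (\<Sum>d\<in>F. P (\<sigma> d - (x + \<theta>))) - (\<Sum>d\<in>F. P (d - x))" by (rule sum_subtractf)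
      also have "(\<Sum>d\<in>F. P (\<sigma> d - (x + \<theta>))) = (\<Sum>d\<in>F. P (\<sigma> d)) - nsq f * (x + \<theta>)"
        using x \<theta>1 by (intro primitive_sum_linear[OF P fin tileB[OF f]]) auto
      also have "(\<Sum>d\<in>F. P (d - x)) = (\<Sum>d\<in>F. P d) - nsq f * x"
        using x by (intro primitive_sum_linear[OF P fin tileA[OF f]]) auto
      finally show ?thesis by (simp add: algebra_simps)
    qed
    have rigid: "\<delta> t = 0" if t: "t \<in> F" "\<bar>t\<bar> \<le> R" for t
    proof (rule displacement_rigidity[where F = F and ?e0.0 = "E g0" and er = "E \<phi>r" and el = "E \<phi>l"
          and ?z0.0 = "\<lambda>x t. z0 (t - x) (\<delta> t)" and zr = "\<lambda>x t. zr (t - x) (\<delta> t)" and zl = "\<lambda>x t. zl (t - x) (\<delta> t)"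
          and \<rho> = \<rho> and R = R and ?n0.0 = n0 and \<eta> = \<eta>' and r = "2 * L" and B = B and c = c and n = n and C = C and \<epsilon> = \<epsilon> and \<delta> = \<delta>
          and kr = "(\<Sum>d\<in>F. Pr (\<sigma> d)) - (\<Sum>d\<in>F. Pr d) - nsq \<phi>r * \<theta>"
          and kl = "(\<Sum>d\<in>F. Pl (\<sigma> d)) - (\<Sum>d\<in>F. Pl d) - nsq \<phi>l * \<theta>"])
      show "finite F" by (rule fin)
      show "\<rho> \<le> \<bar>x - y\<bar>" if "x \<in> F" "y \<in> F" "x \<noteq> y" for x y using sepw that by (simp add: F_def)
      show "card (F \<inter> {x-R..x+R}) \<le> n0" for x unfolding F_def by (rule cardw)
      show "\<bar>z0 (t - x) (\<delta> t) - (t - x)\<bar> \<le> \<eta>'" if "t \<in> F" for x t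
        using z0(1)[of "t - x" "\<delta> t"] \<delta>[OF that] by linarith
      show "\<bar>zr (t - x) (\<delta> t) - (t - x)\<bar> \<le> \<eta>'" if "t \<in> F" for x t
        using zr(1)[of "t - x" "\<delta> t"] \<delta>[OF that] by linarith
      show "\<bar>zl (t - x) (\<delta> t) - (t - x)\<bar> \<le> \<eta>'" if "t \<in> F" for x t
        using zl(1)[of "t - x" "\<delta> t"] \<delta>[OF that] by linarith
      show "E g0 u = 0" "E \<phi>r u = 0" "E \<phi>l u = 0" if "\<bar>u\<bar> > 2 * L" for u
        using E_supp[OF g0_supp that] E_supp[OF r(2) that] E_supp[OF l(2) that] by auto
      show "\<bar>E \<phi>r u\<bar> \<le> B" "\<bar>E \<phi>l u\<bar> \<le> B" for u
        using E_nonneg[of \<phi>r u] E_le[OF r(1), of u] E_nonneg[of \<phi>l u] E_le[OF l(1), of u] by (auto simp: B_def)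
      show "c \<le> E \<phi>r u" "c \<le> E \<phi>l u" if "\<bar>u\<bar> \<le> \<eta>'" for u
      proof -
        have "\<bar>E \<phi>r u - E \<phi>r 0\<bar> < c" "\<bar>E \<phi>l u - E \<phi>l 0\<bar> < c"
          using \<eta>1(2)[of u 0] \<eta>2(2)[of u 0] that \<eta>' by auto
        moreover have "2 * c \<le> E \<phi>r 0" "2 * c \<le> E \<phi>l 0" by (auto simp: c_def)
        ultimately show "c \<le> E \<phi>r u" "c \<le> E \<phi>l u" by linarith+
      qed
      show "E \<phi>r u = 0" if "u \<le> - \<rho> + \<eta>'" for u using r(4)[of u] that \<eta>' by linarith
      show "E \<phi>l u = 0" if "u \<ge> \<rho> - \<eta>'" for u using l(4)[of u] that \<eta>' by linarith
      show "(\<Sum>t\<in>F. \<delta> t * E g0 (z0 (t - x) (\<delta> t))) = 0" if "\<bar>x\<bar> \<le> 2 * R" for x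
        using \<Lambda>[OF g0_L2 g0_supp P0 z0(2) that] by (simp add: nsq_g0 \<theta>_def)
      show "(\<Sum>t\<in>F. \<delta> t * E \<phi>r (zr (t - x) (\<delta> t))) = (\<Sum>d\<in>F. Pr (\<sigma> d)) - (\<Sum>d\<in>F. Pr d) - nsq \<phi>r * \<theta>" if "\<bar>x\<bar> \<le> 2 * R" for x
        by (rule \<Lambda>[OF r(1,2) Pr zr(2) that])
      show "(\<Sum>t\<in>F. \<delta> t * E \<phi>l (zl (t - x) (\<delta> t))) = (\<Sum>d\<in>F. Pl (\<sigma> d)) - (\<Sum>d\<in>F. Pl d) - nsq \<phi>l * \<theta>" if "\<bar>x\<bar> \<le> 2 * R" for x
        by (rule \<Lambda>[OF l(1,2) Pl zl(2) that])
      show "1 - \<epsilon> \<le> E g0 u" if "\<bar>u\<bar> \<le> \<eta>'" for u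
        using \<eta>3(2)[of u 0] E_g0[OF a a] that \<eta>' by auto
      show "\<bar>E g0 u\<bar> \<le> \<epsilon>" if "t \<in> F" "t' \<in> F" "t \<noteq> t'" "\<bar>u - (t' - t)\<bar> \<le> \<eta>'" for t t' u
        using \<eta>3(2)[of u "t' - t"] E_g0[of "a + t" "a + t'"] that \<eta>' by (auto simp: F_def window_def)
    qed (use \<eta>' R L2R c C_def n \<epsilon> t in auto)
    \<comment> \<open>Both windows contain their centre, so the matching fixes 0. Rigidity there
      gives \<open>\<theta> = 0\<close>, and then all matched points near the centre
      coincide.\<close>
    have 0: "0 \<in> F" "0 \<in> window K b" using a b R L_pos by (auto simp: F_def window_def K_def)
    then have "\<sigma> 0 = 0" using \<sigma>[OF 0(1)] uniq[of "\<sigma> 0" b 0] by simp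
    then have "\<theta> = 0" using rigid[OF 0(1)] R L_pos by (simp add: \<delta>_def)
    moreover have "d \<in> F" using d R L_pos by (auto simp: F_def window_def K_def)
    ultimately have "\<sigma> d = d" using rigid[of d] d by (simp add: \<delta>_def)
    then show "b + d \<in> T" using \<sigma>(1)[OF \<open>d \<in> F\<close>] by (simp add: window_def)
  qed
  show thesis using that[OF \<eta>(1)] main by blast
qed

text \<open>Only finitely many cell patterns occur, and the window of one representative per pattern
  already contains all differences of bounded size that start at a point with this pattern.\<close>

lemma T_differences_locally_finite: "finite ({a - b | a b. a \<in> T \<and> b \<in> T} \<inter> {-r..r})"
proof -
  define R where "R = max r (2 * L + 1)"
  obtain \<eta> K where \<eta>: "\<eta> > 0" and same: "\<And>a b d. a \<in> T \<Longrightarrow> b \<in> T \<Longrightarrow>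
      (\<lambda>d. \<lfloor>d / \<eta>\<rfloor>) ` window K a = (\<lambda>d. \<lfloor>d / \<eta>\<rfloor>) ` window K b \<Longrightarrow> \<bar>d\<bar> \<le> R \<Longrightarrow> a + d \<in> T \<Longrightarrow> b + d \<in> T"
    by (rule nearby_windows_coincide[of R]) (simp add: R_def, blast)
  define pat where "pat a = (\<lambda>d. \<lfloor>d / \<eta>\<rfloor>) ` window K a" for a
  have "pat a \<subseteq> {\<lfloor>- K / \<eta>\<rfloor>..\<lfloor>K / \<eta>\<rfloor>}" for a
  proof
    fix k assume "k \<in> pat a"
    then obtain d where "k = \<lfloor>d / \<eta>\<rfloor>" "- K \<le> d" "d \<le> K" by (auto simp: pat_def window_def)
    then show "k \<in> {\<lfloor>- K / \<eta>\<rfloor>..\<lfloor>K / \<eta>\<rfloor>}"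
      using \<eta> floor_mono[OF divide_right_mono[of "- K" d \<eta>]] floor_mono[OF divide_right_mono[of d K \<eta>]] by simp
  qed
  then have "finite (pat ` T)" using finite_subset[of "pat ` T" "Pow {\<lfloor>- K / \<eta>\<rfloor>..\<lfloor>K / \<eta>\<rfloor>}"] by blast
  define rep where "rep p = (SOME a. a \<in> T \<and> pat a = p)" for p
  have rep: "rep p \<in> T" "pat (rep p) = p" if "p \<in> pat ` T" for p
    using someI_ex[of "\<lambda>a. a \<in> T \<and> pat a = p"] that by (auto simp: rep_def)
  have "{a - b | a b. a \<in> T \<and> b \<in> T} \<inter> {-r..r} \<subseteq> (\<Union>p\<in>pat ` T. window R (rep p))"
  proof
    fix d assume "d \<in> {a - b | a b. a \<in> T \<and> b \<in> T} \<inter> {-r..r}"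
    then obtain b where b: "b \<in> T" "b + d \<in> T" and d: "\<bar>d\<bar> \<le> R" by (auto simp: R_def)
    have p: "pat b \<in> pat ` T" using b by simp
    have "rep (pat b) + d \<in> T" using same[OF b(1) rep(1)[OF p] _ d b(2)] rep(2)[OF p] by (simp add: pat_def)
    then have "d \<in> window R (rep (pat b))" using d by (auto simp: window_def)
    then show "d \<in> (\<Union>p\<in>pat ` T. window R (rep p))" using p by blast
  qed
  moreover have "finite (\<Union>p\<in>pat ` T. window R (rep p))"
    using \<open>finite (pat ` T)\<close> finite_window by blast
  ultimately show ?thesis by (rule finite_subset)
qed

text \<open>If \<open>b + m\<close> were missing, the past of \<open>b\<close> alone would exhaust
  \<open>nsq \<phi>\<close> in the tiling of the left-end test; at \<open>a\<close> the same past
  and the positive term of \<open>a + m\<close> would exceed it.\<close>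

lemma T_next_point:
  assumes past: "\<And>d. m - 2 * L \<le> d \<Longrightarrow> d < m \<Longrightarrow> a + d \<in> T \<longleftrightarrow> b + d \<in> T"
    and am: "a + m \<in> T"
  shows "b + m \<in> T"
proof (rule ccontr)
  assume bm: "b + m \<notin> T"
  obtain z where z: "z > 0" "\<And>t. t \<in> T \<inter> {b+m..b+m+1} \<Longrightarrow> t \<noteq> b + m \<Longrightarrow> z \<le> dist (b + m) t"
    using finite_set_avoid[OF finite_T_Icc, of "b + m" "b + m + 1" "b + m"] by blast
  \<comment> \<open>No point of \<open>T\<close> other than \<open>b + m\<close> lies less than
    \<open>\<zeta>\<close> to the right of it, so the test is blind to the whole future of
    \<open>b\<close>.\<close>
  define \<zeta> where "\<zeta> = min z 1"
  have "\<zeta> > 0" using z by (simp add: \<zeta>_def)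
  then obtain \<phi> where \<phi>: "\<phi> \<in> L2b" "supported \<phi>" "E \<phi> 0 > 0" "\<And>u. u \<ge> \<zeta> \<Longrightarrow> E \<phi> u = 0"
    using left_end_test by metis
  define D where "D = {d. b + d \<in> T} \<inter> {m - 2 * L..<m}"
  have tile: "((\<lambda>d. E \<phi> (d - m)) has_sum nsq \<phi>) {d. u + d \<in> T}" for u
  proof -
    have "inj_on (\<lambda>d. u + d) {d. u + d \<in> T}" by (auto simp: inj_on_def)
    moreover have "(\<lambda>d. u + d) ` {d. u + d \<in> T} = T" by (force simp: image_iff intro: exI[of _ "_ - u"])
    ultimately show ?thesis
      using E_tile[OF \<phi>(1), of "u + m"] has_sum_reindex[of "\<lambda>d. u + d" "{d. u + d \<in> T}" "\<lambda>t. E \<phi> (t - (u + m))"]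
      by (simp add: o_def)
  qed
  have "((\<lambda>d. E \<phi> (d - m)) has_sum nsq \<phi>) D"
  proof (subst has_sum_cong_neutral[where T = "{d. b + d \<in> T}" and g = "\<lambda>d. E \<phi> (d - m)"])
    fix d assume d: "d \<in> {d. b + d \<in> T} - D"
    show "E \<phi> (d - m) = 0"
    proof (cases "d < m")
      case True
      then have "\<bar>d - m\<bar> > 2 * L" using d by (auto simp: D_def)
      then show ?thesis by (rule E_supp[OF \<phi>(2)])
    next
      case False
      have "d \<noteq> m" using d bm by auto
      have "d - m \<ge> \<zeta>"
      proof (cases "d \<le> m + 1")
        case True
        then show ?thesis using z(2)[of "b + d"] d False \<open>d \<noteq> m\<close> by (auto simp: \<zeta>_def dist_real_def)
      qed (auto simp: \<zeta>_def)
      then show ?thesis by (rule \<phi>(4))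
    qed
  qed (auto simp: D_def tile)
  moreover have "m \<notin> D" by (simp add: D_def)
  ultimately have "((\<lambda>d. E \<phi> (d - m)) has_sum E \<phi> (m - m) + nsq \<phi>) (insert m D)"
    by (intro has_sum_insert)
  then have "E \<phi> (m - m) + nsq \<phi> \<le> nsq \<phi>"
    using tile[of a] by (rule has_sum_mono_neutral) (use past am E_nonneg in \<open>auto simp: D_def\<close>)
  then show False using \<phi>(3) by simp
qed

lemma periodic_T: "periodic_set T"
proof (rule periodic_set_if_deterministic)
  show "finite ({a - b |a b. a \<in> T \<and> b \<in> T} \<inter> {-r..r})" for r by (rule T_differences_locally_finite)
  show "T \<inter> {x<..x + (4 * L + 1)} \<noteq> {}" for x
  proof -
    obtain t where "t \<in> T" "\<bar>t - (x + 2 * L + 1)\<bar> \<le> 2 * L" using T_relatively_dense by blast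
    then show ?thesis by (intro ex_in_conv[THEN iffD1] exI[of _ t]) auto
  qed
  fix a b d assume a: "a \<in> T" and b: "b \<in> T"
    and ab: "\<And>d. d \<in> {- (2 * L)..0} \<Longrightarrow> (a + d \<in> T) = (b + d \<in> T)" and d: "d \<in> {0..4 * L + 1}"
  show "(a + d \<in> T) = (b + d \<in> T)"
  proof (rule ccontr)
    assume neg: "(a + d \<in> T) \<noteq> (b + d \<in> T)"
    define Z where "Z = {x \<in> {0..d}. (a + x \<in> T) \<noteq> (b + x \<in> T)}"
    have "Z \<subseteq> window d a \<union> window d b" by (auto simp: Z_def window_def)
    then have finZ: "finite Z" using finite_subset finite_window by blast
    have "d \<in> Z" using neg d by (simp add: Z_def)
    define m where "m = Min Z"
    have mZ: "m \<in> Z" unfolding m_def using finZ \<open>d \<in> Z\<close> by (intro Min_in) auto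
    have minm: "x \<notin> Z" if "x < m" for x using finZ that by (metis Min_le m_def not_le)
    have past: "(a + x \<in> T) = (b + x \<in> T)" if "m - 2 * L \<le> x" "x < m" for x
    proof (cases "x \<ge> 0")
      case True
      then show ?thesis using minm[OF that(2)] mZ that by (auto simp: Z_def)
    next
      case False
      then show ?thesis using ab[of x] mZ that by (auto simp: Z_def)
    qed
    show False using T_next_point[of m a b] T_next_point[of m b a] past mZ by (auto simp: Z_def)
  qed
qed

end

section \<open>Fourier integrals of compactly supported functions\<close>

text \<open>Cutting at the integers folds the integral onto \<open>{0..<1}\<close>, where the pieces
  add up to at most \<open>B\<close>; monotone convergence removes the truncation.\<close>

lemma integrable_if_periodization_bounded:
  fixes f :: "real \<Rightarrow> real"
  assumes f [measurable]: "f \<in> borel_measurable borel" and nonneg: "\<And>x. f x \<ge> 0"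
    and le: "\<And>\<theta> J. finite J \<Longrightarrow> (\<Sum>n\<in>J. f (of_int n + \<theta>)) \<le> B"
  shows "integrable lborel f"
proof -
  define fN where "fN N x = ennreal (f x) * indicator {- real N..<real N} x" for N :: nat and x
  have meas [measurable]: "fN N \<in> borel_measurable lborel" for N
    unfolding fN_def[abs_def] by measurable
  have bound: "(\<integral>\<^sup>+x. fN N x \<partial>lborel) \<le> ennreal B" for N
  proof -
    let ?J = "{- int N..<int N}"
    have ind: "indicator {- real N..<real N} x = (\<Sum>n\<in>?J. indicator {of_int n..<of_int n + 1} x :: ennreal)" for x :: real
    proof -
      have "indicator {of_int n..<of_int n + 1} x = (if n = \<lfloor>x\<rfloor> then 1 else 0 :: ennreal)" for n
        by (auto simp: indicator_def) linarith+
      then have "(\<Sum>n\<in>?J. indicator {of_int n..<of_int n + 1} x :: ennreal) = (if \<lfloor>x\<rfloor> \<in> ?J then 1 else 0)"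
        by (simp add: sum.delta)
      also have "\<dots> = indicator {- real N..<real N} x"
        by (auto simp: indicator_def le_floor_iff floor_less_iff)
      finally show ?thesis by simp
    qed
    have "(\<integral>\<^sup>+x. fN N x \<partial>lborel) = (\<integral>\<^sup>+x. (\<Sum>n\<in>?J. ennreal (f x) * indicator {of_int n..<of_int n + 1} x) \<partial>lborel)"
      unfolding fN_def ind sum_distrib_left ..
    also have "\<dots> = (\<Sum>n\<in>?J. \<integral>\<^sup>+x. ennreal (f x) * indicator {of_int n..<of_int n + 1} x \<partial>lborel)"
      by (rule nn_integral_sum) measurable
    also have "\<dots> = (\<Sum>n\<in>?J. \<integral>\<^sup>+x. ennreal (f (of_int n + x)) * indicator {0..<1} x \<partial>lborel)"
    proof (rule sum.cong[OF refl])
      fix n :: int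
      have "(\<integral>\<^sup>+x. ennreal (f x) * indicator {of_int n..<of_int n + 1} x \<partial>lborel)
          = ennreal \<bar>1\<bar> * (\<integral>\<^sup>+x. ennreal (f (of_int n + 1 * x)) * indicator {of_int n..<of_int n + 1} (of_int n + 1 * x) \<partial>lborel)"
        by (rule nn_integral_real_affine) auto
      also have "\<dots> = (\<integral>\<^sup>+x. ennreal (f (of_int n + x)) * indicator {0..<1} x \<partial>lborel)"
        by (simp add: indicator_def)
      finally show "(\<integral>\<^sup>+x. ennreal (f x) * indicator {of_int n..<of_int n + 1} x \<partial>lborel)
          = (\<integral>\<^sup>+x. ennreal (f (of_int n + x)) * indicator {0..<1} x \<partial>lborel)" .
    qed
    also have "\<dots> = (\<integral>\<^sup>+x. (\<Sum>n\<in>?J. ennreal (f (of_int n + x)) * indicator {0..<1} x) \<partial>lborel)"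
      by (rule nn_integral_sum[symmetric]) measurable
    also have "\<dots> \<le> (\<integral>\<^sup>+x. ennreal B * indicator {0..<1} x \<partial>(lborel :: real measure))"
    proof (rule nn_integral_mono)
      fix x :: real
      have "(\<Sum>n\<in>?J. ennreal (f (of_int n + x)) * indicator {0..<1} x) = ennreal (\<Sum>n\<in>?J. f (of_int n + x)) * indicator {0..<1} x"
        using nonneg by (simp add: sum_distrib_right[symmetric])
      also have "\<dots> \<le> ennreal B * indicator {0..<1} x"
        using le by (intro mult_right_mono ennreal_leI) auto
      finally show "(\<Sum>n\<in>?J. ennreal (f (of_int n + x)) * indicator {0..<1} x) \<le> ennreal B * indicator {0..<1} x" .
    qed
    also have "\<dots> = ennreal B" by (subst nn_integral_cmult_indicator) auto
    finally show ?thesis .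
  qed
  have inc: "incseq fN"
    by (auto simp: incseq_def le_fun_def fN_def indicator_def)
  have sup: "ennreal (f x) = (SUP N. fN N x)" for x
  proof (rule antisym)
    obtain N :: nat where N: "\<bar>x\<bar> < real N" using reals_Archimedean2 by blast
    then have "fN N x = ennreal (f x)" by (auto simp: fN_def indicator_def abs_less_iff)
    then show "ennreal (f x) \<le> (SUP N. fN N x)" by (metis SUP_upper UNIV_I)
    show "(SUP N. fN N x) \<le> ennreal (f x)" by (intro SUP_least) (auto simp: fN_def indicator_def)
  qed
  have "(\<integral>\<^sup>+x. ennreal (f x) \<partial>lborel) = (SUP N. \<integral>\<^sup>+x. fN N x \<partial>lborel)"
    unfolding sup by (rule nn_integral_monotone_convergence_SUP[OF inc meas])
  also have "\<dots> \<le> ennreal B" using bound by (intro SUP_least)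
  finally have "(\<integral>\<^sup>+x. ennreal (f x) \<partial>lborel) < \<infinity>" using ennreal_less_top le_less_trans by (metis infinity_ennreal_def)
  then show ?thesis using nonneg by (intro integrableI_nonneg) auto
qed

lemma orthonormal_exponentials:
  fixes n m :: int
  shows "ip (\<lambda>x. indicator {0..1} x * cis (2 * pi * of_int n * x)) (\<lambda>x. indicator {0..1} x * cis (2 * pi * of_int m * x))
    = (if n = m then 1 else 0)"
proof -
  define k where "k = 2 * pi * real_of_int (n - m)"
  have eq: "indicator {0..1} x * cis (2 * pi * of_int n * x) * cnj (indicator {0..1} x * cis (2 * pi * of_int m * x))
      = indicator {0..1} x *\<^sub>R cis (k * x)" for x :: real
    by (auto simp: indicator_def cis_cnj cis_mult k_def algebra_simps)
  have "(LINT x|lborel. indicator {0..1} x *\<^sub>R cis (k * x)) = (if n = m then 1 else 0)"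
  proof (cases "n = m")
    case True
    have "(LINT x|lborel. indicator {0..1} x *\<^sub>R cis (k * x)) = (LINT x|lborel. indicator {0..1::real} x *\<^sub>R (1 :: complex))"
      using True by (simp add: k_def)
    also have "\<dots> = 1" by simp
    finally show ?thesis using True by simp
  next
    case False
    then have k: "k \<noteq> 0" by (simp add: k_def)
    have "(LINT x|lborel. indicator {0..1} x *\<^sub>R cis (k * x)) = cis (k * 1) / (\<i> * k) - cis (k * 0) / (\<i> * k)"
    proof (rule integral_FTC_Icc)
      show "((\<lambda>x. cis (k * x) / (\<i> * k)) has_vector_derivative cis (k * x)) (at x within {0..1})" for x
      proof -
        have "((\<lambda>x. exp (\<i> * of_real k * of_real x) / (\<i> * of_real k)) has_vector_derivative
            (\<i> * of_real k * exp (\<i> * of_real k * of_real x)) / (\<i> * of_real k)) (at x within {0..1})"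
          by (rule has_vector_derivative_real_field) (auto intro!: derivative_eq_intros simp: k)
        then show ?thesis using k by (simp add: cis_conv_exp mult.assoc)
      qed
      show "continuous_on {0..1} (\<lambda>x. cis (k * x))" by (intro continuous_intros)
    qed simp
    also have "cis (k * 1) = 1"
      using cis_multiple_2pi[of "of_int (n - m)"] by (simp add: k_def)
    finally show ?thesis using False by simp
  qed
  then show ?thesis unfolding ip_def eq .
qed

text \<open>In place of Plancherel: for fixed \<open>\<theta>\<close> the values at
  \<open>of_int n + \<theta>\<close> are Fourier coefficients of a modulated \<open>k\<close> on the
  unit interval, so Bessel bounds the periodization by \<open>nsq k\<close>.\<close>

lemma fourier_energy_integrable:
  assumes k: "k \<in> L2b" and supp: "\<And>x. x \<notin> {0..1} \<Longrightarrow> k x = 0"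
    and meas: "(\<lambda>\<xi>. LINT x|lborel. k x * cis (- (2 * pi * \<xi> * x))) \<in> borel_measurable borel"
  shows "integrable lborel (\<lambda>\<xi>. (norm (LINT x|lborel. k x * cis (- (2 * pi * \<xi> * x))))\<^sup>2)"
proof (rule integrable_if_periodization_bounded[where B = "nsq k"])
  show "(\<lambda>\<xi>. (norm (LINT x|lborel. k x * cis (- (2 * pi * \<xi> * x))))\<^sup>2) \<in> borel_measurable borel"
    using meas by measurable
  fix \<theta> :: real and J :: "int set" assume J: "finite J"
  define e where "e n = (\<lambda>x. indicator {0..1} x * cis (2 * pi * of_int n * x))" for n :: int
  have cm: "(\<lambda>x. cis (c * x)) \<in> borel_measurable borel" for c
    by (intro borel_measurable_continuous_onI continuous_intros)
  define h where "h = (\<lambda>x. cis (- (2 * pi * \<theta>) * x) * k x)"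
  have h: "h \<in> L2b" unfolding h_def by (rule L2b_bounded_mult[OF k cm, where B = 1]) simp
  have e: "e n \<in> L2b" for n
  proof (rule L2bI)
    show "e n \<in> borel_measurable borel" unfolding e_def using cm[of "2 * pi * of_int n"] by measurable
    have "(\<lambda>x. (norm (e n x))\<^sup>2) = indicat_real {0..1}" by (auto simp: e_def indicator_def)
    then show "integrable lborel (\<lambda>x. (norm (e n x))\<^sup>2)" by simp
  qed
  have "(\<Sum>n\<in>J. (norm (ip h (e n)))\<^sup>2) \<le> nsq h"
    by (rule bessel_finite[OF h e _ J, where I = UNIV]) (auto simp: e_def orthonormal_exponentials)
  also have "nsq h = nsq k" by (simp add: nsq_def h_def norm_mult)
  moreover have "ip h (e n) = (LINT x|lborel. k x * cis (- (2 * pi * (of_int n + \<theta>) * x)))" for n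
    unfolding ip_def
  proof (intro Bochner_Integration.integral_cong refl)
    fix x
    have "cis (- (2 * pi * \<theta>) * x) * cis (- (2 * pi * of_int n * x)) = cis (- (2 * pi * (of_int n + \<theta>) * x))"
      by (simp add: cis_mult algebra_simps)
    then show "h x * cnj (e n x) = k x * cis (- (2 * pi * (of_int n + \<theta>) * x))"
      using supp[of x] by (cases "x \<in> {0..1}") (auto simp: h_def e_def cis_cnj mult_ac)
  qed
  ultimately show "(\<Sum>n\<in>J. (norm (LINT x|lborel. k x * cis (- (2 * pi * (of_int n + \<theta>) * x))))\<^sup>2) \<le> nsq k" by simp
qed simp

text \<open>Termwise integration of the exponential series; compact support provides the summable
  majorant \<open>(norm z * \<bar>M\<bar>) ^ n / fact n\<close>.\<close>

lemma fourier_holomorphic: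
  fixes w :: "real \<Rightarrow> complex"
  assumes w: "integrable lborel w" and supp: "\<And>x. \<bar>x\<bar> > M \<Longrightarrow> w x = 0"
  shows "(\<lambda>z. LINT x|lborel. w x * exp (\<i> * z * of_real x)) holomorphic_on A"
proof -
  have [measurable]: "w \<in> borel_measurable lborel" using w by (rule borel_measurable_integrable)
  define c where "c n = (LINT x|lborel. w x * (\<i> * of_real x) ^ n / fact n)" for n :: nat
  have le: "norm (w x * (\<i> * z * of_real x) ^ n / fact n) \<le> norm (w x) * ((norm z * \<bar>M\<bar>) ^ n / fact n)" for x z n
  proof (cases "\<bar>x\<bar> > M")
    case False
    then have "norm z * \<bar>x\<bar> \<le> norm z * \<bar>M\<bar>" by (intro mult_left_mono) auto
    then have "(norm z * \<bar>x\<bar>) ^ n \<le> (norm z * \<bar>M\<bar>) ^ n" by (intro power_mono) auto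
    then show ?thesis
      by (simp add: norm_mult norm_divide norm_power mult_left_mono divide_right_mono flip: times_divide_eq_right)
  qed (simp add: supp)
  have int: "integrable lborel (\<lambda>x. w x * (\<i> * z * of_real x) ^ n / fact n)" for z n
    by (rule Bochner_Integration.integrable_bound[of _ "\<lambda>x. norm (w x) * ((norm z * \<bar>M\<bar>) ^ n / fact n)"])
       (use w le in \<open>auto intro!: AE_I2 integrable_mult_left integrable_norm\<close>)
  have sums: "(\<lambda>n. c n * (z - 0) ^ n) sums (LINT x|lborel. w x * exp (\<i> * z * of_real x))" for z
  proof -
    have S: "(\<lambda>n. LINT x|lborel. w x * (\<i> * z * of_real x) ^ n / fact n) sums
        (LINT x|lborel. (\<Sum>n. w x * (\<i> * z * of_real x) ^ n / fact n))"
    proof (rule sums_integral[OF int])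
      have "summable (\<lambda>n. norm (w x) * ((norm z * \<bar>M\<bar>) ^ n / fact n))" for x
        using summable_exp[of "norm z * \<bar>M\<bar>"] by (intro summable_mult) (simp add: divide_inverse mult.commute)
      then have "summable (\<lambda>n. norm (w x * (\<i> * z * of_real x) ^ n / fact n))" for x
        by (rule summable_comparison_test') (use le[of x z] in auto)
      then show "AE x in lborel. summable (\<lambda>n. norm (w x * (\<i> * z * of_real x) ^ n / fact n))" by simp
      have "summable (\<lambda>n. (LINT x|lborel. norm (w x)) * ((norm z * \<bar>M\<bar>) ^ n / fact n))"
        using summable_exp[of "norm z * \<bar>M\<bar>"] by (intro summable_mult) (simp add: divide_inverse mult.commute)
      then show "summable (\<lambda>n. LINT x|lborel. norm (w x * (\<i> * z * of_real x) ^ n / fact n))"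
      proof (rule summable_comparison_test')
        fix n
        have "(LINT x|lborel. norm (w x * (\<i> * z * of_real x) ^ n / fact n)) \<le> (LINT x|lborel. norm (w x) * ((norm z * \<bar>M\<bar>) ^ n / fact n))"
          using int w le by (intro integral_mono integrable_norm integrable_mult_left)
        then show "norm (LINT x|lborel. norm (w x * (\<i> * z * of_real x) ^ n / fact n))
            \<le> (LINT x|lborel. norm (w x)) * ((norm z * \<bar>M\<bar>) ^ n / fact n)"
          by (simp add: integral_nonneg)
      qed
    qed
    have "(\<Sum>n. w x * (\<i> * z * of_real x) ^ n / fact n) = w x * exp (\<i> * z * of_real x)" for x
    proof -
      have "(\<lambda>n. w x * ((\<i> * z * of_real x) ^ n /\<^sub>R fact n)) sums (w x * exp (\<i> * z * of_real x))"
        by (intro sums_mult exp_converges)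
      then show ?thesis
        by (intro sums_unique[symmetric]) (simp add: scaleR_conv_of_real divide_inverse mult_ac)
    qed
    moreover have "(LINT x|lborel. w x * (\<i> * z * of_real x) ^ n / fact n) = c n * (z - 0) ^ n" for n
    proof -
      have "(LINT x|lborel. w x * (\<i> * z * of_real x) ^ n / fact n) = (LINT x|lborel. (w x * (\<i> * of_real x) ^ n / fact n) * z ^ n)"
        by (intro Bochner_Integration.integral_cong) (auto simp: power_mult_distrib mult_ac)
      then show ?thesis by (simp add: c_def)
    qed
    ultimately show ?thesis using S by simp
  qed
  have "(\<lambda>z. LINT x|lborel. w x * exp (\<i> * z * of_real x)) holomorphic_on UNIV"
    unfolding holomorphic_on_def
  proof
    fix z :: complex
    have "(\<lambda>z. LINT x|lborel. w x * exp (\<i> * z * of_real x)) holomorphic_on ball 0 (norm z + 1)"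
      by (rule power_series_holomorphic[OF sums])
    then have "(\<lambda>z. LINT x|lborel. w x * exp (\<i> * z * of_real x)) field_differentiable at z"
      by (rule holomorphic_on_imp_differentiable_at) auto
    then show "(\<lambda>z. LINT x|lborel. w x * exp (\<i> * z * of_real x)) field_differentiable at z within UNIV" by simp
  qed
  then show ?thesis by (rule holomorphic_on_subset) simp
qed

lemma fourier_continuous:
  fixes w :: "real \<Rightarrow> complex"
  assumes w: "integrable lborel w" and supp: "\<And>x. \<bar>x\<bar> > M \<Longrightarrow> w x = 0"
  shows "continuous_on A (\<lambda>\<xi>. LINT x|lborel. w x * cis (c * \<xi> * x))"
proof -
  have "continuous_on UNIV (\<lambda>z. LINT x|lborel. w x * exp (\<i> * z * of_real x))"
    using fourier_holomorphic[OF w supp, of M] by (simp add: holomorphic_on_imp_continuous_on)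
  then have "continuous_on A (\<lambda>\<xi>. (\<lambda>z. LINT x|lborel. w x * exp (\<i> * z * of_real x)) (complex_of_real (c * \<xi>)))"
    by (rule continuous_on_compose2) (auto intro!: continuous_intros)
  then show ?thesis by (simp add: cis_conv_exp mult_ac)
qed

section \<open>The tiling by the frequency shifts\<close>

lemma integral_tail_tendsto_0:
  fixes w :: "real \<Rightarrow> real"
  assumes w: "integrable lborel w"
  shows "(\<lambda>m. LINT u|lborel. w u * indicator {u. \<bar>u\<bar> \<ge> real m} u) \<longlonglongrightarrow> 0"
proof -
  have [measurable]: "w \<in> borel_measurable borel" using borel_measurable_integrable[OF w] by simp
  have "(\<lambda>m. LINT u|lborel. w u * indicator {u. \<bar>u\<bar> \<ge> real m} u) \<longlonglongrightarrow> (LINT u|(lborel :: real measure). 0)"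
  proof (rule integral_dominated_convergence[where w = "\<lambda>u. norm (w u)"])
    show "AE u in lborel. (\<lambda>m. w u * indicator {u. \<bar>u\<bar> \<ge> real m} u) \<longlonglongrightarrow> 0"
    proof (rule AE_I2)
      fix u
      obtain m0 :: nat where "\<bar>u\<bar> < real m0" using reals_Archimedean2 by blast
      then have "\<forall>\<^sub>F m in sequentially. w u * indicator {u. \<bar>u\<bar> \<ge> real m} u = 0"
        by (intro eventually_mono[OF eventually_ge_at_top[of m0]]) auto
      then show "(\<lambda>m. w u * indicator {u. \<bar>u\<bar> \<ge> real m} u) \<longlonglongrightarrow> 0" by (rule tendsto_eventually)
    qed
    show "AE u in lborel. norm (w u * indicator {u. \<bar>u\<bar> \<ge> real m} u) \<le> norm (w u)" for m
      by (auto intro!: AE_I2 simp: indicator_def)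
  qed (use w in \<open>auto intro: integrable_norm\<close>)
  then show ?thesis by simp
qed

lemma has_sum_imp_sums_from_nat_into:
  fixes f :: "'a \<Rightarrow> 'b::{topological_comm_monoid_add}"
  assumes "countable S" "infinite S" "(f has_sum v) S"
  shows "(\<lambda>N. \<Sum>n<N. f (from_nat_into S n)) \<longlonglongrightarrow> v"
proof -
  have "bij_betw (from_nat_into S) UNIV S" by (rule bij_betw_from_nat_into) (use assms in auto)
  from has_sum_imp_sums[OF has_sum_reindex_bij_betw[OF this, THEN iffD2, OF assms(3)]]
  show ?thesis by (simp add: sums_def)
qed

lemma borel_measurable_has_sum:
  fixes f :: "'a \<Rightarrow> real \<Rightarrow> 'b::{banach, second_countable_topology}"
  assumes S: "countable S" and meas: "\<And>s. s \<in> S \<Longrightarrow> f s \<in> borel_measurable borel"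
    and F: "\<And>x. ((\<lambda>s. f s x) has_sum F x) S"
  shows "F \<in> borel_measurable borel"
proof (cases "finite S")
  case True
  then have "F = (\<lambda>x. \<Sum>s\<in>S. f s x)" using F by (auto simp: has_sum_finite_iff)
  then show ?thesis using meas by simp
next
  case False
  show ?thesis
  proof (rule borel_measurable_LIMSEQ_metric)
    show "(\<lambda>x. \<Sum>n<N. f (from_nat_into S n) x) \<in> borel_measurable borel" for N
      using meas False by (intro borel_measurable_sum) (metis from_nat_into finite.emptyI)
    show "(\<lambda>N. \<Sum>n<N. f (from_nat_into S n) x) \<longlonglongrightarrow> F x" for x
      by (rule has_sum_imp_sums_from_nat_into[OF S False F])
  qed
qed

text \<open>Dominated convergence along an enumeration of \<open>S\<close> identifies the value;
  unconditional summability is proved separately, since an enumeration gives only a limit of partial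
  sums.\<close>

lemma has_sum_integral:
  fixes f :: "'a \<Rightarrow> real \<Rightarrow> 'b::{banach, second_countable_topology}"
  assumes S: "countable S" and meas: "\<And>s. s \<in> S \<Longrightarrow> f s \<in> borel_measurable borel"
    and w: "integrable lborel w" and le: "\<And>x J. finite J \<Longrightarrow> J \<subseteq> S \<Longrightarrow> (\<Sum>s\<in>J. norm (f s x)) \<le> w x"
    and F: "\<And>x. ((\<lambda>s. f s x) has_sum F x) S"
  shows "((\<lambda>s. LINT x|lborel. f s x) has_sum (LINT x|lborel. F x)) S"
proof -
  have int: "integrable lborel (f s)" if "s \<in> S" for s
  proof (rule Bochner_Integration.integrable_bound[OF w])
    show "f s \<in> borel_measurable lborel" using meas[OF that] by simp
    show "AE x in lborel. norm (f s x) \<le> norm (w x)"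
    proof (rule AE_I2)
      fix x show "norm (f s x) \<le> norm (w x)" using le[of "{s}" x] that by simp
    qed
  qed
  have abs: "(\<lambda>s. norm (LINT x|lborel. f s x)) summable_on S"
  proof (rule nonneg_bdd_above_summable_on)
    show "0 \<le> norm (LINT x|lborel. f s x)" for s by (rule norm_ge_zero)
    show "bdd_above (sum (\<lambda>s. norm (LINT x|lborel. f s x)) ` {J. J \<subseteq> S \<and> finite J})"
    proof (rule bdd_aboveI2)
      fix J assume J: "J \<in> {J. J \<subseteq> S \<and> finite J}"
      have "(\<Sum>s\<in>J. norm (LINT x|lborel. f s x)) \<le> (\<Sum>s\<in>J. LINT x|lborel. norm (f s x))"
        by (intro sum_mono integral_norm_bound)
      also have "\<dots> = (LINT x|lborel. (\<Sum>s\<in>J. norm (f s x)))"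
        using J int by (intro Bochner_Integration.integral_sum[symmetric] integrable_norm) auto
      also have "\<dots> \<le> (LINT x|lborel. w x)"
        using J int w le by (intro integral_mono Bochner_Integration.integrable_sum integrable_norm) auto
      finally show "(\<Sum>s\<in>J. norm (LINT x|lborel. f s x)) \<le> (LINT x|lborel. w x)" .
    qed
  qed
  then have summ: "((\<lambda>s. LINT x|lborel. f s x) has_sum (\<Sum>\<^sub>\<infinity>s\<in>S. LINT x|lborel. f s x)) S"
    by (rule has_sum_infsum[OF abs_summable_summable])
  have "(\<Sum>\<^sub>\<infinity>s\<in>S. LINT x|lborel. f s x) = (LINT x|lborel. F x)"
  proof (cases "finite S")
    case True
    then have "F x = (\<Sum>s\<in>S. f s x)" for x using F[of x] by (simp add: has_sum_finite_iff)
    then show ?thesis using True int by simp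
  next
    case False
    define \<sigma> where "\<sigma> = from_nat_into S"
    have bij: "bij_betw \<sigma> UNIV S" unfolding \<sigma>_def using S False by (rule bij_betw_from_nat_into)
    have \<sigma>S: "\<sigma> n \<in> S" for n using bij by (auto simp: bij_betw_def)
    have inj: "inj \<sigma>" using bij by (auto simp: bij_betw_def)
    have 1: "(\<lambda>N. \<Sum>n<N. LINT x|lborel. f (\<sigma> n) x) \<longlonglongrightarrow> (\<Sum>\<^sub>\<infinity>s\<in>S. LINT x|lborel. f s x)"
      unfolding \<sigma>_def by (rule has_sum_imp_sums_from_nat_into[OF S False summ])
    have "(\<lambda>N. LINT x|lborel. (\<Sum>n<N. f (\<sigma> n) x)) \<longlonglongrightarrow> (LINT x|lborel. F x)"
    proof (rule integral_dominated_convergence[where w = w and s = "\<lambda>N x. \<Sum>n<N. f (\<sigma> n) x"])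
      have lim: "(\<lambda>N. \<Sum>n<N. f (\<sigma> n) x) \<longlonglongrightarrow> F x" for x
        unfolding \<sigma>_def by (rule has_sum_imp_sums_from_nat_into[OF S False F])
      then show "AE x in lborel. (\<lambda>N. \<Sum>n<N. f (\<sigma> n) x) \<longlonglongrightarrow> F x" by simp
      show "(\<lambda>x. \<Sum>n<N. f (\<sigma> n) x) \<in> borel_measurable lborel" for N
        using meas[OF \<sigma>S] by measurable
      show "F \<in> borel_measurable lborel" using borel_measurable_has_sum[OF S meas F] by simp
      show "AE x in lborel. norm (\<Sum>n<N. f (\<sigma> n) x) \<le> w x" for N
      proof (rule AE_I2)
        fix x
        have "norm (\<Sum>n<N. f (\<sigma> n) x) \<le> (\<Sum>n<N. norm (f (\<sigma> n) x))" by (rule norm_sum)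
        also have "\<dots> = (\<Sum>s\<in>\<sigma> ` {..<N}. norm (f s x))"
          using inj by (subst sum.reindex) (auto simp: inj_on_def)
        also have "\<dots> \<le> w x" using \<sigma>S by (intro le) auto
        finally show "norm (\<Sum>n<N. f (\<sigma> n) x) \<le> w x" .
      qed
    qed (rule w)
    also have "(\<lambda>N. LINT x|lborel. (\<Sum>n<N. f (\<sigma> n) x)) = (\<lambda>N. \<Sum>n<N. LINT x|lborel. f (\<sigma> n) x)"
      using int \<sigma>S by (intro ext Bochner_Integration.integral_sum) auto
    finally show ?thesis using 1 LIMSEQ_unique by blast
  qed
  then show ?thesis using summ by simp
qed

lemma separated_if_differences_locally_finite:
  fixes A :: "real set"
  assumes fin: "\<And>r. finite ({a - b | a b. a \<in> A \<and> b \<in> A} \<inter> {-r..r})"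
  obtains \<rho> where "\<rho> > 0" "\<And>x y. x \<in> A \<Longrightarrow> y \<in> A \<Longrightarrow> x \<noteq> y \<Longrightarrow> \<bar>x - y\<bar> \<ge> \<rho>"
proof -
  obtain d where d: "d > 0" "\<And>x. x \<in> {a - b | a b. a \<in> A \<and> b \<in> A} \<inter> {-1..1} \<Longrightarrow> x \<noteq> 0 \<Longrightarrow> d \<le> dist 0 x"
    using finite_set_avoid[OF fin[of 1], of 0] by blast
  have "\<bar>x - y\<bar> \<ge> min d 1" if "x \<in> A" "y \<in> A" "x \<noteq> y" for x y
  proof (cases "\<bar>x - y\<bar> \<le> 1")
    case True
    then have "x - y \<in> {a - b | a b. a \<in> A \<and> b \<in> A} \<inter> {-1..1}" using that by auto
    then show ?thesis using d(2)[of "x - y"] that by auto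
  qed auto
  then show thesis using d(1) by (intro that[of "min d 1"]) auto
qed

section \<open>Differences of \<open>S\<close> and a weight that tiles with \<open>S\<close>\<close>

context gabor_parseval
begin

lemma S_differences_locally_finite: "finite ({a - b | a b. a \<in> S \<and> b \<in> S} \<inter> {-r..r})"
proof -
  define w where "w x = complex_of_real ((norm (g x))\<^sup>2)" for x
  define F where "F z = (LINT x|lborel. w x * exp (\<i> * z * of_real x))" for z
  have w: "integrable lborel w" unfolding w_def using L2b_integrable[OF g_L2] by (rule integrable_of_real)
  have hol: "F holomorphic_on UNIV"
    unfolding F_def by (rule fourier_holomorphic[OF w, of L]) (simp add: w_def g_supp)
  have "F 0 = of_real (nsq g)" unfolding F_def w_def nsq_def integral_complex_of_real[symmetric] by simp
  also have "nsq g = 1" using nsq_g0 by (simp add: nsq_def norm_g0)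
  finally have F0: "F 0 = 1" by simp
  obtain t where t: "t \<in> T" using nonempty by auto
  have zero: "F (of_real (2 * pi * (a - b))) = 0" if ab: "a \<in> S" "b \<in> S" "a \<noteq> b" for a b
  proof -
    define k where "k = 2 * pi * (a - b)"
    have "0 = (LINT x|lborel. gabor g (t, a) x * cnj (gabor g (t, b) x))"
      using orthonormal[of "(t, a)" "(t, b)"] t ab by (simp add: ip_def)
    also have "\<dots> = (LINT x|lborel. w (x - t) * cis (k * x))"
    proof (intro Bochner_Integration.integral_cong refl)
      fix x
      have "cis (2 * pi * a * x) * cis (- (2 * pi * b * x)) = cis (k * x)"
        by (simp add: cis_mult k_def algebra_simps)
      moreover have "g (x - t) * cnj (g (x - t)) = w (x - t)"
        unfolding w_def complex_norm_square ..
      ultimately show "gabor g (t, a) x * cnj (gabor g (t, b) x) = w (x - t) * cis (k * x)"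
        by (simp add: gabor_simp cis_cnj mult_ac)
    qed
    also have "\<dots> = (LINT x|lborel. w (x + t - t) * cis (k * (x + t)))"
      by (rule lborel_integral_translate[symmetric])
    also have "\<dots> = (LINT x|lborel. cis (k * t) * (w x * exp (\<i> * of_real k * of_real x)))"
    proof (intro Bochner_Integration.integral_cong refl)
      fix x
      have "cis (k * (x + t)) = cis (k * t) * exp (\<i> * of_real k * of_real x)"
        by (simp add: cis_conv_exp algebra_simps flip: exp_add)
      then show "w (x + t - t) * cis (k * (x + t)) = cis (k * t) * (w x * exp (\<i> * of_real k * of_real x))"
        by simp
    qed
    also have "\<dots> = cis (k * t) * F (of_real k)" by (simp add: F_def)
    finally show ?thesis by (simp add: k_def)
  qed
  \<comment> \<open>\<open>F\<close> is not constant because of \<open>F 0 = 1\<close> and the zero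
    supplied by a pair of distinct points; without such a pair the only difference is 0.\<close>
  have fin: "finite {z \<in> cball 0 (2 * pi * \<bar>r\<bar>). F z = 0}" if "a \<in> S" "b \<in> S" "a \<noteq> b" for a b
  proof (rule holomorphic_compact_finite_zeros[OF hol])
    show "\<not> F constant_on UNIV"
      using zero[OF that] F0 unfolding constant_on_def by (metis UNIV_I zero_neq_one)
  qed auto
  show ?thesis
  proof (cases "\<exists>a b. a \<in> S \<and> b \<in> S \<and> a \<noteq> b")
    case True
    then have fin: "finite {z \<in> cball 0 (2 * pi * \<bar>r\<bar>). F z = 0}" using fin by blast
    have "(\<lambda>d. complex_of_real (2 * pi * d)) ` ({a - b | a b. a \<in> S \<and> b \<in> S} \<inter> {-r..r} - {0})
        \<subseteq> {z \<in> cball 0 (2 * pi * \<bar>r\<bar>). F z = 0}"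
    proof
      fix z assume "z \<in> (\<lambda>d. complex_of_real (2 * pi * d)) ` ({a - b | a b. a \<in> S \<and> b \<in> S} \<inter> {-r..r} - {0})"
      then obtain a b where ab: "a \<in> S" "b \<in> S" "a \<noteq> b" "\<bar>a - b\<bar> \<le> \<bar>r\<bar>" and z: "z = of_real (2 * pi * (a - b))" by force
      have "norm z \<le> 2 * pi * \<bar>r\<bar>"
        unfolding z norm_of_real abs_mult using ab(4) by (intro mult_mono) auto
      then show "z \<in> {z \<in> cball 0 (2 * pi * \<bar>r\<bar>). F z = 0}" using zero[OF ab(1-3)] z by simp
    qed
    then have "finite ((\<lambda>d. complex_of_real (2 * pi * d)) ` ({a - b | a b. a \<in> S \<and> b \<in> S} \<inter> {-r..r} - {0}))"
      using fin by (rule finite_subset)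
    then have "finite ({a - b | a b. a \<in> S \<and> b \<in> S} \<inter> {-r..r} - {0})"
      by (rule finite_imageD) (auto simp: inj_on_def)
    then show ?thesis by simp
  next
    case False
    then have "{a - b | a b. a \<in> S \<and> b \<in> S} \<inter> {-r..r} \<subseteq> {0}" by auto
    then show ?thesis using finite_subset by blast
  qed
qed

text \<open>\<open>W\<close> is the energy of the indicator of \<open>{0..1}\<close> as a function
  of frequency, collected over the time shifts. Modulation by \<open>y\<close> preserves the norm
  and displaces the frequency, so Parseval for the modulated function is the tiling. The unit
  interval is what \<open>fourier_energy_integrable\<close> asks for.\<close>

lemma spectral_tiling:
  obtains W :: "real \<Rightarrow> real" where "integrable lborel W" "continuous_on UNIV W" "\<And>x. W x \<ge> 0" "\<And>y. ((\<lambda>s. W (s - y)) has_sum 1) S"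
proof -
  define \<phi> where "\<phi> x = complex_of_real (indicat_real {0..1} x)" for x :: real
  \<comment> \<open>Shifts of \<open>g\<close> by more than \<open>L + 1\<close> miss
    \<open>{0..1}\<close>, so finitely many \<open>t\<close> remain and \<open>W\<close> is a finite
    sum of continuous functions.\<close>
  define T' where "T' = T \<inter> {-(L+1)..L+1}"
  have finT: "finite T'" unfolding T'_def by (rule finite_T_Icc)
  have [measurable]: "\<phi> \<in> borel_measurable borel" unfolding \<phi>_def[abs_def] by measurable
  have eq: "(norm (\<phi> x))\<^sup>2 = indicat_real {0..1} x" for x by (auto simp: \<phi>_def indicator_def)
  have \<phi>: "\<phi> \<in> L2b" by (rule L2bI) (auto simp: eq)
  have nsq\<phi>: "nsq \<phi> = 1" unfolding nsq_def eq by simp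
  have cm: "(\<lambda>x. cis (c * x)) \<in> borel_measurable borel" for c
    by (intro borel_measurable_continuous_onI continuous_intros)
  define k where "k t x = \<phi> x * cnj (g (x - t))" for t x
  have k_int: "integrable lborel (k t)" for t
    using ip_integrable[OF \<phi> L2b_shift[OF g_L2, of t]] by (simp add: k_def[abs_def])
  have k_supp: "k t x = 0" if "x \<notin> {0..1}" for t x using that by (simp add: k_def \<phi>_def)
  have k_L2: "k t \<in> L2b" for t
  proof -
    have "(\<lambda>x. cnj (g (x - t))) \<in> L2b"
      using L2b_shift[OF g_L2, of t] by (auto simp: L2b_def)
    moreover have "norm (\<phi> x) \<le> 1" for x by (simp add: \<phi>_def indicator_def)
    ultimately show ?thesis unfolding k_def[abs_def] by (intro L2b_bounded_mult[where B = 1]) auto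
  qed
  have coef_k: "coef \<phi> t \<xi> = (LINT x|lborel. k t x * cis (- (2 * pi * \<xi> * x)))" for t \<xi>
    by (simp add: coef_eq k_def)
  have cont: "continuous_on UNIV (coef \<phi> t)" for t
  proof -
    have "continuous_on UNIV (\<lambda>\<xi>. LINT x|lborel. k t x * cis (- (2 * pi) * \<xi> * x))"
      by (rule fourier_continuous[OF k_int, of 1]) (auto intro!: k_supp)
    then show ?thesis by (simp add: coef_k[abs_def])
  qed
  define W where "W \<xi> = (\<Sum>t\<in>T'. (norm (coef \<phi> t \<xi>))\<^sup>2)" for \<xi>
  have "integrable lborel (\<lambda>\<xi>. (norm (coef \<phi> t \<xi>))\<^sup>2)" for t
  proof -
    have "(\<lambda>\<xi>. LINT x|lborel. k t x * cis (- (2 * pi * \<xi> * x))) \<in> borel_measurable borel"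
      using borel_measurable_continuous_onI[OF cont[of t]] unfolding coef_k[symmetric] .
    then show ?thesis unfolding coef_k by (intro fourier_energy_integrable k_L2 k_supp)
  qed
  then have W_int: "integrable lborel W" unfolding W_def[abs_def] by (intro Bochner_Integration.integrable_sum)
  have W_cont: "continuous_on UNIV W" unfolding W_def[abs_def] by (intro continuous_intros cont)
  have out: "coef \<phi> t \<xi> = 0" if "t \<in> T - T'" for t \<xi>
  proof -
    have "k t x = 0" for x
    proof (cases "x \<in> {0..1}")
      case True
      have "\<bar>t\<bar> > L + 1" using that by (auto simp: T'_def)
      then have "\<bar>x - t\<bar> > L" using True by auto
      then show ?thesis using g_supp by (simp add: k_def)
    qed (rule k_supp)
    then show ?thesis by (simp add: coef_k)
  qed
  have tile: "((\<lambda>s. W (s - y)) has_sum 1) S" for y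
  proof -
    define f where "f = (\<lambda>x. cis (2 * pi * y * x) * \<phi> x)"
    have f: "f \<in> L2b" unfolding f_def by (rule L2b_bounded_mult[OF \<phi> cm, where B = 1]) simp
    have "nsq f = 1" using nsq\<phi> by (simp add: nsq_def f_def norm_mult)
    then have "((\<lambda>p. (norm (ip f (gabor g p)))\<^sup>2) has_sum 1) (T \<times> S)" using parseval[OF f] by simp
    then have "((\<lambda>p. (norm (ip f (gabor g p)))\<^sup>2) has_sum 1) (T' \<times> S)"
    proof (subst has_sum_cong_neutral[where T = "T \<times> S" and g = "\<lambda>p. (norm (ip f (gabor g p)))\<^sup>2"])
      fix p assume "p \<in> T \<times> S - T' \<times> S"
      then obtain t s where p: "p = (t, s)" "t \<in> T - T'" by auto
      have "ip f (gabor g p) = coef \<phi> t (s - y)" unfolding p f_def by (simp add: coef_modulate flip: coef_def)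
      then show "(norm (ip f (gabor g p)))\<^sup>2 = 0" using out[OF p(2)] by simp
    qed (auto simp: T'_def)
    then have "((\<lambda>(s, t). (norm (ip f (gabor g (t, s))))\<^sup>2) has_sum 1) (S \<times> T')" by (subst (asm) has_sum_swap)
    then show ?thesis
    proof (rule has_sum_SigmaD)
      fix s
      have "ip f (gabor g (t, s)) = coef \<phi> t (s - y)" for t unfolding f_def by (simp add: coef_modulate flip: coef_def)
      then show "((\<lambda>t. case (s, t) of (s, t) \<Rightarrow> (norm (ip f (gabor g (t, s))))\<^sup>2) has_sum W (s - y)) T'"
        using finT by (simp add: W_def has_sum_finite)
    qed
  qed
  show thesis
  proof (rule that[OF W_int W_cont])
    show "W x \<ge> 0" for x by (simp add: W_def sum_nonneg)
  qed (rule tile)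
qed

end

text \<open>Integrate the tiling over a unit interval inside a long gap: only the tail of
  \<open>W\<close> is seen, each point at most \<open>n1\<close> times, which is too little for the
  total 1.\<close>

lemma relatively_dense_if_tiling:
  fixes W :: "real \<Rightarrow> real" and S :: "real set"
  assumes W: "integrable lborel W" and nonneg: "\<And>x. W x \<ge> 0" and tile: "\<And>y. ((\<lambda>s. W (s - y)) has_sum 1) S"
    and S: "countable S" and \<rho>: "\<rho> > 0" and sep: "\<And>x y. x \<in> S \<Longrightarrow> y \<in> S \<Longrightarrow> x \<noteq> y \<Longrightarrow> \<bar>x - y\<bar> \<ge> \<rho>"
  obtains M where "\<And>x. S \<inter> {x<..x+M} \<noteq> {}"
proof -
  have [measurable]: "W \<in> borel_measurable borel" using borel_measurable_integrable[OF W] by simp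
  define n1 where "n1 = nat (\<lceil>1 / \<rho>\<rceil> + 2)"
  have card: "card (S \<inter> {a..a+1}) \<le> n1" for a
    using card_separated_Icc[OF \<rho> sep, of S a "a + 1"] by (simp add: n1_def)
  have fin: "finite (S \<inter> {a..b})" for a b by (rule finite_separated_Icc[OF \<rho> sep])
  have "(\<lambda>m. LINT u|lborel. W u * indicator {u. \<bar>u\<bar> \<ge> real m} u) \<longlonglongrightarrow> 0"
    by (rule integral_tail_tendsto_0[OF W])
  then have "(\<lambda>m. real n1 * (LINT u|lborel. W u * indicator {u. \<bar>u\<bar> \<ge> real m} u)) \<longlonglongrightarrow> real n1 * 0"
    by (intro tendsto_intros) simp
  then have "\<forall>\<^sub>F m in sequentially. real n1 * (LINT u|lborel. W u * indicator {u. \<bar>u\<bar> \<ge> real m} u) < 1"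
    by (intro order_tendstoD(2)[where y = 0]) auto
  then obtain m where m: "real n1 * (LINT u|lborel. W u * indicator {u. \<bar>u\<bar> \<ge> real m} u) < 1"
    using eventually_happens'[OF sequentially_bot] by blast
  show thesis
  proof (rule that[of "2 * real m + 2"])
    fix x
    show "S \<inter> {x<..x + (2 * real m + 2)} \<noteq> {}"
    proof
      assume empty: "S \<inter> {x<..x + (2 * real m + 2)} = {}"
      \<comment> \<open>The interval \<open>{y0..y0+1}\<close> keeps distance at least
        \<open>real m\<close> from both ends of the gap.\<close>
      define y0 where "y0 = x + real m"
      have swap: "((\<lambda>s. LINT y|lborel. W (s - y) * indicator {y0..y0+1} y) has_sum (LINT y|lborel. 1 * indicat_real {y0..y0+1} y)) S"
      proof (rule has_sum_integral[OF S, where w = "indicat_real {y0..y0+1}"])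
        show "((\<lambda>s. W (s - y) * indicator {y0..y0+1} y) has_sum (1 * indicat_real {y0..y0+1} y)) S" for y
          by (rule has_sum_cmult_left[OF tile])
        fix y J assume J: "finite J" "J \<subseteq> S"
        have "(\<Sum>s\<in>J. W (s - y)) \<le> 1"
          using has_sum_mono_neutral[OF has_sum_finite[OF J(1), of "\<lambda>s. W (s - y)"] tile[of y]] J nonneg by auto
        then show "(\<Sum>s\<in>J. norm (W (s - y) * indicator {y0..y0+1} y)) \<le> indicat_real {y0..y0+1} y"
          using nonneg by (simp add: indicator_def)
      qed auto
      have "(LINT y|lborel. 1 * indicat_real {y0..y0+1} y) \<le> real n1 * (LINT u|lborel. W u * indicator {u. \<bar>u\<bar> \<ge> real m} u)"
      proof (rule has_sum_le_finite_sums[OF swap])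
        fix J assume J: "finite J" "J \<subseteq> S"
        have Wi: "integrable lborel (\<lambda>u. W u * indicator A u)" if "A \<in> sets borel" for A
          using integrable_real_mult_indicator[of A lborel W] that W by simp
        have "(\<Sum>s\<in>J. LINT y|lborel. W (s - y) * indicator {y0..y0+1} y) = (\<Sum>s\<in>J. LINT u|lborel. W u * indicator {s-y0-1..s-y0} u)"
        proof (rule sum.cong[OF refl])
          fix s
          have "(LINT y|lborel. W (s - y) * indicator {y0..y0+1} y)
              = \<bar>-1\<bar> *\<^sub>R (LINT u|lborel. W (s - (s + (-1) * u)) * indicator {y0..y0+1} (s + (-1) * u))"
            by (rule lborel_integral_real_affine) simp
          also have "\<dots> = (LINT u|lborel. W u * indicator {s-y0-1..s-y0} u)"
            by (simp, intro Bochner_Integration.integral_cong) (auto simp: indicator_def)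
          finally show "(LINT y|lborel. W (s - y) * indicator {y0..y0+1} y) = (LINT u|lborel. W u * indicator {s-y0-1..s-y0} u)" .
        qed
        also have "\<dots> = (LINT u|lborel. (\<Sum>s\<in>J. W u * indicator {s-y0-1..s-y0} u))"
          by (intro Bochner_Integration.integral_sum[symmetric] Wi) auto
        also have "\<dots> \<le> (LINT u|lborel. real n1 * (W u * indicator {u. \<bar>u\<bar> \<ge> real m} u))"
        proof (rule integral_mono)
          show "integrable lborel (\<lambda>u. \<Sum>s\<in>J. W u * indicator {s-y0-1..s-y0} u)"
            by (intro Bochner_Integration.integrable_sum Wi) auto
          show "integrable lborel (\<lambda>u. real n1 * (W u * indicator {u. \<bar>u\<bar> \<ge> real m} u))"
            by (intro integrable_mult_right Wi) measurable
          fix u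
          have "(\<Sum>s\<in>J. indicat_real {s-y0-1..s-y0} u) \<le> real n1 * indicator {u. \<bar>u\<bar> \<ge> real m} u"
          proof (cases "\<bar>u\<bar> \<ge> real m")
            case True
            have "(\<Sum>s\<in>J. indicat_real {s-y0-1..s-y0} u) = (\<Sum>s\<in>J \<inter> {y0+u..y0+u+1}. 1)"
              using J(1) by (intro sum.mono_neutral_cong_right) (auto simp: indicator_def)
            also have "\<dots> \<le> real n1"
              using card[of "y0 + u"] card_mono[OF fin, of "J \<inter> {y0+u..y0+u+1}" "y0 + u" "y0 + u + 1"] J(2) by force
            finally show ?thesis using True by simp
          next
            case False
            have "indicat_real {s-y0-1..s-y0} u = 0" if "s \<in> J" for s
            proof -
              have "s \<notin> {x<..x + (2 * real m + 2)}" using empty that J(2) by blast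
              then show ?thesis using False by (auto simp: indicator_def y0_def)
            qed
            then show ?thesis by simp
          qed
          then show "(\<Sum>s\<in>J. W u * indicator {s-y0-1..s-y0} u) \<le> real n1 * (W u * indicator {u. \<bar>u\<bar> \<ge> real m} u)"
            using mult_left_mono[OF _ nonneg[of u]] by (simp add: sum_distrib_left[symmetric] mult.left_commute[of "real n1"])
        qed
        also have "\<dots> = real n1 * (LINT u|lborel. W u * indicator {u. \<bar>u\<bar> \<ge> real m} u)" by simp
        finally show "(\<Sum>s\<in>J. LINT y|lborel. W (s - y) * indicator {y0..y0+1} y) \<le> real n1 * (LINT u|lborel. W u * indicator {u. \<bar>u\<bar> \<ge> real m} u)" .
      qed
      then show False using m by simp
    qed
  qed
qed

section \<open>Kernels with a flat spectrum\<close>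

lemma integrable_inverse_1_plus_sq [simp]: "integrable lborel (\<lambda>x::real. 1 / (1 + x\<^sup>2))"
proof -
  have half: "(\<integral>\<^sup>+x. ennreal (1 / (1 + x\<^sup>2)) * indicator {0..} x \<partial>lborel) = ennreal (pi / 2 - arctan 0)"
  proof (rule nn_integral_FTC_atLeast)
    show "(arctan has_real_derivative 1 / (1 + x\<^sup>2)) (at x)" for x :: real
      using DERIV_arctan[of x] by (simp add: inverse_eq_divide)
    show "(arctan \<longlongrightarrow> pi / 2) at_top" by (rule tendsto_arctan_at_top)
  qed auto
  have "(\<integral>\<^sup>+x. ennreal (1 / (1 + x\<^sup>2)) * indicator {..0} x \<partial>lborel)
      = ennreal \<bar>-1\<bar> * (\<integral>\<^sup>+x. ennreal (1 / (1 + (0 + (-1) * x)\<^sup>2)) * indicator {..0} (0 + (-1) * x) \<partial>(lborel :: real measure))"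
    by (rule nn_integral_real_affine) auto
  also have "\<dots> = (\<integral>\<^sup>+x. ennreal (1 / (1 + x\<^sup>2)) * indicator {0..} x \<partial>(lborel :: real measure))"
    by (simp add: indicator_def)
  finally have "(\<integral>\<^sup>+x. ennreal (1 / (1 + x\<^sup>2)) * indicator {..0} x \<partial>lborel) = ennreal (pi / 2)" using half by simp
  moreover have "(\<integral>\<^sup>+x. ennreal (1 / (1 + x\<^sup>2)) \<partial>(lborel :: real measure))
      \<le> (\<integral>\<^sup>+x. ennreal (1 / (1 + x\<^sup>2)) * indicator {..0} x + ennreal (1 / (1 + x\<^sup>2)) * indicator {0..} x \<partial>lborel)"
    by (intro nn_integral_mono) (auto simp: indicator_def)
  moreover have "\<dots> = (\<integral>\<^sup>+x. ennreal (1 / (1 + x\<^sup>2)) * indicator {..0} x \<partial>(lborel :: real measure))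
      + (\<integral>\<^sup>+x. ennreal (1 / (1 + x\<^sup>2)) * indicator {0..} x \<partial>lborel)"
    by (rule nn_integral_add) auto
  ultimately have "(\<integral>\<^sup>+x. ennreal (1 / (1 + x\<^sup>2)) \<partial>(lborel :: real measure)) \<le> ennreal (pi / 2) + ennreal (pi / 2 - arctan 0)"
    using half by simp
  also have "\<dots> < \<infinity>" by simp
  finally show ?thesis by (intro integrableI_nonneg) auto
qed

lemma integrable_inverse_1_plus_sq_cmult [simp]: "integrable lborel (\<lambda>x::real. c / (1 + x\<^sup>2))" for c :: real
  using integrable_mult_right[OF integrable_inverse_1_plus_sq, of c] by simp

text \<open>A consequence of
  \<open>u\<^sup>2 \<le> 2 * (u - h)\<^sup>2 + 2 * h\<^sup>2\<close>.\<close>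

lemma inverse_1_plus_sq_shift:
  fixes u h :: real
  shows "1 / (1 + (u - h)\<^sup>2) \<le> 2 * (1 + h\<^sup>2) / (1 + u\<^sup>2)"
proof -
  have pos: "1 + (u - h)\<^sup>2 > 0" "1 + u\<^sup>2 > 0" by (auto intro: add_pos_nonneg)
  have "0 \<le> (u - 2 * h)\<^sup>2" by simp
  then have "u\<^sup>2 \<le> 2 * (u - h)\<^sup>2 + 2 * h\<^sup>2" by (simp add: power2_eq_square algebra_simps)
  moreover have "2 * (1 + h\<^sup>2) * (1 + (u - h)\<^sup>2) = 2 + 2 * h\<^sup>2 + 2 * (u - h)\<^sup>2 + 2 * (h\<^sup>2 * (u - h)\<^sup>2)"
    by (simp only: distrib_left distrib_right mult_1_left mult_1_right mult.assoc)
  moreover have "0 \<le> h\<^sup>2 * (u - h)\<^sup>2" by simp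
  ultimately have "1 + u\<^sup>2 \<le> 2 * (1 + h\<^sup>2) * (1 + (u - h)\<^sup>2)" by linarith
  then show ?thesis using pos by (simp add: divide_simps mult_ac)
qed

text \<open>Substituting \<open>b * x\<close> produces the factor \<open>\<bar>b\<bar>\<close>. The
  constant \<open>\<kappa>\<close> stays unnamed; the kernel built from these integrals is
  normalised by it.\<close>

lemma one_minus_cos_integral:
  obtains \<kappa> :: real where "\<kappa> > 0" "\<And>b. integrable lborel (\<lambda>x::real. (1 - cos (b * x)) / x\<^sup>2)"
    "\<And>b. (LINT x|lborel. (1 - cos (b * x)) / x\<^sup>2) = \<kappa> * \<bar>b\<bar>"
proof -
  define a :: "real \<Rightarrow> real" where "a x = (1 - cos x) / x\<^sup>2" for x
  have nonneg: "a x \<ge> 0" for x by (simp add: a_def)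
  have a_le: "a x \<le> 3 * (1 / (1 + x\<^sup>2))" for x
  proof (cases "x = 0")
    case False
    have "cos x = 1 - 2 * (sin (x / 2))\<^sup>2" using cos_double_sin[of "x / 2"] by simp
    moreover have "(sin (x / 2))\<^sup>2 \<le> (x / 2)\<^sup>2" by (rule abs_le_square_iff[THEN iffD1]) (rule abs_sin_x_le_abs_x)
    moreover have "(sin (x / 2))\<^sup>2 \<le> 1" by (simp add: abs_square_le_1)
    ultimately have "1 - cos x \<le> x\<^sup>2 / 2" "1 - cos x \<le> 2" by (auto simp: power_divide)
    then have "(1 - cos x) * (1 + x\<^sup>2) \<le> x\<^sup>2 / 2 + 2 * x\<^sup>2"
      using mult_right_mono[of "1 - cos x" 2 "x\<^sup>2"] by (simp add: algebra_simps)
    also have "\<dots> \<le> 3 * x\<^sup>2" by simp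
    finally have "(1 - cos x) * (1 + x\<^sup>2) \<le> 3 * x\<^sup>2" .
    moreover have "1 + x\<^sup>2 > 0" by (auto intro: add_pos_nonneg)
    ultimately show ?thesis using False by (simp add: a_def divide_simps mult_ac)
  qed (simp add: a_def)
  have a_int: "integrable lborel a"
    by (rule Bochner_Integration.integrable_bound[of _ "\<lambda>x. 3 * (1 / (1 + x\<^sup>2))"])
       (use a_le nonneg in \<open>auto intro!: AE_I2 simp: a_def[abs_def]\<close>)
  define \<kappa> where "\<kappa> = (LINT x|lborel. a x)"
  have "\<kappa> > 0"
  proof -
    have c1: "cos 1 < (1::real)" using cos_monotone_0_pi[of 0 1] pi_gt3 by simp
    have "(1 - cos 1) / 4 * indicat_real {1..2} x \<le> a x" for x
    proof (cases "x \<in> {1..2}")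
      case True
      then have "cos x \<le> cos 1" using pi_gt3 by (intro cos_monotone_0_pi_le) auto
      moreover have "x\<^sup>2 \<le> 2\<^sup>2" using True by (intro power_mono) auto
      ultimately have "(1 - cos 1) / 4 \<le> a x" unfolding a_def using True c1 by (intro frac_le) auto
      then show ?thesis using True by simp
    qed (simp add: nonneg)
    then have "(LINT x|lborel. (1 - cos 1) / 4 * indicat_real {1..2::real} x) \<le> \<kappa>"
      unfolding \<kappa>_def by (intro integral_mono a_int integrable_mult_right integrable_indicator_Icc)
    then show ?thesis using c1 by simp
  qed
  moreover have "integrable lborel (\<lambda>x. (1 - cos (b * x)) / x\<^sup>2) \<and> (LINT x|lborel. (1 - cos (b * x)) / x\<^sup>2) = \<kappa> * \<bar>b\<bar>" for b
  proof (cases "b = 0")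
    case False
    have eq: "(1 - cos (b * x)) / x\<^sup>2 = b\<^sup>2 * a (0 + b * x)" for x
      using False by (simp add: a_def power_mult_distrib)
    have "\<kappa> = \<bar>b\<bar> *\<^sub>R (LINT x|lborel. a (0 + b * x))"
      unfolding \<kappa>_def by (rule lborel_integral_real_affine[OF False])
    then have "b\<^sup>2 * (LINT x|lborel. a (0 + b * x)) = \<kappa> * \<bar>b\<bar>"
      using False by (simp add: power2_eq_square abs_if)
    moreover have "integrable lborel (\<lambda>x. a (0 + b * x))"
      by (rule lborel_integrable_real_affine[OF a_int False])
    ultimately show ?thesis unfolding eq by simp
  qed simp
  ultimately show thesis using that by blast
qed

text \<open>A de la Vallee Poussin kernel: a difference of two Fejer kernels.\<close>

lemma reproducing_kernel:
  obtains V :: "real \<Rightarrow> real" and C where "V \<in> borel_measurable borel" "\<And>x. \<bar>V x\<bar> \<le> C * (1 / (1 + x\<^sup>2))"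
    "\<And>x. x \<noteq> 0 \<Longrightarrow> isCont V x" "\<And>u. \<bar>u\<bar> \<le> 1 \<Longrightarrow> (LINT x|lborel. of_real (V x) * cis (u * x)) = 1"
proof -
  obtain \<kappa> :: real where \<kappa>: "\<kappa> > 0" and int: "\<And>b. integrable lborel (\<lambda>x::real. (1 - cos (b * x)) / x\<^sup>2)"
    and val: "\<And>b. (LINT x|lborel. (1 - cos (b * x)) / x\<^sup>2) = \<kappa> * \<bar>b\<bar>"
    by (rule one_minus_cos_integral) blast
  \<comment> \<open>Division by zero sets \<open>V 0\<close> to 0, so continuity is available away
    from 0 only.\<close>
  define V where "V x = (cos x - cos (2 * x)) / x\<^sup>2 / \<kappa>" for x :: real
  have meas [measurable]: "V \<in> borel_measurable borel" unfolding V_def[abs_def] by measurable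
  have le: "\<bar>V x\<bar> \<le> 4 / \<kappa> * (1 / (1 + x\<^sup>2))" for x
  proof (cases "x = 0")
    case False
    define s where "s = sin (x / 2)"
    have sq: "(sin (3 * x / 2))\<^sup>2 \<le> 1" "s\<^sup>2 \<le> 1" by (auto simp: s_def abs_square_le_1)
    have "\<bar>cos x - cos (2 * x)\<bar> = 2 * \<bar>sin (3 * x / 2)\<bar> * \<bar>sin (x / 2)\<bar>"
      using cos_diff_cos[of x "2 * x"] by (simp add: abs_mult)
    moreover have "\<bar>sin (3 * x / 2)\<bar> \<le> 3 * \<bar>x\<bar> / 2" "\<bar>sin (x / 2)\<bar> \<le> \<bar>x\<bar> / 2"
      using abs_sin_x_le_abs_x[of "3 * x / 2"] abs_sin_x_le_abs_x[of "x / 2"] by auto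
    then have "\<bar>sin (3 * x / 2)\<bar> * \<bar>sin (x / 2)\<bar> \<le> (3 * \<bar>x\<bar> / 2) * (\<bar>x\<bar> / 2)" by (intro mult_mono) auto
    ultimately have 1: "\<bar>cos x - cos (2 * x)\<bar> \<le> 2 * x\<^sup>2" by (simp add: power2_eq_square)
    have 2: "\<bar>cos x - cos (2 * x)\<bar> \<le> 2"
      using cos_le_one[of x] cos_ge_minus_one[of x] cos_le_one[of "2 * x"] cos_ge_minus_one[of "2 * x"] by linarith
    have "\<bar>cos x - cos (2 * x)\<bar> * (1 + x\<^sup>2) \<le> 2 * x\<^sup>2 + 2 * x\<^sup>2"
      using 1 mult_right_mono[OF 2, of "x\<^sup>2"] by (simp add: algebra_simps)
    moreover have "1 + x\<^sup>2 > 0" by (auto intro: add_pos_nonneg)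
    ultimately show ?thesis using False \<kappa> by (simp add: V_def abs_divide divide_simps mult_ac)
  qed (use \<kappa> in \<open>simp add: V_def\<close>)
  have V_int: "integrable lborel V"
  proof (rule Bochner_Integration.integrable_bound[OF integrable_mult_right[OF integrable_inverse_1_plus_sq, of "4 / \<kappa>"]])
    show "AE x in lborel. norm (V x) \<le> norm (4 / \<kappa> * (1 / (1 + x\<^sup>2)))"
      using order_trans[OF le abs_ge_self] by (intro AE_I2) simp
  qed simp
  have cont: "isCont V x" if "x \<noteq> 0" for x
    unfolding V_def[abs_def] using that \<kappa> by (intro continuous_intros) auto
  have four: "(LINT x|lborel. of_real (V x) * cis (u * x)) = 1" if u: "\<bar>u\<bar> \<le> 1" for u
  proof -
    have bounded: "integrable lborel (\<lambda>x. V x * f x)" if "f \<in> borel_measurable borel" "\<And>x. \<bar>f x\<bar> \<le> 1" for f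
    proof (rule Bochner_Integration.integrable_bound[OF V_int])
      show "(\<lambda>x. V x * f x) \<in> borel_measurable lborel" using that by measurable
      show "AE x in lborel. norm (V x * f x) \<le> norm (V x)"
        using that(2) by (auto intro!: AE_I2 simp: abs_mult mult_left_le)
    qed
    have ci: "integrable lborel (\<lambda>x. V x * cos (u * x))" "integrable lborel (\<lambda>x. V x * sin (u * x))"
      by (intro bounded; simp)+
    define A where "A b x = (1 - cos (b * x)) / x\<^sup>2" for b x :: real
    \<comment> \<open>Product-to-sum formulas reduce the integral to four integrals of the form
      \<open>A b\<close>, whose values are known.\<close>
    have eq: "V x * cos (u * x) = (A (2 + u) x + A (2 - u) x - A (1 + u) x - A (1 - u) x) / (2 * \<kappa>)" for x
    proof -
      have "cos (2 * x) * cos (u * x) = (cos ((2 + u) * x) + cos ((2 - u) * x)) / 2"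
        "cos x * cos (u * x) = (cos ((1 + u) * x) + cos ((1 - u) * x)) / 2"
        by (simp_all add: cos_add cos_diff algebra_simps)
      then have "(cos x - cos (2 * x)) * cos (u * x) =
          ((1 - cos ((2 + u) * x)) + (1 - cos ((2 - u) * x)) - (1 - cos ((1 + u) * x)) - (1 - cos ((1 - u) * x))) / 2"
        by (simp add: left_diff_distrib)
      moreover have "A (2 + u) x + A (2 - u) x - A (1 + u) x - A (1 - u) x =
          ((1 - cos ((2 + u) * x)) + (1 - cos ((2 - u) * x)) - (1 - cos ((1 + u) * x)) - (1 - cos ((1 - u) * x))) / x\<^sup>2"
        unfolding A_def by (simp only: diff_divide_distrib add_divide_distrib)
      moreover have "V x * cos (u * x) = (cos x - cos (2 * x)) * cos (u * x) / x\<^sup>2 / \<kappa>"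
        by (simp add: V_def)
      moreover have "n / 2 / x\<^sup>2 / \<kappa> = n / x\<^sup>2 / (2 * \<kappa>)" for n :: real by simp
      ultimately show ?thesis by metis
    qed
    have "(LINT x|lborel. V x * cos (u * x)) = \<kappa> * (\<bar>2 + u\<bar> + \<bar>2 - u\<bar> - \<bar>1 + u\<bar> - \<bar>1 - u\<bar>) / (2 * \<kappa>)"
    proof -
      have Ai: "integrable lborel (A b)" "(LINT x|lborel. A b x) = \<kappa> * \<bar>b\<bar>" for b
        using int[of b] val[of b] by (simp_all add: A_def[abs_def])
      show ?thesis unfolding eq using Ai by (simp add: right_diff_distrib distrib_left)
    qed
    \<comment> \<open>The transform is a trapezoid; this is its plateau.\<close>
    also have "\<bar>2 + u\<bar> + \<bar>2 - u\<bar> - \<bar>1 + u\<bar> - \<bar>1 - u\<bar> = 2" using u by auto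
    finally have c: "(LINT x|lborel. V x * cos (u * x)) = 1" using \<kappa> by simp
    have "(LINT x|lborel. V x * sin (u * x)) = \<bar>-1\<bar> *\<^sub>R (LINT x|lborel. V (0 + (-1) * x) * sin (u * (0 + (-1) * x)))"
      by (rule lborel_integral_real_affine) simp
    also have "\<dots> = - (LINT x|lborel. V x * sin (u * x))" by (simp add: V_def)
    finally have s: "(LINT x|lborel. V x * sin (u * x)) = 0" by simp
    have "(LINT x|lborel. of_real (V x) * cis (u * x))
        = (LINT x|lborel. of_real (V x * cos (u * x)) + \<i> * of_real (V x * sin (u * x)))"
      by (intro Bochner_Integration.integral_cong) (auto simp: complex_eq_iff)
    also have "\<dots> = of_real (LINT x|lborel. V x * cos (u * x)) + \<i> * of_real (LINT x|lborel. V x * sin (u * x))"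
      using ci by (subst Bochner_Integration.integral_add) (auto simp del: of_real_mult intro!: integrable_mult_right integrable_of_real)
    finally show ?thesis using c s by simp
  qed
  show thesis by (rule that[OF meas le cont four])
qed

text \<open>
  A bounded function which is reproduced by a very flat kernel varies slowly, so it cannot be
  annihilated by averaging against a nonnegative \<open>W\<close>.
\<close>

lemma annihilated_slowly_varying_zero:
  fixes W V :: "real \<Rightarrow> real"
  assumes W: "integrable lborel W" and nonneg: "\<And>x. W x \<ge> 0" and pos: "(LINT x|lborel. W x) > 0"
    and V [measurable]: "V \<in> borel_measurable borel" and V_le: "\<And>x. \<bar>V x\<bar> \<le> C * (1 / (1 + x\<^sup>2))"
    and V_cont: "\<And>x. x \<noteq> 0 \<Longrightarrow> isCont V x"
  obtains \<epsilon> where "\<epsilon> > 0" "\<forall>(D :: real \<Rightarrow> complex) Q. D \<in> borel_measurable borel \<longrightarrow> (\<forall>y. norm (D y) \<le> Q) \<longrightarrow>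
    (\<forall>y. (LINT x|lborel. of_real (\<epsilon> * V (\<epsilon> * x)) * D (y + x)) = D y) \<longrightarrow>
    (\<forall>y. (LINT x|lborel. of_real (W x) * D (y + x)) = 0) \<longrightarrow> (\<forall>y. D y = 0)"
proof -
  have C: "C \<ge> 0" using V_le[of 0] by simp
  have [measurable]: "W \<in> borel_measurable borel" using borel_measurable_integrable[OF W] by simp
  have V_int: "integrable lborel V"
    by (rule Bochner_Integration.integrable_bound[of _ "\<lambda>x. C * (1 / (1 + x\<^sup>2))"])
       (use V_le C in \<open>auto intro!: AE_I2\<close>)
  have V_shift: "integrable lborel (\<lambda>u. V (u - h))" for h
    using lborel_integrable_translate[OF V_int, of "-h"] by simp
  have dom: "\<bar>V (u - h) - V u\<bar> \<le> C * (3 + 2 * H\<^sup>2) * (1 / (1 + u\<^sup>2))" if "\<bar>h\<bar> \<le> H" for u h H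
  proof -
    have "\<bar>V (u - h) - V u\<bar> \<le> C * (1 / (1 + (u - h)\<^sup>2)) + C * (1 / (1 + u\<^sup>2))"
      using V_le[of "u - h"] V_le[of u] by linarith
    also have "C * (1 / (1 + (u - h)\<^sup>2)) \<le> C * (2 * (1 + H\<^sup>2) / (1 + u\<^sup>2))"
    proof (rule mult_left_mono[OF _ C])
      have "h\<^sup>2 \<le> H\<^sup>2" using that by (simp add: abs_le_square_iff[symmetric])
      then have "2 * (1 + h\<^sup>2) / (1 + u\<^sup>2) \<le> 2 * (1 + H\<^sup>2) / (1 + u\<^sup>2)"
        by (intro divide_right_mono) (auto intro: add_nonneg_nonneg)
      then show "1 / (1 + (u - h)\<^sup>2) \<le> 2 * (1 + H\<^sup>2) / (1 + u\<^sup>2)"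
        using inverse_1_plus_sq_shift[of u h] by linarith
    qed
    finally show ?thesis by (simp add: add_divide_distrib[symmetric] algebra_simps)
  qed
  \<comment> \<open>The integral modulus of continuity of \<open>V\<close> controls how much a
    function reproduced by the rescaled kernel varies under a shift.\<close>
  define \<omega> where "\<omega> h = (LINT u|lborel. \<bar>V (u - h) - V u\<bar>)" for h
  have \<omega>_meas [measurable]: "\<omega> \<in> borel_measurable borel"
    unfolding \<omega>_def[abs_def] by measurable
  have \<omega>_nonneg: "\<omega> h \<ge> 0" for h unfolding \<omega>_def by (intro Bochner_Integration.integral_nonneg) auto
  have \<omega>_le: "\<omega> h \<le> 2 * (LINT u|lborel. \<bar>V u\<bar>)" for h
  proof -
    have "\<omega> h \<le> (LINT u|lborel. \<bar>V (u - h)\<bar> + \<bar>V u\<bar>)"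
      unfolding \<omega>_def using V_int V_shift by (intro integral_mono) (auto intro: integrable_abs)
    also have "\<dots> = (LINT u|lborel. \<bar>V (u - h)\<bar>) + (LINT u|lborel. \<bar>V u\<bar>)"
      using V_int V_shift by (intro Bochner_Integration.integral_add integrable_abs)
    also have "(LINT u|lborel. \<bar>V (u - h)\<bar>) = (LINT u|lborel. \<bar>V u\<bar>)"
      using lborel_integral_translate[of "\<lambda>u. \<bar>V u\<bar>" "-h"] by simp
    finally show ?thesis by simp
  qed
  have \<omega>_lim: "(\<lambda>n. \<omega> (x / real (Suc n))) \<longlonglongrightarrow> 0" for x
  proof -
    have "(\<lambda>n. LINT u|lborel. \<bar>V (u - x / real (Suc n)) - V u\<bar>) \<longlonglongrightarrow> (LINT u|(lborel :: real measure). 0)"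
    proof (rule integral_dominated_convergence[where w = "\<lambda>u. C * (3 + 2 * \<bar>x\<bar>\<^sup>2) * (1 / (1 + u\<^sup>2))"])
      have xn: "(\<lambda>n. x / real (Suc n)) \<longlonglongrightarrow> 0" using LIMSEQ_Suc[OF lim_const_over_n[of x]] by simp
      have "AE u in (lborel :: real measure). u \<noteq> 0" by (rule AE_lborel_singleton)
      then show "AE u in lborel. (\<lambda>n. \<bar>V (u - x / real (Suc n)) - V u\<bar>) \<longlonglongrightarrow> 0"
      proof eventually_elim
        case (elim u)
        have "(\<lambda>n. u - x / real (Suc n)) \<longlonglongrightarrow> u - 0" by (intro tendsto_intros xn)
        then have "(\<lambda>n. V (u - x / real (Suc n))) \<longlonglongrightarrow> V u" using isCont_tendsto_compose[OF V_cont[OF elim]] by simp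
        then have "(\<lambda>n. \<bar>V (u - x / real (Suc n)) - V u\<bar>) \<longlonglongrightarrow> \<bar>V u - V u\<bar>" by (intro tendsto_intros)
        then show ?case by simp
      qed
      show "AE u in lborel. norm \<bar>V (u - x / real (Suc n)) - V u\<bar> \<le> C * (3 + 2 * \<bar>x\<bar>\<^sup>2) * (1 / (1 + u\<^sup>2))" for n
      proof (rule AE_I2)
        fix u
        have "\<bar>x / real (Suc n)\<bar> \<le> \<bar>x\<bar>" by (simp add: abs_divide divide_le_eq mult_le_cancel_left1)
        then show "norm \<bar>V (u - x / real (Suc n)) - V u\<bar> \<le> C * (3 + 2 * \<bar>x\<bar>\<^sup>2) * (1 / (1 + u\<^sup>2))"
          using dom[of "x / real (Suc n)" "\<bar>x\<bar>" u] by simp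
      qed
    qed auto
    then show ?thesis by (simp add: \<omega>_def)
  qed
  have "(\<lambda>n. LINT x|lborel. W x * \<omega> (x / real (Suc n))) \<longlonglongrightarrow> (LINT x|(lborel :: real measure). 0)"
  proof (rule integral_dominated_convergence[where w = "\<lambda>x. W x * (2 * (LINT u|lborel. \<bar>V u\<bar>))"])
    show "AE x in lborel. (\<lambda>n. W x * \<omega> (x / real (Suc n))) \<longlonglongrightarrow> 0"
      using tendsto_mult_right_zero[OF \<omega>_lim] by simp
    show "AE x in lborel. norm (W x * \<omega> (x / real (Suc n))) \<le> W x * (2 * (LINT u|lborel. \<bar>V u\<bar>))" for n
      using nonneg \<omega>_nonneg \<omega>_le by (auto intro!: AE_I2 mult_left_mono simp: abs_mult)
  qed (use W in auto)
  \<comment> \<open>Widening the kernel drives the weighted average of \<open>\<omega>\<close> to 0;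
    once it is below the mass of \<open>W\<close>, their quotient is a contraction factor.\<close>
  then have "\<forall>\<^sub>F n in sequentially. (LINT x|lborel. W x * \<omega> (x / real (Suc n))) < (LINT x|lborel. W x)"
    using pos by (intro order_tendstoD(2)[where y = 0]) auto
  then obtain n where n: "(LINT x|lborel. W x * \<omega> (x / real (Suc n))) < (LINT x|lborel. W x)"
    using eventually_happens'[OF sequentially_bot] by blast
  define \<epsilon> where "\<epsilon> = 1 / real (Suc n)"
  have \<epsilon>: "\<epsilon> > 0" by (simp add: \<epsilon>_def)
  have n': "(LINT x|lborel. W x * \<omega> (\<epsilon> * x)) < (LINT x|lborel. W x)" using n by (simp add: \<epsilon>_def)
  have W\<omega>_int: "integrable lborel (\<lambda>x. W x * \<omega> (\<epsilon> * x))"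
    by (rule Bochner_Integration.integrable_bound[of _ "\<lambda>x. W x * (2 * (LINT u|lborel. \<bar>V u\<bar>))"])
       (use W nonneg \<omega>_nonneg \<omega>_le in \<open>auto intro!: AE_I2 mult_left_mono simp: abs_mult\<close>)
  show thesis
  proof (rule that[OF \<epsilon>], intro allI impI)
    fix D :: "real \<Rightarrow> complex" and Q y
    assume D [measurable]: "D \<in> borel_measurable borel" and Q: "\<forall>y. norm (D y) \<le> Q"
      and rep: "\<forall>y. (LINT x|lborel. of_real (\<epsilon> * V (\<epsilon> * x)) * D (y + x)) = D y"
      and ann: "\<forall>y. (LINT x|lborel. of_real (W x) * D (y + x)) = 0"
    \<comment> \<open>The exact supremum is taken instead of the bound \<open>Q\<close>: if every
      value is at most \<open>q * \<theta>\<close> with \<open>\<theta> < 1\<close>, then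
      \<open>q\<close> must be 0.\<close>
    define q where "q = (SUP y. norm (D y))"
    have bdd: "bdd_above (range (\<lambda>y. norm (D y)))" using Q by (auto simp: bdd_above_def)
    have q: "norm (D y) \<le> q" for y unfolding q_def using bdd by (rule cSUP_upper[rotated]) simp
    have q0: "q \<ge> 0" using q[of 0] norm_ge_zero order_trans by blast
    have V\<epsilon>_int: "integrable lborel (\<lambda>u. V (\<epsilon> * u - h))" for h
      using lborel_integrable_real_affine[OF V_int, of \<epsilon> "-h"] \<epsilon> by (simp add: add.commute)
    have int1: "integrable lborel (\<lambda>u. complex_of_real (\<epsilon> * V (\<epsilon> * u - h)) * D (y + u))" for h y
    proof (rule Bochner_Integration.integrable_bound[of _ "\<lambda>u. \<epsilon> * V (\<epsilon> * u - h) * q"])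
      show "integrable lborel (\<lambda>u. \<epsilon> * V (\<epsilon> * u - h) * q)" using V\<epsilon>_int by simp
      show "AE u in lborel. norm (complex_of_real (\<epsilon> * V (\<epsilon> * u - h)) * D (y + u)) \<le> norm (\<epsilon> * V (\<epsilon> * u - h) * q)"
        using q q0 by (auto intro!: AE_I2 mult_left_mono simp: norm_mult abs_mult)
    qed measurable
    \<comment> \<open>Both values are written through the kernel, with the shift moved from
      \<open>D\<close> onto \<open>V\<close>; rescaling turns the resulting integral into
      \<open>\<omega> (\<epsilon> * x)\<close>.\<close>
    have var: "norm (D y - D (y + x)) \<le> q * \<omega> (\<epsilon> * x)" for x y
    proof -
      have "D (y + x) = (LINT u|lborel. of_real (\<epsilon> * V (\<epsilon> * u)) * D (y + x + u))" by (rule rep[rule_format, symmetric])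
      also have "\<dots> = (LINT u|lborel. of_real (\<epsilon> * V (\<epsilon> * u - \<epsilon> * x)) * D (y + u))"
        using lborel_integral_translate[of "\<lambda>u. of_real (\<epsilon> * V (\<epsilon> * u - \<epsilon> * x)) * D (y + u)" x]
        by (simp add: algebra_simps)
      finally have "D (y + x) = (LINT u|lborel. of_real (\<epsilon> * V (\<epsilon> * u - \<epsilon> * x)) * D (y + u))" .
      moreover have "D y = (LINT u|lborel. of_real (\<epsilon> * V (\<epsilon> * u - 0)) * D (y + u))" using rep by simp
      ultimately have "D y - D (y + x) = (LINT u|lborel. of_real (\<epsilon> * V (\<epsilon> * u - 0)) * D (y + u) - of_real (\<epsilon> * V (\<epsilon> * u - \<epsilon> * x)) * D (y + u))"
        using int1 by (simp only: Bochner_Integration.integral_diff)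
      then have "norm (D y - D (y + x)) \<le> (LINT u|lborel. norm (of_real (\<epsilon> * V (\<epsilon> * u - 0)) * D (y + u) - of_real (\<epsilon> * V (\<epsilon> * u - \<epsilon> * x)) * D (y + u)))"
        by (simp only: integral_norm_bound)
      also have "\<dots> \<le> (LINT u|lborel. q * (\<epsilon> * \<bar>V (\<epsilon> * u - \<epsilon> * x) - V (\<epsilon> * u - 0)\<bar>))"
      proof (rule integral_mono)
        show "integrable lborel (\<lambda>u. norm (of_real (\<epsilon> * V (\<epsilon> * u - 0)) * D (y + u) - of_real (\<epsilon> * V (\<epsilon> * u - \<epsilon> * x)) * D (y + u)))"
          by (intro integrable_norm Bochner_Integration.integrable_diff int1)
        show "integrable lborel (\<lambda>u. q * (\<epsilon> * \<bar>V (\<epsilon> * u - \<epsilon> * x) - V (\<epsilon> * u - 0)\<bar>))"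
          by (intro integrable_mult_right integrable_abs Bochner_Integration.integrable_diff V\<epsilon>_int)
        fix u
        have "of_real (\<epsilon> * V (\<epsilon> * u - 0)) * D (y + u) - of_real (\<epsilon> * V (\<epsilon> * u - \<epsilon> * x)) * D (y + u)
            = of_real (\<epsilon> * (V (\<epsilon> * u - 0) - V (\<epsilon> * u - \<epsilon> * x))) * D (y + u)"
          by (simp add: algebra_simps)
        then have "norm (of_real (\<epsilon> * V (\<epsilon> * u - 0)) * D (y + u) - of_real (\<epsilon> * V (\<epsilon> * u - \<epsilon> * x)) * D (y + u))
            = \<epsilon> * \<bar>V (\<epsilon> * u - \<epsilon> * x) - V (\<epsilon> * u - 0)\<bar> * norm (D (y + u))"
          by (simp only: norm_mult norm_of_real abs_mult) (use \<epsilon> in \<open>simp add: abs_minus_commute\<close>)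
        also have "\<dots> \<le> \<epsilon> * \<bar>V (\<epsilon> * u - \<epsilon> * x) - V (\<epsilon> * u - 0)\<bar> * q"
          using q \<epsilon> by (intro mult_left_mono) auto
        finally show "norm (of_real (\<epsilon> * V (\<epsilon> * u - 0)) * D (y + u) - of_real (\<epsilon> * V (\<epsilon> * u - \<epsilon> * x)) * D (y + u))
            \<le> q * (\<epsilon> * \<bar>V (\<epsilon> * u - \<epsilon> * x) - V (\<epsilon> * u - 0)\<bar>)" by (simp add: mult_ac)
      qed
      also have "\<dots> = q * (\<epsilon> * (LINT u|lborel. \<bar>V (\<epsilon> * u - \<epsilon> * x) - V (\<epsilon> * u)\<bar>))" by simp
      also have "\<epsilon> * (LINT u|lborel. \<bar>V (\<epsilon> * u - \<epsilon> * x) - V (\<epsilon> * u)\<bar>) = \<omega> (\<epsilon> * x)"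
        unfolding \<omega>_def using lborel_integral_real_affine[of \<epsilon> "\<lambda>u. \<bar>V (u - \<epsilon> * x) - V u\<bar>" 0] \<epsilon> by simp
      finally show ?thesis .
    qed
    define \<theta> where "\<theta> = (LINT x|lborel. W x * \<omega> (\<epsilon> * x)) / (LINT x|lborel. W x)"
    have \<theta>: "\<theta> < 1" using n' pos by (simp add: \<theta>_def)
    have contr: "norm (D y) \<le> q * \<theta>" for y
    proof -
      have i1: "integrable lborel (\<lambda>x. complex_of_real (W x) * D (y + x))"
      proof (rule Bochner_Integration.integrable_bound[of _ "\<lambda>x. W x * q"])
        show "AE x in lborel. norm (complex_of_real (W x) * D (y + x)) \<le> norm (W x * q)"
          using q q0 by (auto intro!: AE_I2 mult_left_mono simp: norm_mult abs_mult)
      qed (use W in auto)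
      have i2: "integrable lborel (\<lambda>x. complex_of_real (W x) * D y)" using W by (intro integrable_mult_left integrable_of_real)
      \<comment> \<open>As the average of \<open>D (y + x)\<close> against \<open>W\<close> is zero,
        subtracting it for free turns \<open>D y\<close> into an average of variations.\<close>
      have "of_real (LINT x|lborel. W x) * D y = (LINT x|lborel. complex_of_real (W x) * D y) - (LINT x|lborel. of_real (W x) * D (y + x))"
        using ann by simp
      also have "\<dots> = (LINT x|lborel. complex_of_real (W x) * D y - of_real (W x) * D (y + x))"
        using i1 i2 by simp
      finally have "norm (of_real (LINT x|lborel. W x) * D y) \<le> (LINT x|lborel. norm (complex_of_real (W x) * D y - of_real (W x) * D (y + x)))"
        by (simp only: integral_norm_bound)
      also have "\<dots> \<le> (LINT x|lborel. q * (W x * \<omega> (\<epsilon> * x)))"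
      proof (rule integral_mono)
        show "integrable lborel (\<lambda>x. norm (complex_of_real (W x) * D y - of_real (W x) * D (y + x)))"
          using i1 i2 by (intro integrable_norm Bochner_Integration.integrable_diff)
        show "integrable lborel (\<lambda>x. q * (W x * \<omega> (\<epsilon> * x)))" using W\<omega>_int by simp
        fix x
        have "norm (complex_of_real (W x) * D y - of_real (W x) * D (y + x)) = W x * norm (D y - D (y + x))"
          using nonneg[of x] by (simp add: norm_mult flip: right_diff_distrib)
        also have "\<dots> \<le> W x * (q * \<omega> (\<epsilon> * x))" using nonneg var by (intro mult_left_mono)
        finally show "norm (complex_of_real (W x) * D y - of_real (W x) * D (y + x)) \<le> q * (W x * \<omega> (\<epsilon> * x))"
          by (simp add: mult_ac)
      qed
      also have "\<dots> = q * (LINT x|lborel. W x * \<omega> (\<epsilon> * x))" by simp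
      finally have "(LINT x|lborel. W x) * norm (D y) \<le> q * (LINT x|lborel. W x * \<omega> (\<epsilon> * x))"
        using pos by (simp add: norm_mult)
      then show ?thesis using pos by (simp add: \<theta>_def field_simps)
    qed
    then have "q \<le> q * \<theta>" unfolding q_def by (intro cSUP_least) (auto simp: q_def)
    then have "q = 0" using q0 \<theta> by (metis less_le_not_le mult_le_cancel_left1 not_less order_antisym)
    then show "D y = 0" using q[of y] by simp
  qed
qed

section \<open>Band-limited combs\<close>

definition hat :: "real \<Rightarrow> real" where "hat v = max 0 (1 - \<bar>v\<bar>)"

text \<open>Despite its name this is the transform of the triangle: for nonzero \<open>x\<close> the
  squared sinc \<open>(sin (x/2) / (x/2))\<^sup>2\<close>, with spectrum in \<open>{-1..1}\<close>
  and integrable decay.\<close>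

definition tri :: "real \<Rightarrow> complex" where "tri x = (LINT v|lborel. of_real (hat v) * cis (x * v))"

lemma hat_borel [measurable]: "hat \<in> borel_measurable borel"
  unfolding hat_def[abs_def] by measurable

lemma hat_bounds: "0 \<le> hat v" "hat v \<le> indicator {-1..1} v"
  by (auto simp: hat_def indicator_def)

lemma hat_integrable: "integrable lborel hat"
proof (rule Bochner_Integration.integrable_bound[OF integrable_indicator_Icc[of "-1" 1]])
  show "AE x in lborel. norm (hat x) \<le> norm (indicat_real {- 1..1} x)"
    using hat_bounds by (intro AE_I2) (simp add: abs_of_nonneg)
qed simp

lemma tri_continuous: "continuous_on A tri"
  using fourier_continuous[of "\<lambda>v. of_real (hat v)" 1 A 1]
  by (simp add: tri_def[abs_def] hat_integrable) (simp add: hat_def)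

lemma tri_0: "tri 0 \<noteq> 0"
proof -
  have "(LINT v|lborel. 1 / 2 * indicat_real {-1/2..1/2::real} v) \<le> (LINT v|lborel. hat v)"
    by (intro integral_mono hat_integrable integrable_mult_right integrable_indicator_Icc)
       (auto simp: hat_def indicator_def)
  moreover have "tri 0 = of_real (LINT v|lborel. hat v)" by (simp add: tri_def)
  ultimately show ?thesis by auto
qed

text \<open>Integration by parts, with the antiderivative written out.\<close>

lemma integral_linear_cis:
  fixes x p q a b :: real
  assumes "x \<noteq> 0" "a \<le> b"
  shows "has_bochner_integral lborel (\<lambda>v. indicator {a..b} v *\<^sub>R (of_real (p + q * v) * cis (x * v)))
    ((of_real (p + q * b) / (\<i> * of_real x) + of_real (q / x\<^sup>2)) * cis (x * b)
     - (of_real (p + q * a) / (\<i> * of_real x) + of_real (q / x\<^sup>2)) * cis (x * a))"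
proof (rule has_bochner_integral_FTC_Icc[OF assms(2)])
  let ?x = "complex_of_real x" and ?p = "complex_of_real p" and ?q = "complex_of_real q"
  fix v
  have "((\<lambda>v. ((?p + ?q * of_real v) / (\<i> * ?x) + ?q / ?x\<^sup>2) * exp (\<i> * ?x * of_real v)) has_vector_derivative
      (?q / (\<i> * ?x)) * exp (\<i> * ?x * of_real v) + ((?p + ?q * of_real v) / (\<i> * ?x) + ?q / ?x\<^sup>2) * (\<i> * ?x * exp (\<i> * ?x * of_real v)))
      (at v within {a..b})"
    by (rule has_vector_derivative_real_field) (auto intro!: derivative_eq_intros simp: assms)
  moreover have "(?q / (\<i> * ?x)) * e + ((?p + ?q * of_real v) / (\<i> * ?x) + ?q / ?x\<^sup>2) * (\<i> * ?x * e)
      = (?p + ?q * of_real v) * e" for e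
    using assms(1) by (simp add: field_simps power2_eq_square)
  ultimately show "((\<lambda>v. (of_real (p + q * v) / (\<i> * of_real x) + of_real (q / x\<^sup>2)) * cis (x * v)) has_vector_derivative
      of_real (p + q * v) * cis (x * v)) (at v within {a..b})"
    by (simp add: cis_conv_exp mult.assoc)
next
  show "continuous_on {a..b} (\<lambda>v. complex_of_real (p + q * v) * cis (x * v))" by (intro continuous_intros)
qed

text \<open>The trivial bound 2 serves small \<open>x\<close>. For large \<open>x\<close> the two
  linear pieces of \<open>hat\<close> give \<open>4 / x\<^sup>2\<close>: the boundary terms of order
  \<open>1 / x\<close> cancel since \<open>hat\<close> is continuous and vanishes at both
  ends.\<close>

lemma norm_tri_le: "norm (tri x) \<le> 6 * (1 / (1 + x\<^sup>2))"
proof -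
  have le2: "norm (tri x) \<le> 2"
  proof -
    have "norm (tri x) \<le> (LINT v|lborel. norm (of_real (hat v) * cis (x * v)))"
      unfolding tri_def by (rule integral_norm_bound)
    also have "\<dots> = (LINT v|lborel. hat v)" using hat_bounds by (simp add: norm_mult)
    also have "\<dots> \<le> (LINT v|lborel. indicat_real {-1..1::real} v)"
      by (intro integral_mono hat_integrable integrable_indicator_Icc hat_bounds)
    finally show ?thesis by simp
  qed
  have le4: "norm (tri x) * x\<^sup>2 \<le> 4"
  proof (cases "x = 0")
    case False
    have "AE v in (lborel :: real measure). v \<noteq> 0" by (rule AE_lborel_singleton)
    then have ae: "AE v in lborel. of_real (hat v) * cis (x * v)
        = indicator {-1..0} v *\<^sub>R (of_real (1 + 1 * v) * cis (x * v)) + indicator {0..1} v *\<^sub>R (of_real (1 + (-1) * v) * cis (x * v))"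
      by eventually_elim (auto simp: hat_def indicator_def)
    note I1 = integral_linear_cis[OF False, of "-1" 0 1 1] and I2 = integral_linear_cis[OF False, of 0 1 1 "-1"]
    have m: "(\<lambda>v. cis (x * v)) \<in> borel_measurable borel"
      by (intro borel_measurable_continuous_onI continuous_intros)
    have "tri x = (LINT v|lborel. indicator {-1..0} v *\<^sub>R (of_real (1 + 1 * v) * cis (x * v)) + indicator {0..1} v *\<^sub>R (of_real (1 + (-1) * v) * cis (x * v)))"
      unfolding tri_def using m ae by (intro integral_cong_AE) auto
    also have "\<dots> = of_real (2 / x\<^sup>2) - of_real (1 / x\<^sup>2) * cis (x * - 1) - of_real (1 / x\<^sup>2) * cis (x * 1)"
      using has_bochner_integral_add[OF I1 I2] by (simp add: has_bochner_integral_iff)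
    also have "norm \<dots> \<le> norm (complex_of_real (2 / x\<^sup>2) - of_real (1 / x\<^sup>2) * cis (x * - 1)) + norm (of_real (1 / x\<^sup>2) * cis (x * 1))"
      by (rule norm_triangle_ineq4)
    also have "\<dots> \<le> norm (complex_of_real (2 / x\<^sup>2)) + norm (of_real (1 / x\<^sup>2) * cis (x * - 1)) + norm (of_real (1 / x\<^sup>2) * cis (x * 1))"
      by (intro add_right_mono norm_triangle_ineq4)
    also have "\<dots> = 4 / x\<^sup>2" unfolding norm_mult norm_of_real by simp
    finally show ?thesis using False by (simp add: field_simps)
  qed simp
  have "norm (tri x) * (1 + x\<^sup>2) \<le> 6" using le2 le4 by (simp add: algebra_simps)
  moreover have "1 + x\<^sup>2 > 0" by (auto intro: add_pos_nonneg)
  ultimately show ?thesis by (simp add: field_simps)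
qed

text \<open>A test function whose spectrum is a tent of half-width \<open>\<epsilon>\<close> around
  \<open>z\<close>; varying \<open>z\<close> will probe a whole interval of frequencies.\<close>

definition band :: "real \<Rightarrow> real \<Rightarrow> real \<Rightarrow> complex" where
  "band \<epsilon> z x = tri (\<epsilon> * x) * cis (z * x)"

lemma band_continuous: "continuous_on A (band \<epsilon> z)"
  unfolding band_def[abs_def]
  by (intro continuous_intros continuous_on_compose2[OF tri_continuous[of UNIV]]) auto

lemma norm_band_le:
  assumes "\<epsilon> > 0"
  shows "norm (band \<epsilon> z x) \<le> 6 * (1 + 1 / \<epsilon>\<^sup>2) * (1 / (1 + x\<^sup>2))"
proof -
  have "norm (band \<epsilon> z x) \<le> 6 * (1 / (1 + (\<epsilon> * x)\<^sup>2))" using norm_tri_le[of "\<epsilon> * x"] by (simp add: band_def norm_mult)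
  also have "1 / (1 + (\<epsilon> * x)\<^sup>2) \<le> (1 + 1 / \<epsilon>\<^sup>2) * (1 / (1 + x\<^sup>2))"
  proof -
    have pos: "1 + (\<epsilon> * x)\<^sup>2 > 0" "1 + x\<^sup>2 > 0" by (auto intro: add_pos_nonneg)
    have "(1 + 1 / \<epsilon>\<^sup>2) * (1 + (\<epsilon> * x)\<^sup>2) = 1 + (\<epsilon> * x)\<^sup>2 + 1 / \<epsilon>\<^sup>2 + x\<^sup>2"
      using assms by (simp add: algebra_simps power_mult_distrib)
    then have "1 + x\<^sup>2 \<le> (1 + 1 / \<epsilon>\<^sup>2) * (1 + (\<epsilon> * x)\<^sup>2)" by (simp add: add_nonneg_nonneg)
    then show ?thesis using pos by (simp add: divide_simps mult_ac)
  qed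
  finally show ?thesis by simp
qed

lemma band_fourier: "band \<epsilon> z x = (LINT v|lborel. of_real (hat v) * cis ((\<epsilon> * v + z) * x))"
proof -
  have "band \<epsilon> z x = (LINT v|lborel. of_real (hat v) * cis (\<epsilon> * x * v) * cis (z * x))"
    by (simp add: band_def tri_def)
  also have "\<dots> = (LINT v|lborel. of_real (hat v) * cis ((\<epsilon> * v + z) * x))"
    by (intro Bochner_Integration.integral_cong) (auto simp: mult.assoc cis_mult algebra_simps)
  finally show ?thesis .
qed

text \<open>Fubini in the representation \<open>band_fourier\<close>: every frequency that carries
  weight lies where the transform of \<open>k\<close> is 1.\<close>

lemma band_reproduced:
  fixes k :: "real \<Rightarrow> real"
  assumes k: "integrable lborel k" and four: "\<And>u. \<bar>u\<bar> \<le> e \<Longrightarrow> (LINT x|lborel. of_real (k x) * cis (u * x)) = 1"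
    and e: "\<epsilon> > 0" "\<epsilon> + \<bar>z\<bar> \<le> e"
  shows "(LINT x|lborel. of_real (k x) * band \<epsilon> z (c - x)) = band \<epsilon> z c"
proof -
  have [measurable]: "k \<in> borel_measurable borel" using borel_measurable_integrable[OF k] by simp
  define f where "f x v = of_real (k x) * (of_real (hat v) * cis ((\<epsilon> * v + z) * (c - x)))" for x v
  have cism: "cis \<in> borel_measurable borel" by (intro borel_measurable_continuous_onI continuous_intros)
  have meas: "case_prod f \<in> borel_measurable (lborel \<Otimes>\<^sub>M lborel)"
  proof -
    have "(\<lambda>(x, v). (\<epsilon> * v + z) * (c - x)) \<in> borel_measurable (lborel \<Otimes>\<^sub>M lborel)" by measurable
    from measurable_compose[OF this cism]
    have [measurable]: "(\<lambda>p. cis ((\<epsilon> * snd p + z) * (c - fst p))) \<in> borel_measurable (lborel \<Otimes>\<^sub>M lborel)"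
      by (simp add: case_prod_unfold)
    show ?thesis unfolding f_def case_prod_unfold by measurable
  qed
  have normf: "norm (f x v) = \<bar>k x\<bar> * hat v" for x v
    using hat_bounds by (simp add: f_def norm_mult abs_of_nonneg)
  have "integrable (lborel \<Otimes>\<^sub>M lborel) (case_prod f)"
  proof (rule lborel_pair.Fubini_integrable[OF meas])
    show "integrable lborel (\<lambda>x. LINT v|lborel. norm (case (x, v) of (x, v) \<Rightarrow> f x v))"
      using k by (simp add: normf)
    show "AE x in lborel. integrable lborel (\<lambda>v. case (x, v) of (x, v) \<Rightarrow> f x v)"
    proof (rule AE_I2)
      fix x
      have "(\<lambda>v. f x v) \<in> borel_measurable lborel"
        using measurable_compose[OF measurable_Pair1' meas, of x] by simp
      then show "integrable lborel (\<lambda>v. case (x, v) of (x, v) \<Rightarrow> f x v)"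
        by (intro Bochner_Integration.integrable_bound[OF integrable_mult_right[OF hat_integrable, of "k x"]])
           (auto simp: normf abs_mult intro!: AE_I2 mult_left_mono)
    qed
  qed
  from lborel_pair.Fubini_integral[OF this]
  have "(LINT x|lborel. LINT v|lborel. f x v) = (LINT v|lborel. LINT x|lborel. f x v)" by simp
  also have "(LINT x|lborel. LINT v|lborel. f x v) = (LINT x|lborel. of_real (k x) * band \<epsilon> z (c - x))"
    by (simp add: f_def band_fourier)
  also have "(LINT v|lborel. LINT x|lborel. f x v) = (LINT v|lborel. of_real (hat v) * cis ((\<epsilon> * v + z) * c))"
  proof (intro Bochner_Integration.integral_cong refl)
    fix v
    have "(LINT x|lborel. f x v) = (LINT x|lborel. (of_real (hat v) * cis ((\<epsilon> * v + z) * c)) * (of_real (k x) * cis (- (\<epsilon> * v + z) * x)))"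
    proof (intro Bochner_Integration.integral_cong refl)
      fix x
      have "cis ((\<epsilon> * v + z) * (c - x)) = cis ((\<epsilon> * v + z) * c) * cis (- (\<epsilon> * v + z) * x)"
        by (simp add: cis_mult algebra_simps)
      then show "f x v = (of_real (hat v) * cis ((\<epsilon> * v + z) * c)) * (of_real (k x) * cis (- (\<epsilon> * v + z) * x))"
        by (simp add: f_def mult_ac)
    qed
    also have "\<dots> = (of_real (hat v) * cis ((\<epsilon> * v + z) * c)) * (LINT x|lborel. of_real (k x) * cis (- (\<epsilon> * v + z) * x))"
      by (rule Bochner_Integration.integral_mult_right_zero)
    also have "\<dots> = of_real (hat v) * cis ((\<epsilon> * v + z) * c)"
    proof (cases "\<bar>v\<bar> \<le> 1")
      case True
      then have "\<bar>\<epsilon> * v\<bar> \<le> \<epsilon>" using e(1) by (simp add: abs_mult mult_left_le)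
      then have "\<bar>- (\<epsilon> * v + z)\<bar> \<le> e" using e(2) by linarith
      then show ?thesis using four by simp
    qed (simp add: hat_def)
    finally show "(LINT x|lborel. f x v) = of_real (hat v) * cis ((\<epsilon> * v + z) * c)" .
  qed
  also have "\<dots> = band \<epsilon> z c" by (rule band_fourier[symmetric])
  finally show ?thesis .
qed

text \<open>Each term is spread over \<open>{s..<s+\<rho>}\<close>. These intervals are disjoint,
  and within one of them \<open>1 / (1 + x\<^sup>2)\<close> changes by a factor of at most
  \<open>2 * (1 + \<rho>\<^sup>2)\<close>.\<close>

lemma separated_sum_le:
  fixes J :: "real set"
  assumes J: "finite J" and \<rho>: "\<rho> > 0" and sep: "\<And>x y. x \<in> J \<Longrightarrow> y \<in> J \<Longrightarrow> x \<noteq> y \<Longrightarrow> \<bar>x - y\<bar> \<ge> \<rho>"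
    and R: "\<And>s. s \<in> J \<Longrightarrow> \<bar>s\<bar> \<ge> R"
  shows "(\<Sum>s\<in>J. 1 / (1 + s\<^sup>2)) \<le> 2 * (1 + \<rho>\<^sup>2) / \<rho> * (LINT x|lborel. 1 / (1 + x\<^sup>2) * indicator {x. \<bar>x\<bar> \<ge> R - \<rho>} x)"
proof -
  define I where "I s = indicat_real {s..<s+\<rho>}" for s :: real
  have I_int: "integrable lborel (I s)" for s
    unfolding I_def using \<rho> by (intro integrable_real_indicator) auto
  have mi: "integrable lborel (\<lambda>x::real. 1 / (1 + x\<^sup>2) * indicator {x. \<bar>x\<bar> \<ge> R - \<rho>} x)"
    by (rule integrable_real_mult_indicator) (auto simp del: times_divide_eq_left)
  have "\<rho> * (\<Sum>s\<in>J. 1 / (1 + s\<^sup>2)) = (\<Sum>s\<in>J. LINT x|lborel. 1 / (1 + s\<^sup>2) * I s x)"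
    unfolding sum_distrib_left using \<rho> by (intro sum.cong refl) (simp add: I_def)
  also have "\<dots> = (LINT x|lborel. (\<Sum>s\<in>J. 1 / (1 + s\<^sup>2) * I s x))"
    by (intro Bochner_Integration.integral_sum[symmetric] integrable_mult_right I_int)
  also have "\<dots> \<le> (LINT x|lborel. 2 * (1 + \<rho>\<^sup>2) * (1 / (1 + x\<^sup>2) * indicator {x. \<bar>x\<bar> \<ge> R - \<rho>} x))"
  proof (rule integral_mono)
    show "integrable lborel (\<lambda>x. \<Sum>s\<in>J. 1 / (1 + s\<^sup>2) * I s x)"
      by (intro Bochner_Integration.integrable_sum integrable_mult_right I_int)
    show "integrable lborel (\<lambda>x::real. 2 * (1 + \<rho>\<^sup>2) * (1 / (1 + x\<^sup>2) * indicator {x. \<bar>x\<bar> \<ge> R - \<rho>} x))"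
      by (intro integrable_mult_right mi)
    fix x :: real
    show "(\<Sum>s\<in>J. 1 / (1 + s\<^sup>2) * I s x) \<le> 2 * (1 + \<rho>\<^sup>2) * (1 / (1 + x\<^sup>2) * indicator {x. \<bar>x\<bar> \<ge> R - \<rho>} x)"
    proof (cases "\<exists>s\<in>J. x \<in> {s..<s+\<rho>}")
      case True
      then obtain s where s: "s \<in> J" "s \<le> x" "x < s + \<rho>" by auto
      have other: "I s' x = 0" if "s' \<in> J" "s' \<noteq> s" for s'
        using sep[OF that(1) s(1) that(2)] s by (auto simp: I_def indicator_def)
      have "(\<Sum>s\<in>J. 1 / (1 + s\<^sup>2) * I s x) = 1 / (1 + s\<^sup>2) * I s x + (\<Sum>s\<in>J - {s}. 1 / (1 + s\<^sup>2) * I s x)"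
        by (rule sum.remove[OF J s(1)])
      also have "(\<Sum>s\<in>J - {s}. 1 / (1 + s\<^sup>2) * I s x) = 0" using other by (intro sum.neutral) auto
      also have "1 / (1 + s\<^sup>2) * I s x = 1 / (1 + (x - (x - s))\<^sup>2)" using s by (simp add: I_def)
      also have "\<dots> \<le> 2 * (1 + (x - s)\<^sup>2) / (1 + x\<^sup>2)" by (rule inverse_1_plus_sq_shift)
      also have "\<dots> \<le> 2 * (1 + \<rho>\<^sup>2) / (1 + x\<^sup>2)"
        using s \<rho> by (intro divide_right_mono mult_left_mono add_left_mono power_mono) (auto intro: add_nonneg_nonneg)
      also have "\<dots> = 2 * (1 + \<rho>\<^sup>2) * (1 / (1 + x\<^sup>2) * indicator {x. \<bar>x\<bar> \<ge> R - \<rho>} x)"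
      proof -
        have "\<bar>x\<bar> \<ge> R - \<rho>" using R[OF s(1)] s by linarith
        then show ?thesis by simp
      qed
      finally show ?thesis by simp
    next
      case False
      then have "(\<Sum>s\<in>J. 1 / (1 + s\<^sup>2) * I s x) = 0" by (intro sum.neutral) (auto simp: I_def)
      then show ?thesis by (simp add: add_nonneg_nonneg)
    qed
  qed
  also have "\<dots> = 2 * (1 + \<rho>\<^sup>2) * (LINT x|lborel. 1 / (1 + x\<^sup>2) * indicator {x. \<bar>x\<bar> \<ge> R - \<rho>} x)"
    by (rule Bochner_Integration.integral_mult_right_zero)
  finally show ?thesis using \<rho> by (simp add: field_simps)
qed

lemma separated_sum_tail:
  assumes \<rho>: "\<rho> > 0" and \<delta>: "\<delta> > 0"
  obtains R where "\<And>J :: real set. finite J \<Longrightarrow> (\<And>x y. x \<in> J \<Longrightarrow> y \<in> J \<Longrightarrow> x \<noteq> y \<Longrightarrow> \<bar>x - y\<bar> \<ge> \<rho>) \<Longrightarrow>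
    (\<And>s. s \<in> J \<Longrightarrow> \<bar>s\<bar> \<ge> R) \<Longrightarrow> (\<Sum>s\<in>J. 1 / (1 + s\<^sup>2)) < \<delta>"
proof -
  have "(\<lambda>m. LINT x|lborel. 1 / (1 + x\<^sup>2) * indicator {x. \<bar>x\<bar> \<ge> real m} x) \<longlonglongrightarrow> 0"
    by (rule integral_tail_tendsto_0[OF integrable_inverse_1_plus_sq])
  then have "(\<lambda>m. 2 * (1 + \<rho>\<^sup>2) / \<rho> * (LINT x|lborel. 1 / (1 + x\<^sup>2) * indicator {x. \<bar>x\<bar> \<ge> real m} x)) \<longlonglongrightarrow> 2 * (1 + \<rho>\<^sup>2) / \<rho> * 0"
    by (intro tendsto_intros) simp
  then have "\<forall>\<^sub>F m in sequentially. 2 * (1 + \<rho>\<^sup>2) / \<rho> * (LINT x|lborel. 1 / (1 + x\<^sup>2) * indicator {x. \<bar>x\<bar> \<ge> real m} x) < \<delta>"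
    using \<delta> by (intro order_tendstoD(2)[where y = 0]) auto
  then obtain m where m: "2 * (1 + \<rho>\<^sup>2) / \<rho> * (LINT x|lborel. 1 / (1 + x\<^sup>2) * indicator {x. \<bar>x\<bar> \<ge> real m} x) < \<delta>"
    using eventually_happens'[OF sequentially_bot] by blast
  show thesis
  proof (rule that[of "real m + \<rho>"])
    fix J :: "real set" assume "finite J" "\<And>x y. x \<in> J \<Longrightarrow> y \<in> J \<Longrightarrow> x \<noteq> y \<Longrightarrow> \<bar>x - y\<bar> \<ge> \<rho>" "\<And>s. s \<in> J \<Longrightarrow> \<bar>s\<bar> \<ge> real m + \<rho>"
    from separated_sum_le[OF this(1) \<rho> this(2,3)] m show "(\<Sum>s\<in>J. 1 / (1 + s\<^sup>2)) < \<delta>" by simp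
  qed
qed

text \<open>
  The sum extends holomorphically to the upper half plane and vanishes on a boundary interval;
  extending it by zero across that interval shows that it vanishes identically, and its leading
  coefficient is read off along the imaginary axis.
\<close>

lemma one_sided_exponential_sum:
  fixes c :: "real \<Rightarrow> complex"
  assumes summ: "(\<lambda>x. norm (c x)) summable_on D" and d0: "d0 \<in> D" "d0 \<ge> 0" and gap: "\<gamma> > 0"
    and D: "\<And>x. x \<in> D \<Longrightarrow> x \<noteq> d0 \<Longrightarrow> x \<ge> d0 + \<gamma>"
    and r: "r > 0" and zero: "\<And>z. \<bar>z\<bar> < r \<Longrightarrow> ((\<lambda>x. c x * cis (z * x)) has_sum 0) D"
  shows "c d0 = 0"
proof -
  define f where "f x z = c x * exp (\<i> * z * of_real x)" for x z
  define N where "N z = (\<Sum>\<^sub>\<infinity>x\<in>D. f x z)" for z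
  define H where "H = {z. Im z \<ge> 0}"
  have Dpos: "x \<ge> 0" if "x \<in> D" for x using D[OF that] d0(2) gap by (cases "x = d0") auto
  have norm_f: "norm (f x z) = norm (c x) * exp (- (Im z * x))" for x z
    by (simp add: f_def norm_mult)
  have f_le: "norm (f x z) \<le> norm (c x)" if "x \<in> D" "z \<in> H" for x z
    using that Dpos[OF that(1)] by (auto simp: norm_f H_def intro!: mult_left_le)
  \<comment> \<open>\<open>D\<close> lies in the nonnegative reals, so the exponentials have modulus
    at most 1 on the closed upper half plane and the M-test is uniform up to the boundary.\<close>
  have ulim: "uniform_limit H (\<lambda>X z. \<Sum>x\<in>X. f x z) N (finite_subsets_at_top D)"
    unfolding N_def using f_le summ by (rule Weierstrass_m_test_general)
  have fhol: "(\<lambda>z. \<Sum>x\<in>X. f x z) holomorphic_on A" for X A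
    unfolding f_def by (intro holomorphic_intros)
  have N_cont: "continuous_on H N"
    by (rule uniform_limit_theorem[OF _ ulim]) (auto intro!: always_eventually holomorphic_on_imp_continuous_on fhol)
  have N_hol: "N holomorphic_on {z. Im z > 0}"
  proof (rule analytic_imp_holomorphic, unfold analytic_on_def, intro ballI)
    fix z assume z: "z \<in> {z. Im z > 0}"
    have sub: "cball z (Im z / 2) \<subseteq> H"
    proof
      fix w assume "w \<in> cball z (Im z / 2)"
      then have "\<bar>Im (z - w)\<bar> \<le> Im z / 2" using abs_Im_le_cmod[of "z - w"] by (simp add: dist_norm)
      then have "Im w \<ge> 0" using z by (simp only: minus_complex.sel mem_Collect_eq)
      then show "w \<in> H" by (simp add: H_def)
    qed
    have "N holomorphic_on ball z (Im z / 2)"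
      using holomorphic_uniform_limit[OF _ uniform_limit_on_subset[OF ulim sub]] fhol
      by (auto intro!: always_eventually holomorphic_on_imp_continuous_on)
    then show "\<exists>e>0. N holomorphic_on ball z e" using z by (intro exI[of _ "Im z / 2"]) auto
  qed
  have N_real: "N z = 0" if "Im z = 0" "norm z < r" for z
  proof -
    have z: "z = of_real (Re z)" using that by (simp add: complex_eq_iff)
    then have "\<bar>Re z\<bar> < r" using that by (metis norm_of_real)
    from zero[OF this] have "((\<lambda>x. f x z) has_sum 0) D"
      by (subst z) (simp add: f_def cis_conv_exp mult_ac)
    then show ?thesis by (simp add: N_def infsumI)
  qed
  define F where "F z = (if Im z \<ge> 0 then N z else 0)" for z
  have F_cont: "continuous_on (ball 0 r) F"
  proof -
    have "continuous_on ({z. 0 \<le> Im z} \<inter> ball 0 r \<union> {z. Im z \<le> 0} \<inter> ball 0 r) F"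
      unfolding F_def
    proof (rule continuous_on_cases_local)
      show "closedin (top_of_set ({z. 0 \<le> Im z} \<inter> ball 0 r \<union> {z. Im z \<le> 0} \<inter> ball 0 r)) ({z. 0 \<le> Im z} \<inter> ball 0 r)"
        by (auto simp: closedin_closed intro!: exI[of _ "{z. 0 \<le> Im z}"] closed_halfspace_Im_ge)
      show "closedin (top_of_set ({z. 0 \<le> Im z} \<inter> ball 0 r \<union> {z. Im z \<le> 0} \<inter> ball 0 r)) ({z. Im z \<le> 0} \<inter> ball 0 r)"
        by (auto simp: closedin_closed intro!: exI[of _ "{z. Im z \<le> 0}"] closed_halfspace_Im_le)
      show "continuous_on ({z. 0 \<le> Im z} \<inter> ball 0 r) N"
        by (rule continuous_on_subset[OF N_cont]) (auto simp: H_def)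
      show "N z = 0" if "z \<in> {z. 0 \<le> Im z} \<inter> ball 0 r \<and> \<not> 0 \<le> Im z \<or> z \<in> {z. Im z \<le> 0} \<inter> ball 0 r \<and> 0 \<le> Im z" for z
        using that by (intro N_real) auto
    qed auto
    moreover have "{z. 0 \<le> Im z} \<inter> ball 0 r \<union> {z. Im z \<le> 0} \<inter> ball 0 r = ball 0 r" by auto
    ultimately show ?thesis by simp
  qed
  \<comment> \<open>A continuous function that is holomorphic on both sides of a line is holomorphic
    across it.\<close>
  have "F holomorphic_on ball 0 r"
  proof (rule holomorphic_on_paste_across_line[where d = \<i> and k = 0])
    show "F holomorphic_on ball 0 r \<inter> {z. \<i> \<bullet> z < 0}"
      by (rule holomorphic_transform[of "\<lambda>_. 0"]) (auto simp: F_def)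
    show "F holomorphic_on ball 0 r \<inter> {z. 0 < \<i> \<bullet> z}"
      by (rule holomorphic_transform[OF holomorphic_on_subset[OF N_hol]]) (auto simp: F_def)
  qed (auto intro: F_cont)
  have F_zero: "F z = 0" if "z \<in> ball 0 r" for z
  proof (rule analytic_continuation_open[where f = F and z = z and s = "ball 0 r \<inter> {z. Im z < 0}" and g = "\<lambda>_. 0" and s' = "ball 0 r"])
    have "- \<i> * of_real (r / 2) \<in> ball 0 r \<inter> {z. Im z < 0}" using r by (simp add: norm_mult)
    then show "ball 0 r \<inter> {z. Im z < 0} \<noteq> {}" by blast
    show "open (ball 0 r \<inter> {z. Im z < 0})" by (intro open_Int open_ball open_halfspace_Im_lt)
  qed (use that \<open>F holomorphic_on ball 0 r\<close> in \<open>auto simp: F_def\<close>)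
  have N_zero: "N z = 0" if "Im z > 0" for z
  proof (rule analytic_continuation_open[where f = N and z = z and s = "ball 0 r \<inter> {z. Im z > 0}" and g = "\<lambda>_. 0" and s' = "{z. Im z > 0}"])
    have "\<i> * of_real (r / 2) \<in> ball 0 r \<inter> {z. Im z > 0}" using r by (simp add: norm_mult)
    then show "ball 0 r \<inter> {z. Im z > 0} \<noteq> {}" by blast
    show "open (ball 0 r \<inter> {z. Im z > 0})" by (intro open_Int open_ball open_halfspace_Im_gt)
    show "open {z. Im z > 0}" by (rule open_halfspace_Im_gt)
    show "connected {z. Im z > 0}" by (intro convex_connected convex_halfspace_Im_gt)
    show "N z = 0" if "z \<in> ball 0 r \<inter> {z. Im z > 0}" for z using F_zero[of z] that by (simp add: F_def)
  qed (use that N_hol in auto)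
  define K where "K = (\<Sum>\<^sub>\<infinity>x\<in>D - {d0}. norm (c x))"
  have summ': "(\<lambda>x. norm (c x)) summable_on D - {d0}" by (rule summable_on_subset_banach[OF summ]) auto
  \<comment> \<open>On the imaginary axis the term of \<open>d0\<close> must cancel all the others,
    which are smaller by at least the factor \<open>exp (- (y * \<gamma>))\<close>.\<close>
  have bound: "norm (c d0) \<le> exp (- (y * \<gamma>)) * K" if y: "y > 0" for y
  proof -
    define z where "z = \<i> * complex_of_real y"
    have z: "Im z = y" by (simp add: z_def)
    have "(\<lambda>x. norm (f x z)) summable_on D - {d0}"
      by (rule summable_on_comparison_test[OF summ']) (use f_le y z in \<open>auto simp: H_def\<close>)
    then have fs: "(\<lambda>x. f x z) summable_on D - {d0}" by (rule abs_summable_summable)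
    define v where "v = (\<Sum>\<^sub>\<infinity>x\<in>D - {d0}. f x z)"
    have v: "((\<lambda>x. f x z) has_sum v) (D - {d0})" unfolding v_def using fs by (rule has_sum_infsum)
    have "((\<lambda>x. f x z) has_sum (f d0 z + v)) (insert d0 (D - {d0}))" by (rule has_sum_insert[OF _ v]) simp
    then have "((\<lambda>x. f x z) has_sum (f d0 z + v)) D" using d0(1) by (simp add: insert_absorb)
    then have "f d0 z + v = N z" by (simp add: N_def infsumI)
    then have "f d0 z = - v" using N_zero[of z] z y by (simp add: eq_neg_iff_add_eq_0)
    then have "norm (f d0 z) = norm v" by simp
    also have "norm v \<le> exp (- (y * (d0 + \<gamma>))) * K"
    proof (rule norm_infsum_le[OF v])
      show "((\<lambda>x. exp (- (y * (d0 + \<gamma>))) * norm (c x)) has_sum (exp (- (y * (d0 + \<gamma>))) * K)) (D - {d0})"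
        unfolding K_def by (intro has_sum_cmult_right has_sum_infsum summ')
      fix x assume "x \<in> D - {d0}"
      then have "y * (d0 + \<gamma>) \<le> y * x" using D[of x] y by (intro mult_left_mono) auto
      then show "norm (f x z) \<le> exp (- (y * (d0 + \<gamma>))) * norm (c x)"
        unfolding norm_f z by (subst mult.commute) (intro mult_right_mono, auto)
    qed
    also have "exp (- (y * (d0 + \<gamma>))) = exp (- (y * \<gamma>)) * exp (- (y * d0))"
      by (simp add: algebra_simps flip: exp_add)
    finally have "norm (c d0) * exp (- (y * d0)) \<le> exp (- (y * \<gamma>)) * K * exp (- (y * d0))"
      unfolding norm_f z by (simp only: mult_ac)
    then show ?thesis by (rule mult_right_le_imp_le) simp
  qed
  have "((\<lambda>n. exp (- (real (Suc n) * \<gamma>)) * K) \<longlonglongrightarrow> 0 * K)"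
  proof (intro tendsto_mult tendsto_const)
    have "filterlim (\<lambda>n. real (Suc n) * \<gamma>) at_top sequentially"
      using gap by (intro filterlim_at_top_mult_tendsto_pos[OF tendsto_const] filterlim_compose[OF filterlim_real_sequentially filterlim_Suc])
    then show "(\<lambda>n. exp (- (real (Suc n) * \<gamma>))) \<longlonglongrightarrow> 0"
      by (intro filterlim_compose[OF exp_at_bot]) (simp add: filterlim_uminus_at_top[symmetric] filterlim_uminus_at_bot)
  qed
  then have "norm (c d0) \<le> 0 * K"
    by (rule LIMSEQ_le_const) (use bound in auto)
  then show ?thesis by simp
qed

text \<open>Modulation by \<open>z\<close> does not change absolute values, so one bound serves all
  \<open>z\<close>.\<close>

lemma band_sum_le:
  assumes \<epsilon>: "\<epsilon> > 0" and \<rho>: "\<rho> > 0"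
  obtains Q where "\<And>J z. finite J \<Longrightarrow> (\<And>x y. x \<in> J \<Longrightarrow> y \<in> J \<Longrightarrow> x \<noteq> y \<Longrightarrow> \<bar>x - y\<bar> \<ge> \<rho>) \<Longrightarrow> (\<Sum>s\<in>J. norm (band \<epsilon> z s)) \<le> Q"
proof -
  let ?K = "6 * (1 + 1 / \<epsilon>\<^sup>2)"
  let ?C = "2 * (1 + \<rho>\<^sup>2) / \<rho> * (LINT x|lborel. 1 / (1 + x\<^sup>2) * indicator {x. \<bar>x\<bar> \<ge> 0 - \<rho>} x)"
  show thesis
  proof (rule that[of "?K * ?C"])
    fix J z assume J: "finite J" "\<And>x y. x \<in> J \<Longrightarrow> y \<in> J \<Longrightarrow> x \<noteq> y \<Longrightarrow> \<bar>x - y\<bar> \<ge> \<rho>"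
    have "(\<Sum>s\<in>J. norm (band \<epsilon> z s)) \<le> (\<Sum>s\<in>J. ?K * (1 / (1 + s\<^sup>2)))" by (intro sum_mono norm_band_le \<epsilon>)
    also have "\<dots> = ?K * (\<Sum>s\<in>J. 1 / (1 + s\<^sup>2))" by (rule sum_distrib_left[symmetric])
    also have "\<dots> \<le> ?K * ?C"
      by (intro mult_left_mono separated_sum_le[OF J(1) \<rho> J(2)]) (auto intro: add_nonneg_nonneg)
    finally show "(\<Sum>s\<in>J. norm (band \<epsilon> z s)) \<le> ?K * ?C" .
  qed
qed

text \<open>The radius is uniform over all \<open>\<rho>\<close>-separated sets, which lets band
  sums pass to limits of translates.\<close>

lemma band_sum_tail:
  assumes \<epsilon>: "\<epsilon> > 0" and \<rho>: "\<rho> > 0" and \<delta>: "\<delta> > 0"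
  obtains R where "\<And>J z. finite J \<Longrightarrow> (\<And>x y. x \<in> J \<Longrightarrow> y \<in> J \<Longrightarrow> x \<noteq> y \<Longrightarrow> \<bar>x - y\<bar> \<ge> \<rho>) \<Longrightarrow>
    (\<And>s. s \<in> J \<Longrightarrow> \<bar>s\<bar> \<ge> R) \<Longrightarrow> (\<Sum>s\<in>J. norm (band \<epsilon> z s)) \<le> \<delta>"
proof -
  let ?K = "6 * (1 + 1 / \<epsilon>\<^sup>2)"
  have K: "?K > 0" using \<epsilon> by (simp add: add_pos_nonneg)
  obtain R where R: "\<And>J :: real set. finite J \<Longrightarrow> (\<And>x y. x \<in> J \<Longrightarrow> y \<in> J \<Longrightarrow> x \<noteq> y \<Longrightarrow> \<bar>x - y\<bar> \<ge> \<rho>) \<Longrightarrow>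
      (\<And>s. s \<in> J \<Longrightarrow> \<bar>s\<bar> \<ge> R) \<Longrightarrow> (\<Sum>s\<in>J. 1 / (1 + s\<^sup>2)) < \<delta> / ?K"
    by (rule separated_sum_tail[OF \<rho>, of "\<delta> / ?K"]) (use \<delta> K in \<open>simp, blast\<close>)
  show thesis
  proof (rule that[of R])
    fix J z assume J: "finite J" "\<And>x y. x \<in> J \<Longrightarrow> y \<in> J \<Longrightarrow> x \<noteq> y \<Longrightarrow> \<bar>x - y\<bar> \<ge> \<rho>" "\<And>s. s \<in> J \<Longrightarrow> \<bar>s\<bar> \<ge> R"
    have "(\<Sum>s\<in>J. norm (band \<epsilon> z s)) \<le> (\<Sum>s\<in>J. ?K * (1 / (1 + s\<^sup>2)))" by (intro sum_mono norm_band_le \<epsilon>)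
    also have "\<dots> = ?K * (\<Sum>s\<in>J. 1 / (1 + s\<^sup>2))" by (rule sum_distrib_left[symmetric])
    also have "\<dots> \<le> ?K * (\<delta> / ?K)"
      using R[OF J] K by (intro mult_left_mono) auto
    also have "\<dots> = \<delta>" using K by simp
    finally show "(\<Sum>s\<in>J. norm (band \<epsilon> z s)) \<le> \<delta>" .
  qed
qed

text \<open>
  The difference of the comb and its translate is band limited and is annihilated by \<open>W\<close>.
\<close>

lemma smoothed_comb_constant:
  fixes S :: "real set" and W :: "real \<Rightarrow> real"
  assumes W: "integrable lborel W" and cont: "continuous_on UNIV W" and nonneg: "\<And>x. W x \<ge> 0"
    and tile: "\<And>y. ((\<lambda>s. W (s - y)) has_sum 1) S"
    and S: "countable S" and \<rho>: "\<rho> > 0" and sep: "\<And>x y. x \<in> S \<Longrightarrow> y \<in> S \<Longrightarrow> x \<noteq> y \<Longrightarrow> \<bar>x - y\<bar> \<ge> \<rho>"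
  obtains e where "e > 0" "\<forall>\<epsilon> z. \<epsilon> > 0 \<longrightarrow> \<epsilon> + \<bar>z\<bar> \<le> e \<longrightarrow> (\<exists>c. \<forall>y. ((\<lambda>s. band \<epsilon> z (s - y)) has_sum c) S)"
proof -
  have [measurable]: "W \<in> borel_measurable borel" using borel_measurable_integrable[OF W] by simp
  have "\<exists>x. W x \<noteq> 0"
  proof (rule ccontr)
    assume "\<not> ?thesis"
    then have "((\<lambda>s. W (s - 0)) has_sum 0) S" by (simp add: has_sum_0)
    then show False using tile[of 0] has_sum_unique by (metis zero_neq_one)
  qed
  then obtain x0 where x0: "W x0 > 0" using nonneg by (metis less_eq_real_def)
  have pos: "(LINT x|lborel. W x) > 0"
  proof -
    have "\<exists>d>0. \<forall>x. dist x x0 < d \<longrightarrow> dist (W x) (W x0) < W x0 / 2"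
      using cont x0 unfolding continuous_on_iff by (metis UNIV_I half_gt_zero)
    then obtain d where d: "d > 0" "\<And>x. \<bar>x - x0\<bar> < d \<Longrightarrow> \<bar>W x - W x0\<bar> < W x0 / 2" by (auto simp: dist_real_def)
    have "W x0 / 2 * indicat_real {x0 - d/2..x0 + d/2} x \<le> W x" for x
    proof (cases "x \<in> {x0 - d/2..x0 + d/2}")
      case True
      then have "\<bar>x - x0\<bar> < d" using d(1) by (auto simp: abs_less_iff)
      from d(2)[OF this] have "W x0 / 2 \<le> W x" by linarith
      then show ?thesis using True by simp
    qed (simp add: nonneg)
    then have "(LINT x|lborel. W x0 / 2 * indicat_real {x0 - d/2..x0 + d/2} x) \<le> (LINT x|lborel. W x)"
      by (intro integral_mono W integrable_mult_right integrable_indicator_Icc)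
    moreover have "(LINT x|lborel. W x0 / 2 * indicat_real {x0 - d/2..x0 + d/2} x) > 0" using x0 d(1) by simp
    ultimately show ?thesis by linarith
  qed
  obtain V :: "real \<Rightarrow> real" and C where V [measurable]: "V \<in> borel_measurable borel"
    and V_le: "\<And>x. \<bar>V x\<bar> \<le> C * (1 / (1 + x\<^sup>2))" and V_cont: "\<And>x. x \<noteq> 0 \<Longrightarrow> isCont V x"
    and V_four: "\<And>u. \<bar>u\<bar> \<le> 1 \<Longrightarrow> (LINT x|lborel. of_real (V x) * cis (u * x)) = 1"
    by (rule reproducing_kernel) blast
  obtain e where e: "e > 0" and ann: "\<forall>(D :: real \<Rightarrow> complex) Q. D \<in> borel_measurable borel \<longrightarrow> (\<forall>y. norm (D y) \<le> Q) \<longrightarrow>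
      (\<forall>y. (LINT x|lborel. of_real (e * V (e * x)) * D (y + x)) = D y) \<longrightarrow>
      (\<forall>y. (LINT x|lborel. of_real (W x) * D (y + x)) = 0) \<longrightarrow> (\<forall>y. D y = 0)"
    by (rule annihilated_slowly_varying_zero[OF W nonneg pos V V_le V_cont])
  have V_int: "integrable lborel V"
  proof (rule Bochner_Integration.integrable_bound[OF integrable_mult_right[OF integrable_inverse_1_plus_sq, of C]])
    show "AE x in lborel. norm (V x) \<le> norm (C * (1 / (1 + x\<^sup>2)))"
      using order_trans[OF V_le abs_ge_self] by (intro AE_I2) simp
  qed simp
  \<comment> \<open>Rescaling moves the flat part of the spectrum to \<open>{-e..e}\<close>.\<close>
  define k where "k x = e * V (e * x)" for x
  have k: "integrable lborel k"
    using lborel_integrable_real_affine[OF V_int, of e 0] e by (simp add: k_def[abs_def])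
  have k_four: "(LINT x|lborel. of_real (k x) * cis (u * x)) = 1" if "\<bar>u\<bar> \<le> e" for u
  proof -
    have "1 = (LINT x|lborel. of_real (V x) * cis (u / e * x))"
      using that e by (intro V_four[symmetric]) (simp add: abs_divide divide_le_eq)
    also have "\<dots> = \<bar>e\<bar> *\<^sub>R (LINT x|lborel. of_real (V (0 + e * x)) * cis (u / e * (0 + e * x)))"
      by (rule lborel_integral_real_affine) (use e in simp)
    also have "\<dots> = (LINT x|lborel. of_real (k x) * cis (u * x))"
      unfolding k_def using e by (simp add: scaleR_conv_of_real mult.assoc)
    finally show ?thesis by simp
  qed
  show thesis
  proof (rule that[OF e], intro allI impI)
    fix \<epsilon> z assume \<epsilon>: "\<epsilon> > 0" "\<epsilon> + \<bar>z\<bar> \<le> e"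
    define h where "h = band \<epsilon> z"
    have [measurable]: "h \<in> borel_measurable borel"
      unfolding h_def by (rule borel_measurable_continuous_onI[OF band_continuous])
    have h_int: "integrable lborel h"
    proof (rule Bochner_Integration.integrable_bound[OF integrable_mult_right[OF integrable_inverse_1_plus_sq, of "6 * (1 + 1 / \<epsilon>\<^sup>2)"]])
      show "AE x in lborel. norm (h x) \<le> norm (6 * (1 + 1 / \<epsilon>\<^sup>2) * (1 / (1 + x\<^sup>2)))"
        using order_trans[OF norm_band_le[OF \<epsilon>(1)] abs_ge_self] by (intro AE_I2) (simp add: h_def)
    qed simp
    obtain Q where Q: "\<And>J z. finite J \<Longrightarrow> (\<And>x y. x \<in> J \<Longrightarrow> y \<in> J \<Longrightarrow> x \<noteq> y \<Longrightarrow> \<bar>x - y\<bar> \<ge> \<rho>) \<Longrightarrow> (\<Sum>s\<in>J. norm (band \<epsilon> z s)) \<le> Q"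
      by (rule band_sum_le[OF \<epsilon>(1) \<rho>]) blast
    have h_sum: "(\<Sum>s\<in>J. norm (h (s - y))) \<le> Q" if J: "finite J" "J \<subseteq> S" for J y
    proof -
      have "(\<Sum>s\<in>J. norm (h (s - y))) = (\<Sum>s\<in>(\<lambda>s. s - y) ` J. norm (h s))"
        by (subst sum.reindex) (auto simp: inj_on_def)
      also have "\<dots> \<le> Q" unfolding h_def
      proof (rule Q)
        fix a b assume "a \<in> (\<lambda>s. s - y) ` J" "b \<in> (\<lambda>s. s - y) ` J" "a \<noteq> b"
        then obtain s s' where "a = s - y" "b = s' - y" "s \<in> S" "s' \<in> S" "s \<noteq> s'" using J(2) by auto
        then show "\<bar>a - b\<bar> \<ge> \<rho>" using sep[of s s'] by simp
      qed (use J in simp)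
      finally show ?thesis .
    qed
    have Q0: "Q \<ge> 0" using h_sum[of "{}" 0] by simp
    have abs: "(\<lambda>s. norm (h (s - y))) summable_on S" for y
      by (rule nonneg_bdd_above_summable_on) (auto intro!: bdd_aboveI2 h_sum)
    define B where "B y = (\<Sum>\<^sub>\<infinity>s\<in>S. h (s - y))" for y
    have B: "((\<lambda>s. h (s - y)) has_sum B y) S" for y
      unfolding B_def by (rule has_sum_infsum[OF abs_summable_summable[OF abs]])
    have B_le: "norm (B y) \<le> Q" for y
      using norm_has_sum_bound[OF has_sum_infsum[OF abs] B]
        has_sum_le_finite_sums[OF has_sum_infsum[OF abs] h_sum] by (meson order_trans)
    have [measurable]: "B \<in> borel_measurable borel"
      by (rule borel_measurable_has_sum[OF S _ B]) simp
    have B_int: "integrable lborel (\<lambda>x. of_real (p x) * B (y + x))" if p: "integrable lborel p" for p :: "real \<Rightarrow> real" and y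
    proof (rule Bochner_Integration.integrable_bound[OF integrable_mult_left[OF p, of Q]])
      show "(\<lambda>x. of_real (p x) * B (y + x)) \<in> borel_measurable lborel"
        using borel_measurable_integrable[OF p] by measurable
      show "AE x in lborel. norm (of_real (p x) * B (y + x)) \<le> norm (p x * Q)"
        using B_le Q0 by (auto intro!: AE_I2 mult_left_mono simp: norm_mult abs_mult)
    qed
    have B_conv: "((\<lambda>s. LINT x|lborel. of_real (p x) * h (s - y - x)) has_sum (LINT x|lborel. of_real (p x) * B (y + x))) S"
      if p: "integrable lborel p" for p :: "real \<Rightarrow> real" and y
    proof (rule has_sum_integral[OF S, where w = "\<lambda>x. \<bar>p x\<bar> * Q"])
      have [measurable]: "p \<in> borel_measurable borel" using borel_measurable_integrable[OF p] by simp
      show "(\<lambda>x. of_real (p x) * h (s - y - x)) \<in> borel_measurable borel" for s by measurable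
      show "integrable lborel (\<lambda>x. \<bar>p x\<bar> * Q)" using p by (intro integrable_mult_left integrable_abs)
      show "((\<lambda>s. of_real (p x) * h (s - y - x)) has_sum (of_real (p x) * B (y + x))) S" for x
        using has_sum_cmult_right[OF B[of "y + x"], of "of_real (p x)"] by (simp add: algebra_simps)
      fix x J assume J: "finite J" "J \<subseteq> S"
      have "(\<Sum>s\<in>J. norm (of_real (p x) * h (s - y - x))) = \<bar>p x\<bar> * (\<Sum>s\<in>J. norm (h (s - (y + x))))"
        by (simp add: norm_mult sum_distrib_left algebra_simps)
      also have "\<dots> \<le> \<bar>p x\<bar> * Q" by (intro mult_left_mono h_sum J) auto
      finally show "(\<Sum>s\<in>J. norm (of_real (p x) * h (s - y - x))) \<le> \<bar>p x\<bar> * Q" .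
    qed
    have rep: "(LINT x|lborel. of_real (k x) * B (y + x)) = B y" for y
    proof -
      have "(LINT x|lborel. of_real (k x) * h (s - y - x)) = h (s - y)" for s
        unfolding h_def by (rule band_reproduced[OF k k_four \<epsilon>])
      then show ?thesis using B_conv[OF k, of y] B[of y] has_sum_unique by auto
    qed
    \<comment> \<open>A substitution moves the shift from \<open>h\<close> to \<open>W\<close>; the
      tiling is then summed first, and the average of \<open>B\<close> no longer depends on
      \<open>y\<close>.\<close>
    have WB: "(LINT x|lborel. of_real (W x) * B (y + x)) = (LINT x|lborel. h x)" for y
    proof -
      have "((\<lambda>s. LINT u|lborel. of_real (W (s - (y + u))) * h u) has_sum (LINT u|lborel. 1 * h u)) S"
      proof (rule has_sum_integral[OF S, where w = "\<lambda>u. norm (h u)"])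
        show "((\<lambda>s. of_real (W (s - (y + u))) * h u) has_sum (1 * h u)) S" for u
          using has_sum_cmult_left[OF has_sum_of_real[OF tile[of "y + u"]], of "h u"] by simp
        fix u J assume J: "finite J" "J \<subseteq> S"
        have "(\<Sum>s\<in>J. norm (of_real (W (s - (y + u))) * h u)) = (\<Sum>s\<in>J. W (s - (y + u))) * norm (h u)"
          using nonneg by (simp add: norm_mult sum_distrib_right)
        also have "(\<Sum>s\<in>J. W (s - (y + u))) \<le> 1"
          using has_sum_mono_neutral[OF has_sum_finite[OF J(1), of "\<lambda>s. W (s - (y + u))"] tile[of "y + u"]] J nonneg by auto
        then have "(\<Sum>s\<in>J. W (s - (y + u))) * norm (h u) \<le> 1 * norm (h u)" by (intro mult_right_mono) auto
        finally show "(\<Sum>s\<in>J. norm (of_real (W (s - (y + u))) * h u)) \<le> norm (h u)" by simp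
      qed (use h_int in \<open>auto intro: integrable_norm\<close>)
      moreover have "(LINT x|lborel. of_real (W x) * h (s - y - x)) = (LINT u|lborel. of_real (W (s - (y + u))) * h u)" for s
      proof -
        have "(LINT x|lborel. of_real (W x) * h (s - y - x))
            = \<bar>-1\<bar> *\<^sub>R (LINT u|lborel. of_real (W ((s - y) + (-1) * u)) * h (s - y - ((s - y) + (-1) * u)))"
          by (rule lborel_integral_real_affine) simp
        then show ?thesis by (simp add: algebra_simps)
      qed
      ultimately show ?thesis using B_conv[OF W, of y] has_sum_unique by auto
    qed
    have const: "B y = B (y + p)" for y p
    proof -
      define D where "D y = B y - B (y + p)" for y
      have "D y = 0"
      proof (rule ann[rule_format, where Q = "2 * Q"])
        show "D \<in> borel_measurable borel" unfolding D_def[abs_def] by measurable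
        show "norm (D y) \<le> 2 * Q" for y
          using norm_triangle_ineq4[of "B y" "B (y + p)"] B_le[of y] B_le[of "y + p"] by (simp add: D_def)
        have split: "(LINT x|lborel. of_real (q x) * D (y + x))
            = (LINT x|lborel. of_real (q x) * B (y + x)) - (LINT x|lborel. of_real (q x) * B (y + p + x))"
          if q: "integrable lborel q" for q :: "real \<Rightarrow> real" and y
          using B_int[OF q, of y] B_int[OF q, of "y + p"] unfolding D_def
          by (subst Bochner_Integration.integral_diff[symmetric]) (auto simp: algebra_simps)
        show "(LINT x|lborel. of_real (e * V (e * x)) * D (y + x)) = D y" for y
          using split[OF k, of y] rep by (simp add: k_def D_def)
        show "(LINT x|lborel. of_real (W x) * D (y + x)) = 0" for y
          using split[OF W, of y] WB by simp
      qed
      then show ?thesis by (simp add: D_def)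
    qed
    show "\<exists>c. \<forall>y. ((\<lambda>s. band \<epsilon> z (s - y)) has_sum c) S"
    proof (intro exI allI)
      fix y show "((\<lambda>s. band \<epsilon> z (s - y)) has_sum B 0) S" using B[of y] const[of 0 y] by (simp add: h_def)
    qed
  qed
qed

section \<open>Periodicity of both sets\<close>

text \<open>A convergent sequence of zeros and ones is eventually constant, so limits of indicators
  decide membership from some index on.\<close>

lemma eventually_eq_limit_if_convergent:
  assumes lim: "(\<lambda>n. (if P n then 1 else 0 :: real)) \<longlonglongrightarrow> l"
  shows "\<forall>\<^sub>F n in sequentially. P n \<longleftrightarrow> (\<forall>\<^sub>F n in sequentially. P n)"
proof (cases "l > 0")
  case True
  from order_tendstoD(1)[OF lim this] have "\<forall>\<^sub>F n in sequentially. P n"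
    by (auto elim!: eventually_mono split: if_splits)
  then show ?thesis by (auto elim: eventually_mono)
next
  case False
  from order_tendstoD(2)[OF lim, of 1] False have ev: "\<forall>\<^sub>F n in sequentially. \<not> P n"
    by (auto elim!: eventually_mono split: if_splits)
  have "\<not> (\<forall>\<^sub>F n in sequentially. P n)"
  proof
    assume "\<forall>\<^sub>F n in sequentially. P n"
    with ev have "\<forall>\<^sub>F n::nat in sequentially. False" by eventually_elim simp
    then show False by simp
  qed
  then show ?thesis using ev by (auto elim: eventually_mono)
qed

text \<open>\<open>A\<close> is the limit of translates of \<open>S\<close> inside the locally
  finite set \<open>\<Delta>\<close>. Tails of band sums are uniformly small over separated sets, so
  the comb identity survives the limit.\<close>

lemma comb_limit:
  fixes S \<Delta> A :: "real set" and a :: "nat \<Rightarrow> real"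
  assumes \<rho>: "\<rho> > 0" and sep: "\<And>x y. x \<in> S \<Longrightarrow> y \<in> S \<Longrightarrow> x \<noteq> y \<Longrightarrow> \<bar>x - y\<bar> \<ge> \<rho>"
    and \<epsilon>: "\<epsilon> > 0" and comb: "\<And>y. ((\<lambda>s. band \<epsilon> z (s - y)) has_sum c) S"
    and fin: "\<And>r. finite (\<Delta> \<inter> {-r..r})" and sub: "\<And>n x. a n + x \<in> S \<Longrightarrow> x \<in> \<Delta>" and A: "A \<subseteq> \<Delta>"
    and lim: "\<And>x. x \<in> \<Delta> \<Longrightarrow> \<forall>\<^sub>F n in sequentially. a n + x \<in> S \<longleftrightarrow> x \<in> A"
  shows "(\<lambda>x. norm (band \<epsilon> z x)) summable_on A" "(band \<epsilon> z has_sum c) A"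
proof -
  \<comment> \<open>Two points of \<open>A\<close> occur together in a translate of \<open>S\<close>
    and inherit its separation.\<close>
  have sepA: "\<bar>x - y\<bar> \<ge> \<rho>" if xy: "x \<in> A" "y \<in> A" "x \<noteq> y" for x y
  proof -
    have "\<forall>\<^sub>F n in sequentially. a n + x \<in> S \<and> a n + y \<in> S"
    proof -
      have "x \<in> \<Delta>" "y \<in> \<Delta>" using A xy by auto
      from eventually_conj[OF lim[OF this(1)] lim[OF this(2)]] show ?thesis
        by (rule eventually_mono) (use xy in auto)
    qed
    then obtain n where "a n + x \<in> S" "a n + y \<in> S" using eventually_happens'[OF sequentially_bot] by blast
    then show ?thesis using sep[of "a n + x" "a n + y"] xy(3) by simp
  qed
  obtain Q where Q: "\<And>J z. finite J \<Longrightarrow> (\<And>x y. x \<in> J \<Longrightarrow> y \<in> J \<Longrightarrow> x \<noteq> y \<Longrightarrow> \<bar>x - y\<bar> \<ge> \<rho>) \<Longrightarrow> (\<Sum>s\<in>J. norm (band \<epsilon> z s)) \<le> Q"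
    by (rule band_sum_le[OF \<epsilon> \<rho>]) blast
  show abs: "(\<lambda>x. norm (band \<epsilon> z x)) summable_on A"
  proof (rule nonneg_bdd_above_summable_on)
    show "bdd_above (sum (\<lambda>x. norm (band \<epsilon> z x)) ` {J. J \<subseteq> A \<and> finite J})"
    proof (rule bdd_aboveI2)
      fix J assume "J \<in> {J. J \<subseteq> A \<and> finite J}"
      then show "(\<Sum>x\<in>J. norm (band \<epsilon> z x)) \<le> Q" using sepA by (intro Q) auto
    qed
  qed simp
  define v where "v = (\<Sum>\<^sub>\<infinity>x\<in>A. band \<epsilon> z x)"
  have v: "(band \<epsilon> z has_sum v) A" unfolding v_def by (rule has_sum_infsum[OF abs_summable_summable[OF abs]])
  have key: "norm (v - c) \<le> 2 * \<delta>" if \<delta>: "\<delta> > 0" for \<delta>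
  proof -
    obtain R where R: "\<And>J z. finite J \<Longrightarrow> (\<And>x y. x \<in> J \<Longrightarrow> y \<in> J \<Longrightarrow> x \<noteq> y \<Longrightarrow> \<bar>x - y\<bar> \<ge> \<rho>) \<Longrightarrow>
        (\<And>s. s \<in> J \<Longrightarrow> \<bar>s\<bar> \<ge> R) \<Longrightarrow> (\<Sum>s\<in>J. norm (band \<epsilon> z s)) \<le> \<delta>"
      by (rule band_sum_tail[OF \<epsilon> \<rho> \<delta>]) blast
    have tail: "norm (w - (\<Sum>x\<in>X \<inter> {-R..R}. band \<epsilon> z x)) \<le> \<delta>"
      if w: "(band \<epsilon> z has_sum w) X" and X: "X \<subseteq> \<Delta>" "\<And>x y. x \<in> X \<Longrightarrow> y \<in> X \<Longrightarrow> x \<noteq> y \<Longrightarrow> \<bar>x - y\<bar> \<ge> \<rho>" for w X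
    proof -
      have finX: "finite (X \<inter> {-R..R})" by (rule finite_subset[OF _ fin[of R]]) (use X in auto)
      have "((band \<epsilon> z) has_sum (w - (\<Sum>x\<in>X \<inter> {-R..R}. band \<epsilon> z x))) (X - X \<inter> {-R..R})"
        by (rule has_sum_Diff[OF w has_sum_finite[OF finX]]) auto
      moreover have bnd: "(\<Sum>x\<in>J. norm (band \<epsilon> z x)) \<le> \<delta>" if "finite J" "J \<subseteq> X - X \<inter> {-R..R}" for J
      proof (rule R[OF that(1)])
        show "\<bar>s\<bar> \<ge> R" if "s \<in> J" for s
        proof -
          have "s \<notin> {-R..R}" using that \<open>J \<subseteq> X - X \<inter> {-R..R}\<close> by blast
          then show ?thesis by auto
        qed
      qed (use X that in blast)
      ultimately have sum: "((band \<epsilon> z) has_sum (w - (\<Sum>x\<in>X \<inter> {-R..R}. band \<epsilon> z x))) (X - X \<inter> {-R..R})" by blast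
      have "(\<lambda>x. norm (band \<epsilon> z x)) summable_on (X - X \<inter> {-R..R})"
        by (rule nonneg_bdd_above_summable_on) (auto intro!: bdd_aboveI2 bnd)
      from has_sum_infsum[OF this]
      have "norm (w - (\<Sum>x\<in>X \<inter> {-R..R}. band \<epsilon> z x)) \<le> infsum (\<lambda>x. norm (band \<epsilon> z x)) (X - X \<inter> {-R..R})"
        "infsum (\<lambda>x. norm (band \<epsilon> z x)) (X - X \<inter> {-R..R}) \<le> \<delta>"
        by (rule norm_has_sum_bound[OF _ sum], rule has_sum_le_finite_sums[OF _ bnd])
      then show ?thesis by (rule order_trans)
    qed
    \<comment> \<open>\<open>\<Delta>\<close> has finitely many points in \<open>{-R..R}\<close>, so
      a single translate agrees with \<open>A\<close> on all of them.\<close>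
    have "\<forall>\<^sub>F n in sequentially. \<forall>x\<in>\<Delta> \<inter> {-R..R}. a n + x \<in> S \<longleftrightarrow> x \<in> A"
      using lim by (intro eventually_ball_finite fin) auto
    then obtain n where n: "\<And>x. x \<in> \<Delta> \<inter> {-R..R} \<Longrightarrow> a n + x \<in> S \<longleftrightarrow> x \<in> A"
      using eventually_happens'[OF sequentially_bot] by blast
    define X where "X = {x. a n + x \<in> S}"
    have bij: "bij_betw (\<lambda>x. a n + x) X S"
      by (rule bij_betwI[where g = "\<lambda>s. s - a n"]) (auto simp: X_def)
    have "((\<lambda>x. band \<epsilon> z (a n + x - a n)) has_sum c) X"
      using has_sum_reindex_bij_betw[OF bij, of "\<lambda>s. band \<epsilon> z (s - a n)" c] comb[of "a n"] by simp
    then have X: "(band \<epsilon> z has_sum c) X" by simp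
    have sepX: "\<bar>x - y\<bar> \<ge> \<rho>" if "x \<in> X" "y \<in> X" "x \<noteq> y" for x y
      using sep[of "a n + x" "a n + y"] that by (simp add: X_def)
    have sub': "X \<subseteq> \<Delta>" using sub by (auto simp: X_def)
    have eq: "X \<inter> {-R..R} = A \<inter> {-R..R}" using n sub' A by (auto simp: X_def)
    have "v - c = (v - (\<Sum>x\<in>A \<inter> {-R..R}. band \<epsilon> z x)) - (c - (\<Sum>x\<in>X \<inter> {-R..R}. band \<epsilon> z x))" by (simp add: eq)
    then have "norm (v - c) \<le> norm (v - (\<Sum>x\<in>A \<inter> {-R..R}. band \<epsilon> z x)) + norm (c - (\<Sum>x\<in>X \<inter> {-R..R}. band \<epsilon> z x))"
      using norm_triangle_ineq4 by metis
    moreover have "norm (v - (\<Sum>x\<in>A \<inter> {-R..R}. band \<epsilon> z x)) \<le> \<delta>" by (rule tail[OF v A]) (rule sepA)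
    moreover have "norm (c - (\<Sum>x\<in>X \<inter> {-R..R}. band \<epsilon> z x)) \<le> \<delta>" by (rule tail[OF X sub']) (rule sepX)
    ultimately show ?thesis by simp
  qed
  have "norm (v - c) \<le> 0"
  proof (rule field_le_epsilon)
    fix e :: real assume "e > 0"
    then show "norm (v - c) \<le> 0 + e" using key[of "e / 2"] by simp
  qed
  then show "(band \<epsilon> z has_sum c) A" using v by simp
qed

text \<open>
  Otherwise two limits of translates of \<open>S\<close> would agree on the left half line but not everywhere,
  and the difference of their combs is a one-sided sum.
\<close>

lemma comb_deterministic:
  fixes S :: "real set"
  assumes diff: "\<And>r. finite ({a - b | a b. a \<in> S \<and> b \<in> S} \<inter> {-r..r})"
    and e: "e > 0" and comb: "\<And>\<epsilon> z. \<epsilon> > 0 \<Longrightarrow> \<epsilon> + \<bar>z\<bar> \<le> e \<Longrightarrow> \<exists>c. \<forall>y. ((\<lambda>s. band \<epsilon> z (s - y)) has_sum c) S"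
  shows "\<exists>N::nat. \<forall>a\<in>S. \<forall>b\<in>S. (\<forall>d\<in>{- real N..0}. a + d \<in> S \<longleftrightarrow> b + d \<in> S) \<longrightarrow> (\<forall>d\<in>{0..M}. a + d \<in> S \<longleftrightarrow> b + d \<in> S)"
proof (rule ccontr)
  assume "\<not> ?thesis"
  then have "\<forall>N::nat. \<exists>a b d. a \<in> S \<and> b \<in> S \<and> (\<forall>d\<in>{- real N..0}. a + d \<in> S \<longleftrightarrow> b + d \<in> S)
      \<and> d \<in> {0..M} \<and> (a + d \<in> S) \<noteq> (b + d \<in> S)" by blast
  then obtain a b d where abd: "\<And>N::nat. a N \<in> S \<and> b N \<in> S \<and> (\<forall>d\<in>{- real N..0}. a N + d \<in> S \<longleftrightarrow> b N + d \<in> S)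
      \<and> d N \<in> {0..M} \<and> (a N + d N \<in> S) \<noteq> (b N + d N \<in> S)" by metis
  obtain \<rho> where \<rho>: "\<rho> > 0" and sep: "\<And>x y. x \<in> S \<Longrightarrow> y \<in> S \<Longrightarrow> x \<noteq> y \<Longrightarrow> \<bar>x - y\<bar> \<ge> \<rho>"
    using separated_if_differences_locally_finite[OF diff] by metis
  define \<Delta> where "\<Delta> = {a - b | a b. a \<in> S \<and> b \<in> S}"
  have fin: "finite (\<Delta> \<inter> {-r..r})" for r using diff by (simp add: \<Delta>_def)
  have in\<Delta>: "x \<in> \<Delta>" if "u \<in> S" "u + x \<in> S" for u x using that unfolding \<Delta>_def by force
  have "\<Delta> \<subseteq> (\<Union>n::nat. \<Delta> \<inter> {- real n..real n})"
  proof -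
    have "\<exists>n::nat. x \<in> {- real n..real n}" for x :: real
    proof -
      obtain n :: nat where "\<bar>x\<bar> \<le> real n" using real_arch_simple by blast
      then show ?thesis by (intro exI[of _ n]) auto
    qed
    then show ?thesis by auto
  qed
  moreover have "countable (\<Union>n::nat. \<Delta> \<inter> {- real n..real n})"
    by (intro countable_UN countableI_type countable_finite fin)
  ultimately have "countable \<Delta>" by (rule countable_subset)
  \<comment> \<open>Packing both indicators into one complex number yields a single subsequence
    along which both families of translates converge.\<close>
  define f where "f n x = Complex (if a n + x \<in> S then 1 else 0) (if b n + x \<in> S then 1 else 0)" for n x
  have f2: "norm (f n x) \<le> 2" for n x
  proof -
    have "norm (f n x) \<le> \<bar>Re (f n x)\<bar> + \<bar>Im (f n x)\<bar>" by (rule cmod_le)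
    also have "\<dots> \<le> 1 + 1" by (intro add_mono) (simp_all add: f_def)
    finally show ?thesis by simp
  qed
  have "\<exists>k :: nat \<Rightarrow> nat. strict_mono k \<and> (\<forall>x\<in>\<Delta>. \<exists>l. (\<lambda>n. f (k n) x) \<longlonglongrightarrow> l)"
  proof (rule function_convergent_subsequence[OF \<open>countable \<Delta>\<close> f2])
    fix k :: "nat \<Rightarrow> nat" assume "strict_mono k" "\<And>x. x \<in> \<Delta> \<Longrightarrow> \<exists>l. (\<lambda>n. f (k n) x) \<longlonglongrightarrow> l"
    then show ?thesis by (intro exI[of _ k] conjI ballI)
  qed
  then obtain k where k: "strict_mono (k :: nat \<Rightarrow> nat)" and conv: "\<And>x. x \<in> \<Delta> \<Longrightarrow> \<exists>l. (\<lambda>n. f (k n) x) \<longlonglongrightarrow> l" by blast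
  define A where "A = {x \<in> \<Delta>. \<forall>\<^sub>F n in sequentially. a (k n) + x \<in> S}"
  define B where "B = {x \<in> \<Delta>. \<forall>\<^sub>F n in sequentially. b (k n) + x \<in> S}"
  have limA: "\<forall>\<^sub>F n in sequentially. a (k n) + x \<in> S \<longleftrightarrow> x \<in> A" if x: "x \<in> \<Delta>" for x
  proof -
    obtain l where "(\<lambda>n. f (k n) x) \<longlonglongrightarrow> l" using conv[OF x] by blast
    from tendsto_Re[OF this] have "(\<lambda>n. if a (k n) + x \<in> S then 1 else 0) \<longlonglongrightarrow> Re l" by (simp add: f_def)
    from eventually_eq_limit_if_convergent[OF this] show ?thesis using x by (simp add: A_def)
  qed
  have limB: "\<forall>\<^sub>F n in sequentially. b (k n) + x \<in> S \<longleftrightarrow> x \<in> B" if x: "x \<in> \<Delta>" for x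
  proof -
    obtain l where "(\<lambda>n. f (k n) x) \<longlonglongrightarrow> l" using conv[OF x] by blast
    from tendsto_Im[OF this] have "(\<lambda>n. if b (k n) + x \<in> S then 1 else 0) \<longlonglongrightarrow> Im l" by (simp add: f_def)
    from eventually_eq_limit_if_convergent[OF this] show ?thesis using x by (simp add: B_def)
  qed
  have left: "x \<in> A \<longleftrightarrow> x \<in> B" if x: "x \<in> \<Delta>" "x \<le> 0" for x
  proof -
    obtain m :: nat where m: "- x \<le> real m" using real_arch_simple by blast
    have "\<forall>\<^sub>F n in sequentially. (a (k n) + x \<in> S \<longleftrightarrow> x \<in> A) \<and> (b (k n) + x \<in> S \<longleftrightarrow> x \<in> B) \<and> n \<ge> m"
      by (intro eventually_conj limA limB x eventually_ge_at_top)
    then obtain n where n: "a (k n) + x \<in> S \<longleftrightarrow> x \<in> A" "b (k n) + x \<in> S \<longleftrightarrow> x \<in> B" "n \<ge> m"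
      using eventually_happens'[OF sequentially_bot] by blast
    have "real m \<le> real (k n)" using n(3) seq_suble[OF k, of n] by linarith
    then have "x \<in> {- real (k n)..0}" using m x by simp
    then show ?thesis using abd[of "k n"] n by blast
  qed
  \<comment> \<open>The disagreements \<open>d N\<close> stay among the finitely many points of
    \<open>\<Delta>\<close> in \<open>{0..M}\<close>, so they are not lost in the limit.\<close>
  have "\<exists>x\<in>\<Delta> \<inter> {0..M}. (x \<in> A) \<noteq> (x \<in> B)"
  proof (rule ccontr)
    assume same: "\<not> ?thesis"
    have finM: "finite (\<Delta> \<inter> {0..M})" by (rule finite_subset[OF _ fin[of "\<bar>M\<bar>"]]) auto
    have "\<forall>\<^sub>F n in sequentially. \<forall>x\<in>\<Delta> \<inter> {0..M}. (a (k n) + x \<in> S \<longleftrightarrow> x \<in> A) \<and> (b (k n) + x \<in> S \<longleftrightarrow> x \<in> B)"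
      using limA limB by (intro eventually_ball_finite finM ballI eventually_conj) auto
    then obtain n where n: "\<And>x. x \<in> \<Delta> \<inter> {0..M} \<Longrightarrow> (a (k n) + x \<in> S \<longleftrightarrow> x \<in> A) \<and> (b (k n) + x \<in> S \<longleftrightarrow> x \<in> B)"
      using eventually_happens'[OF sequentially_bot] by blast
    have "d (k n) \<in> \<Delta> \<inter> {0..M}" using abd[of "k n"] in\<Delta> by blast
    then show False using n same abd[of "k n"] by blast
  qed
  define Z where "Z = {x \<in> \<Delta>. (x \<in> A) \<noteq> (x \<in> B)}"
  obtain x1 where x1: "x1 \<in> Z" using \<open>\<exists>x\<in>\<Delta> \<inter> {0..M}. (x \<in> A) \<noteq> (x \<in> B)\<close> by (auto simp: Z_def)
  have Zpos: "x > 0" if "x \<in> Z" for x using left that by (force simp: Z_def)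
  have finZ: "finite (Z \<inter> {..r})" for r
    by (rule finite_subset[OF _ fin[of r]]) (use Zpos in \<open>force simp: Z_def\<close>)
  define d0 where "d0 = Min (Z \<inter> {..x1})"
  have d0: "d0 \<in> Z \<inter> {..x1}" unfolding d0_def using finZ x1 by (intro Min_in) auto
  have d0_min: "x \<ge> d0" if "x \<in> Z" for x
  proof (cases "x \<le> x1")
    case True
    then show ?thesis unfolding d0_def using finZ that by (intro Min_le) auto
  next
    case False
    then show ?thesis using d0 by auto
  qed
  obtain \<gamma> where \<gamma>: "\<gamma> > 0" "\<And>x. x \<in> Z \<inter> {..d0 + 1} \<Longrightarrow> x \<noteq> d0 \<Longrightarrow> \<gamma> \<le> dist d0 x"
    using finite_set_avoid[OF finZ[of "d0 + 1"], of d0] by blast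
  have gap: "x \<ge> d0 + min \<gamma> 1" if "x \<in> Z" "x \<noteq> d0" for x
  proof (cases "x \<le> d0 + 1")
    case True
    then show ?thesis using \<gamma>(2)[of x] that d0_min[of x] by (auto simp: dist_real_def)
  qed auto
  \<comment> \<open>The bound \<open>e / 2\<close> leaves every \<open>z\<close> with
    \<open>\<bar>z\<bar> < e / 2\<close> admissible. The factor \<open>tri (\<epsilon> * d0)\<close>
    must not vanish, since the one-sided lemma only shows that its product with
    \<open>\<sigma> d0\<close> is zero.\<close>
  have "\<exists>\<epsilon>>0. \<epsilon> \<le> e / 2 \<and> tri (\<epsilon> * d0) \<noteq> 0"
  proof -
    have "isCont tri 0" using tri_continuous[of UNIV] by (simp add: continuous_on_eq_continuous_at)
    then have "\<forall>\<^sub>F x in at 0. tri x \<noteq> 0" using tri_0 by (simp add: isCont_def tendsto_imp_eventually_ne)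
    then obtain r where r: "r > 0" "\<And>x. x \<noteq> 0 \<Longrightarrow> \<bar>x\<bar> < r \<Longrightarrow> tri x \<noteq> 0" by (auto simp: eventually_at dist_real_def)
    define \<epsilon> where "\<epsilon> = min (e / 2) (r / (2 * d0))"
    have d0p: "d0 > 0" using d0 Zpos by auto
    have "\<epsilon> > 0" using e r d0p by (simp add: \<epsilon>_def)
    moreover have "\<epsilon> * d0 \<le> r / (2 * d0) * d0" using d0p by (intro mult_right_mono) (auto simp: \<epsilon>_def)
    then have "\<bar>\<epsilon> * d0\<bar> < r" using r(1) d0p \<open>\<epsilon> > 0\<close> by (simp add: abs_of_pos)
    then have "tri (\<epsilon> * d0) \<noteq> 0" using r(2)[of "\<epsilon> * d0"] d0p \<open>\<epsilon> > 0\<close> by simp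
    moreover have "\<epsilon> \<le> e / 2" by (simp add: \<epsilon>_def)
    ultimately show ?thesis by blast
  qed
  then obtain \<epsilon> where \<epsilon>: "\<epsilon> > 0" "\<epsilon> \<le> e / 2" "tri (\<epsilon> * d0) \<noteq> 0" by blast
  define \<sigma> where "\<sigma> x = (of_bool (x \<in> A) - of_bool (x \<in> B) :: complex)" for x
  have lims: "(\<lambda>x. norm (band \<epsilon> z x)) summable_on A \<and> (\<lambda>x. norm (band \<epsilon> z x)) summable_on B
      \<and> (\<exists>c. (band \<epsilon> z has_sum c) A \<and> (band \<epsilon> z has_sum c) B)" if z: "\<bar>z\<bar> < e / 2" for z
  proof -
    obtain c where c: "\<And>y. ((\<lambda>s. band \<epsilon> z (s - y)) has_sum c) S" using comb[OF \<epsilon>(1), of z] \<epsilon>(2) z by auto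
    have "A \<subseteq> \<Delta>" "B \<subseteq> \<Delta>" by (auto simp: A_def B_def)
    have sub: "x \<in> \<Delta>" if "a (k n) + x \<in> S" for n x using in\<Delta>[OF _ that] abd[of "k n"] by simp
    have sub': "x \<in> \<Delta>" if "b (k n) + x \<in> S" for n x using in\<Delta>[OF _ that] abd[of "k n"] by simp
    note 1 = comb_limit[OF \<rho> sep \<epsilon>(1) c fin sub \<open>A \<subseteq> \<Delta>\<close> limA]
      and 2 = comb_limit[OF \<rho> sep \<epsilon>(1) c fin sub' \<open>B \<subseteq> \<Delta>\<close> limB]
    show ?thesis by (intro conjI exI[of _ c] 1 2)
  qed
  have "\<sigma> d0 * tri (\<epsilon> * d0) = 0"
  proof (rule one_sided_exponential_sum[where D = Z and ?d0.0 = d0 and \<gamma> = "min \<gamma> 1" and r = "e / 2"])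
    have nb: "norm (band \<epsilon> 0 x) = norm (tri (\<epsilon> * x))" for x by (simp add: band_def)
    have "(\<lambda>x. norm (tri (\<epsilon> * x))) summable_on A \<union> B"
      using lims[of 0] e unfolding nb by (intro summable_on_union) auto
    then have Zs: "(\<lambda>x. norm (tri (\<epsilon> * x))) summable_on Z" by (rule summable_on_subset_banach) (auto simp: Z_def)
    have "norm (\<sigma> x * tri (\<epsilon> * x)) = norm (tri (\<epsilon> * x))" if "x \<in> Z" for x
      using that by (cases "x \<in> A") (auto simp: \<sigma>_def Z_def norm_mult)
    then have "(\<lambda>x. norm (\<sigma> x * tri (\<epsilon> * x))) summable_on Z \<longleftrightarrow> (\<lambda>x. norm (tri (\<epsilon> * x))) summable_on Z"
      by (rule summable_on_cong)
    then show "(\<lambda>x. norm (\<sigma> x * tri (\<epsilon> * x))) summable_on Z" using Zs by blast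
    show "((\<lambda>x. \<sigma> x * tri (\<epsilon> * x) * cis (z * x)) has_sum 0) Z" if z: "\<bar>z\<bar> < e / 2" for z
    proof -
      obtain c where c: "(band \<epsilon> z has_sum c) A" "(band \<epsilon> z has_sum c) B" using lims[OF z] by blast
      have "((\<lambda>x. of_bool (x \<in> A) * band \<epsilon> z x) has_sum c) \<Delta>"
        using c(1) by (subst has_sum_cong_neutral[where T = A and g = "band \<epsilon> z"]) (auto simp: A_def)
      moreover have "((\<lambda>x. of_bool (x \<in> B) * band \<epsilon> z x) has_sum c) \<Delta>"
        using c(2) by (subst has_sum_cong_neutral[where T = B and g = "band \<epsilon> z"]) (auto simp: B_def)
      \<comment> \<open>Both limits have the comb constant \<open>c\<close> of \<open>S\<close>, so
        it cancels for every \<open>z\<close> in the interval.\<close>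
      ultimately have "((\<lambda>x. of_bool (x \<in> A) * band \<epsilon> z x + (-1) * (of_bool (x \<in> B) * band \<epsilon> z x)) has_sum (c + (-1) * c)) \<Delta>"
        by (intro has_sum_add has_sum_cmult_right)
      then have "((\<lambda>x. \<sigma> x * tri (\<epsilon> * x) * cis (z * x)) has_sum 0) \<Delta>"
        by (simp add: \<sigma>_def band_def left_diff_distrib mult.assoc)
      then show ?thesis
        by (subst has_sum_cong_neutral[where T = \<Delta> and g = "\<lambda>x. \<sigma> x * tri (\<epsilon> * x) * cis (z * x)"]) (auto simp: Z_def \<sigma>_def)
    qed
    show "d0 \<in> Z" "d0 \<ge> 0" using d0 Zpos[of d0] by auto
    show "x \<ge> d0 + min \<gamma> 1" if "x \<in> Z" "x \<noteq> d0" for x by (rule gap[OF that])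
  qed (use e \<gamma> in auto)
  moreover have "\<sigma> d0 \<noteq> 0" using d0 by (auto simp: \<sigma>_def Z_def)
  ultimately show False using \<epsilon>(3) by simp
qed

lemma (in gabor_parseval) periodic_S:
  assumes S: "countable S"
  shows "periodic_set S"
proof -
  obtain W :: "real \<Rightarrow> real" where W: "integrable lborel W" "continuous_on UNIV W" "\<And>x. W x \<ge> 0" "\<And>y. ((\<lambda>s. W (s - y)) has_sum 1) S"
    by (rule spectral_tiling) blast
  obtain \<rho> where \<rho>: "\<rho> > 0" and sep: "\<And>x y. x \<in> S \<Longrightarrow> y \<in> S \<Longrightarrow> x \<noteq> y \<Longrightarrow> \<bar>x - y\<bar> \<ge> \<rho>"
    using separated_if_differences_locally_finite[OF S_differences_locally_finite] by metis
  obtain M where M: "\<And>x. S \<inter> {x<..x+M} \<noteq> {}"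
    using relatively_dense_if_tiling[OF W(1,3,4) S \<rho> sep] by metis
  obtain e where e: "e > 0" and comb: "\<forall>\<epsilon> z. \<epsilon> > 0 \<longrightarrow> \<epsilon> + \<bar>z\<bar> \<le> e \<longrightarrow> (\<exists>c. \<forall>y. ((\<lambda>s. band \<epsilon> z (s - y)) has_sum c) S)"
    by (rule smoothed_comb_constant[OF W S \<rho> sep]) blast
  obtain N :: nat where N: "\<forall>a\<in>S. \<forall>b\<in>S. (\<forall>d\<in>{- real N..0}. a + d \<in> S \<longleftrightarrow> b + d \<in> S) \<longrightarrow> (\<forall>d\<in>{0..M}. a + d \<in> S \<longleftrightarrow> b + d \<in> S)"
    using comb_deterministic[OF S_differences_locally_finite e comb[rule_format], of M] by blast
  show ?thesis
    by (rule periodic_set_if_deterministic[OF S_differences_locally_finite M, of "real N"]) (use N in blast)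
qed

theorem theorem1p1:
  fixes g :: "real \<Rightarrow> complex" and T S :: "real set"
  assumes "g \<in> L2"
    and "compact (ess_support g)"
    and "countable T" and "countable S"
    and "L2_orthonormal_basis (T \<times> S) (gabor g)"
  shows "periodic_set T \<and> periodic_set S"
proof -
  obtain g' L where "gabor_parseval g' T S L"
    using gabor_parseval_of_basis[OF assms(1,2,5)] by blast
  then interpret gabor_parseval g' T S L .
  show ?thesis using periodic_T periodic_S[OF assms(4)] by simp
qed

end
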